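(* Let $X$ be a finite set with conductances $C$ and nonzero killing measure $\kappa$ (transient case). Run Wilson's algorithm with root $\Delta$, for some ordering of $X$, and let $\Upsilon$ be the resulting random spanning tree of $X\cup\{\Delta\}$ and $\mathcal L_W$ the random set of loops erased during the algorithm. Then the network defined by $\mathcal L_W$ is independent of the random spanning tree $\Upsilon$, its distribution does not depend on the ordering, and it has the same distribution as the network defined by the loops of $\mathcal L_1$ (the Poissonian loop ensemble of intensity $\mu$).
   Context: Setting. $X$ is a finite set; $C_{x,y}=C_{y,x}\ge 0$ ($x\ne y$, $C_{x,x}=0$) are conductances such that the graph with edges $\{x,y\}$, $C_{x,y}>0$, is connected; $\kappa:X\to[0,\infty)$ is not identically zero. Put $\lambda_x=\kappa_x+\sum_yC_{x,y}$, $P^x_y=C_{x,y}/\lambda_x$, $P_t=\exp(t(P-I))$. The Markov chain $(x_t)$ has exponential holding times of parameter $1$, jumps from $x$ to $y\in X$ with probability $P^x_y$ and from $x$ to a cemetery point $\Delta$ with probability $\kappa_x/\lambda_x$. Loop ensemble. With $\mathbb P_t^{x,x}(A)=\frac1{\lambda_x}\mathbb P_x(A\cap\{x_t=x\})$ for sets $A$ of piecewise constant paths on $[0,t]$, the loop measure is $\mu=\sum_x\int_0^\infty\frac1t\mathbb P_t^{x,x}\lambda_x\,dt$, and $\mathcal L_1$ is a Poisson point process of loops of intensity $\mu$ (it contains loops reduced to a point). For a loop $l$ of duration $T(l)$, $\widehat l^{\,x}=\frac1{\lambda_x}\int_0^{T(l)}1_{\{l(s)=x\}}ds$, and $N_{x,y}(l)$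 is the number of jumps of $l$ from $x$ to $y$ (cyclically). Network. The network defined by a set of loops $\Lambda$ is the pair formed by its occupation field $\big(\sum_{l\in\Lambda}\widehat l^{\,x}\big)_{x\in X}$ and its traversal numbers $\big(\sum_{l\in\Lambda}N_{x,y}(l)\big)_{(x,y)}$, over ordered pairs with $C_{x,y}>0$. Wilson's algorithm. Start with the tree reduced to $\{\Delta\}$. At each step take the first point (in the ordering) not yet in the tree, run an independent copy of the chain from it until it hits the current tree, and add to the tree the loop erasure of this trajectory (loops removed in chronological order), oriented towards the root; continue until all points of $X$ are in the tree. The erased loops include holding times and may be reduced to points. Thus the network of $\mathcal L_W$ is given by: occupation field at $x$ equal to $\frac1{\lambda_x}$ times the total time spent at $x$ by all the trajectories (each stopped when it hits the current tree), and traversal number of $(x,y)$ equal to the total number of jumps from $x$ to $y$ made by the trajectories, minus $1$ if $(x,y)$ is an oriented edge of $\Upsilon$. *)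

theory Defs
  imports "HOL-Probability.Probability"
begin

text \<open>The vertex set is a finite type; the state space of the chain is its option type, where
  \<open>None\<close> is the cemetery point.\<close>

definition weight :: "('a::finite \<Rightarrow> 'a \<Rightarrow> real) \<Rightarrow> ('a \<Rightarrow> real) \<Rightarrow> 'a \<Rightarrow> real" where
  "weight C \<kappa> x = \<kappa> x + (\<Sum>y\<in>UNIV. C x y)"

definition jump_pmf :: "('a::finite \<Rightarrow> 'a \<Rightarrow> real) \<Rightarrow> ('a \<Rightarrow> real) \<Rightarrow> 'a option \<Rightarrow> 'a option pmf" where
  "jump_pmf C \<kappa> v = (case v of
     None \<Rightarrow> return_pmf None
   | Some x \<Rightarrow> embed_pmf (\<lambda>w. case w of None \<Rightarrow> \<kappa> x / weight C \<kappa> x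
                                      | Some y \<Rightarrow> C x y / weight C \<kappa> x))"

text \<open>A trajectory is the sequence of the successive states together with their holding times.\<close>

type_synonym 'a trajectory = "nat \<Rightarrow> 'a option \<times> real"

definition trajectory_space :: "'a trajectory measure" where
  "trajectory_space = (\<Pi>\<^sub>M n\<in>UNIV. count_space UNIV \<Otimes>\<^sub>M borel)"

text \<open>The law of the chain started at \<open>x\<close>. The jump chain is driven by independent arrows
  \<open>U (n, v)\<close>, the vertex visited after \<open>v\<close> if \<open>v\<close> is visited at step \<open>n\<close>; see
  \<open>emeasure_jump_chain_prefix\<close> below for its finite-dimensional distributions.\<close>

primrec jump_chain :: "(nat \<times> 'a option \<Rightarrow> 'a option) \<Rightarrow> 'a \<Rightarrow> nat \<Rightarrow> 'a option" where
  "jump_chain U x 0 = Some x"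
| "jump_chain U x (Suc n) = U (n, jump_chain U x n)"

definition arrow_measure ::
  "('a::finite \<Rightarrow> 'a \<Rightarrow> real) \<Rightarrow> ('a \<Rightarrow> real) \<Rightarrow> (nat \<times> 'a option \<Rightarrow> 'a option) measure" where
  "arrow_measure C \<kappa> = (\<Pi>\<^sub>M i\<in>UNIV. measure_pmf (jump_pmf C \<kappa> (snd i)))"

definition holding_measure :: "(nat \<Rightarrow> real) measure" where
  "holding_measure = (\<Pi>\<^sub>M n\<in>UNIV. density lborel (exponential_density 1))"

definition chain_law ::
  "('a::finite \<Rightarrow> 'a \<Rightarrow> real) \<Rightarrow> ('a \<Rightarrow> real) \<Rightarrow> 'a \<Rightarrow> 'a trajectory measure" where
  "chain_law C \<kappa> x =
     distr (arrow_measure C \<kappa> \<Otimes>\<^sub>M holding_measure) trajectory_space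
       (\<lambda>(U, \<tau>) n. (jump_chain U x n, \<tau> n))"

text \<open>A piecewise constant path on a bounded time interval is encoded as the list of its
  successive states with their holding times. The \<open>\<sigma>\<close>-algebra is the Borel one on the disjoint union
  of the spaces of lists of given length.\<close>

type_synonym 'a path = "('a option \<times> real) list"

definition path_space :: "'a path measure" where
  "path_space = vimage_algebra UNIV
     (\<lambda>l. (length l, \<lambda>i. if i < length l then l ! i else (None, 0)))
     (count_space UNIV \<Otimes>\<^sub>M (\<Pi>\<^sub>M i\<in>UNIV. count_space UNIV \<Otimes>\<^sub>M borel))"

definition duration :: "'a path \<Rightarrow> real" where
  "duration l = sum_list (map snd l)"

fun path_at :: "'a path \<Rightarrow> real \<Rightarrow> 'a option" where
  "path_at [] s = None"
| "path_at ((v, r) # l) s = (if s < r \<or> l = [] then v else path_at l (s - r))"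

definition local_time ::
  "('a::finite \<Rightarrow> 'a \<Rightarrow> real) \<Rightarrow> ('a \<Rightarrow> real) \<Rightarrow> 'a path \<Rightarrow> 'a \<Rightarrow> ennreal" where
  "local_time C \<kappa> l x =
     ennreal (1 / weight C \<kappa> x) *
     (\<integral>\<^sup>+ s. indicator {s \<in> {0..duration l}. path_at l s = Some x} s \<partial>lborel)"

text \<open>Only pairs of distinct vertices matter. The jump from the last state of the list to the first
  one is counted; it is not a proper jump if the path ends in the state it started from.\<close>

definition traversals :: "'a path \<Rightarrow> 'a \<Rightarrow> 'a \<Rightarrow> nat" where
  "traversals l x y =
     card {i. i < length l \<and> fst (l ! i) = Some x \<and> fst (l ! (Suc i mod length l)) = Some y}"

definition edge_pairs :: "('a \<Rightarrow> 'a \<Rightarrow> real) \<Rightarrow> ('a \<times> 'a) set" where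
  "edge_pairs C = {(x, y). C x y > 0}"

type_synonym 'a network = "('a \<Rightarrow> ennreal) \<times> ('a \<times> 'a \<Rightarrow> ennreal)"

definition network_space :: "('a \<Rightarrow> 'a \<Rightarrow> real) \<Rightarrow> 'a network measure" where
  "network_space C = (\<Pi>\<^sub>M x\<in>UNIV. borel) \<Otimes>\<^sub>M (\<Pi>\<^sub>M e\<in>edge_pairs C. borel)"

text \<open>The network of the family of loops \<open>l i\<close>, \<open>i \<in> I\<close>.\<close>

definition network ::
  "('a::finite \<Rightarrow> 'a \<Rightarrow> real) \<Rightarrow> ('a \<Rightarrow> real) \<Rightarrow> 'i set \<Rightarrow> ('i \<Rightarrow> 'a path) \<Rightarrow> 'a network" where
  "network C \<kappa> I l =
     (\<lambda>x. \<integral>\<^sup>+ i. local_time C \<kappa> (l i) x \<partial>count_space I,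
      \<lambda>(x, y)\<in>edge_pairs C. \<integral>\<^sup>+ i. of_nat (traversals (l i) x y) \<partial>count_space I)"

text \<open>The index of the holding interval that contains time \<open>t\<close> (arbitrary on the null event that
  the holding times sum up to at most \<open>t\<close>).\<close>

definition jump_count :: "real \<Rightarrow> 'a trajectory \<Rightarrow> nat" where
  "jump_count t z = (LEAST n. t < (\<Sum>i\<le>n. snd (z i)))"

definition state_at :: "real \<Rightarrow> 'a trajectory \<Rightarrow> 'a option" where
  "state_at t z = fst (z (jump_count t z))"

definition path_until :: "real \<Rightarrow> 'a trajectory \<Rightarrow> 'a path" where
  "path_until t z = (let n = jump_count t z in
     map z [0..<n] @ [(fst (z n), t - (\<Sum>i<n. snd (z i)))])"

definition bridge_measure ::
  "('a::finite \<Rightarrow> 'a \<Rightarrow> real) \<Rightarrow> ('a \<Rightarrow> real) \<Rightarrow> 'a \<Rightarrow> real \<Rightarrow> 'a path set \<Rightarrow> ennreal" where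
  "bridge_measure C \<kappa> x t A =
     ennreal (1 / weight C \<kappa> x) *
     emeasure (chain_law C \<kappa> x)
       {z \<in> space (chain_law C \<kappa> x). path_until t z \<in> A \<and> state_at t z = Some x}"

definition loop_measure ::
  "('a::finite \<Rightarrow> 'a \<Rightarrow> real) \<Rightarrow> ('a \<Rightarrow> real) \<Rightarrow> 'a path measure" where
  "loop_measure C \<kappa> = measure_of UNIV (sets path_space) (\<lambda>A. \<Sum>x\<in>UNIV.
     \<integral>\<^sup>+ t\<in>{0<..}. ennreal (1 / t) * bridge_measure C \<kappa> x t A * ennreal (weight C \<kappa> x) \<partial>lborel)"

text \<open>A Poisson point process as a random set of points; the intensities of interest
  have no atoms.\<close>

definition poisson_point_process :: "'w measure \<Rightarrow> 'b measure \<Rightarrow> ('w \<Rightarrow> 'b set) \<Rightarrow> bool" where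
  "poisson_point_process N \<mu> \<Lambda> \<longleftrightarrow>
     (let count = (\<lambda>A \<omega>. emeasure (count_space UNIV) (\<Lambda> \<omega> \<inter> A)) in
     prob_space N \<and>
     (\<forall>\<omega>\<in>space N. \<Lambda> \<omega> \<subseteq> space \<mu>) \<and>
     (\<forall>A\<in>sets \<mu>. count A \<in> borel_measurable N) \<and>
     (\<forall>A\<in>sets \<mu>. emeasure \<mu> A < \<infinity> \<longrightarrow>
        (\<forall>k::nat. measure N {\<omega> \<in> space N. count A \<omega> = of_nat k} =
           exp (- measure \<mu> A) * measure \<mu> A ^ k / fact k)) \<and>
     (\<forall>A\<in>sets \<mu>. emeasure \<mu> A = \<infinity> \<longrightarrow> (AE \<omega> in N. count A \<omega> = \<infinity>)) \<and>
     (\<forall>(n::nat) A. (\<forall>i<n. A i \<in> sets \<mu>) \<and> disjoint_family_on A {..<n} \<longrightarrow>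
        prob_space.indep_vars N (\<lambda>_. borel) (\<lambda>i. count (A i)) {..<n}))"

text \<open>Chronological loop erasure. The first component is the current self-avoiding path, the second
  one collects the erased loops. A loop erased on returning to \<open>v\<close> starts with the holding time of
  the previous visit to \<open>v\<close>; the holding time of the new visit remains with the path.\<close>

fun erase_step :: "'a option \<times> real \<Rightarrow> 'a path \<times> 'a path list \<Rightarrow> 'a path \<times> 'a path list" where
  "erase_step (v, r) (\<gamma>, L) =
     (if v \<in> fst ` set \<gamma>
      then (takeWhile (\<lambda>p. fst p \<noteq> v) \<gamma> @ [(v, r)], L @ [dropWhile (\<lambda>p. fst p \<noteq> v) \<gamma>])
      else (\<gamma> @ [(v, r)], L))"

text \<open>At the end, each vertex of the self-avoiding path leaves its remaining holding time as a loop
  reduced to a point.\<close>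

definition loop_erasure :: "'a path \<Rightarrow> 'a option list \<times> 'a path list" where
  "loop_erasure p = (let (\<gamma>, L) = fold erase_step p ([], []) in
     (map fst \<gamma>, L @ map (\<lambda>q. [q]) \<gamma>))"

text \<open>The tree is the set of its edges, oriented towards the root \<open>None\<close>. The hitting time
  is arbitrary on the null event that the tree is not hit.\<close>

definition tree_vertices :: "('a option \<times> 'a option) set \<Rightarrow> 'a option set" where
  "tree_vertices T = insert None (Field T)"

definition hitting_index :: "'a trajectory \<Rightarrow> 'a option set \<Rightarrow> nat" where
  "hitting_index z V = (LEAST n. fst (z n) \<in> V)"

definition wilson_step :: "('a \<Rightarrow> 'a trajectory) \<Rightarrow> 'a \<Rightarrow>
    ('a option \<times> 'a option) set \<times> 'a path list \<Rightarrow> ('a option \<times> 'a option) set \<times> 'a path list" where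
  "wilson_step z x = (\<lambda>(T, L).
     if Some x \<in> tree_vertices T then (T, L)
     else let h = hitting_index (z x) (tree_vertices T);
              (\<gamma>, L') = loop_erasure (map (z x) [0..<h])
          in (T \<union> set (zip \<gamma> (tl \<gamma> @ [fst (z x h)])), L @ L'))"

text \<open>Since every vertex is used at most once as a starting point, the algorithm is run with one
  trajectory \<open>z x\<close> for each starting point \<open>x\<close>. The list \<open>xs\<close> is the ordering of the vertices.\<close>

definition wilson :: "('a \<Rightarrow> 'a trajectory) \<Rightarrow> 'a list \<Rightarrow> ('a option \<times> 'a option) set \<times> 'a path list" where
  "wilson z xs = fold (wilson_step z) xs ({}, [])"

definition wilson_tree :: "('a \<Rightarrow> 'a trajectory) \<Rightarrow> 'a list \<Rightarrow> ('a option \<times> 'a option) set" where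
  "wilson_tree z xs = fst (wilson z xs)"

definition wilson_loops :: "('a \<Rightarrow> 'a trajectory) \<Rightarrow> 'a list \<Rightarrow> 'a path list" where
  "wilson_loops z xs = snd (wilson z xs)"

definition wilson_network :: "('a::finite \<Rightarrow> 'a \<Rightarrow> real) \<Rightarrow> ('a \<Rightarrow> real) \<Rightarrow>
    ('a \<Rightarrow> 'a trajectory) \<Rightarrow> 'a list \<Rightarrow> 'a network" where
  "wilson_network C \<kappa> z xs =
     network C \<kappa> {..<length (wilson_loops z xs)} (\<lambda>i. wilson_loops z xs ! i)"

definition independent_chains :: "('a::finite \<Rightarrow> 'a \<Rightarrow> real) \<Rightarrow> ('a \<Rightarrow> real) \<Rightarrow>
    'w measure \<Rightarrow> ('w \<Rightarrow> 'a \<Rightarrow> 'a trajectory) \<Rightarrow> bool" where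
  "independent_chains C \<kappa> M Z \<longleftrightarrow>
     prob_space M \<and>
     prob_space.indep_vars M (\<lambda>_. trajectory_space) (\<lambda>x \<omega>. Z \<omega> x) UNIV \<and>
     (\<forall>x. distr M trajectory_space (\<lambda>\<omega>. Z \<omega> x) = chain_law C \<kappa> x)"

text \<open>Independence of random variables with values in different types
  (cf. \<open>prob_space.indep_var_eq\<close>).\<close>

definition independent_rvs ::
  "'w measure \<Rightarrow> 'b measure \<Rightarrow> ('w \<Rightarrow> 'b) \<Rightarrow> 'c measure \<Rightarrow> ('w \<Rightarrow> 'c) \<Rightarrow> bool" where
  "independent_rvs M S X T Y \<longleftrightarrow>
     X \<in> measurable M S \<and> Y \<in> measurable M T \<and>
     prob_space.indep_set M
       (sigma_sets (space M) {X -` A \<inter> space M | A. A \<in> sets S})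
       (sigma_sets (space M) {Y -` A \<inter> space M | A. A \<in> sets T})"

lemma weight_pos:
  fixes C :: "'a::finite \<Rightarrow> 'a \<Rightarrow> real"
  assumes "\<And>x y. C x y \<ge> 0" "\<And>x y. (x, y) \<in> (edge_pairs C)\<^sup>*"
    "\<And>x. \<kappa> x \<ge> 0" "\<exists>x. \<kappa> x \<noteq> 0"
  shows "weight C \<kappa> x > 0"
proof (cases "\<kappa> x = 0")
  case False
  then have "\<kappa> x > 0" using assms(3)[of x] by simp
  then show ?thesis unfolding weight_def using assms(1) by (simp add: add_pos_nonneg sum_nonneg)
next
  case True
  then obtain z where "z \<noteq> x" using assms(4) by metis
  obtain y where "(x, y) \<in> edge_pairs C"
    by (rule converse_rtranclE[OF assms(2)[of x z]]) (use \<open>z \<noteq> x\<close> in auto)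
  then have "0 < C x y" by (simp add: edge_pairs_def)
  then have "0 < (\<Sum>y\<in>UNIV. C x y)" using assms(1) by (intro sum_pos2[of _ y]) auto
  then show ?thesis unfolding weight_def using assms(3)[of x] by simp
qed

lemma pmf_jump_pmf_Some:
  assumes "\<And>x y. C x y \<ge> 0" "\<And>x. \<kappa> x \<ge> 0" "weight C \<kappa> x > 0"
  shows "pmf (jump_pmf C \<kappa> (Some x)) None = \<kappa> x / weight C \<kappa> x"
    and "pmf (jump_pmf C \<kappa> (Some x)) (Some y) = C x y / weight C \<kappa> x"
proof -
  let ?f = "\<lambda>w. case w of None \<Rightarrow> \<kappa> x / weight C \<kappa> x | Some y \<Rightarrow> C x y / weight C \<kappa> x"
  have nn: "\<And>w. 0 \<le> ?f w" using assms by (auto split: option.split)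
  have "(\<integral>\<^sup>+ w. ennreal (?f w) \<partial>count_space UNIV) = (\<Sum>w\<in>UNIV. ennreal (?f w))"
    by (simp add: nn_integral_count_space_finite)
  also have "\<dots> = ennreal (\<Sum>w\<in>UNIV. ?f w)" using nn by (simp add: sum_ennreal)
  also have "(\<Sum>w\<in>UNIV. ?f w) = 1"
    using assms(3) by (simp add: UNIV_option_conv sum.reindex weight_def
        sum_divide_distrib[symmetric] add_divide_distrib[symmetric])
  finally have 1: "(\<integral>\<^sup>+ w. ennreal (?f w) \<partial>count_space UNIV) = 1" by simp
  show "pmf (jump_pmf C \<kappa> (Some x)) None = \<kappa> x / weight C \<kappa> x"
    "pmf (jump_pmf C \<kappa> (Some x)) (Some y) = C x y / weight C \<kappa> x"
    by (simp_all add: jump_pmf_def pmf_embed_pmf[OF nn 1])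
qed

lemma prob_space_arrow_measure: "prob_space (arrow_measure C \<kappa>)"
  unfolding arrow_measure_def by (intro prob_space_PiM measure_pmf.prob_space_axioms)

lemma prob_space_holding_measure: "prob_space holding_measure"
  unfolding holding_measure_def by (intro prob_space_PiM prob_space_exponential_density) simp

lemma measurable_jump_chain [measurable]:
  "(\<lambda>U. jump_chain U (x::'a::finite) n) \<in> measurable (arrow_measure C \<kappa>) (count_space UNIV)"
proof (induction n)
  case (Suc n)
  note [measurable] = Suc.IH
  have [measurable]: "(\<lambda>U. U (n, v)) \<in> measurable (arrow_measure C \<kappa>) (count_space UNIV)" for v
    unfolding arrow_measure_def using measurable_component_singleton[of "(n, v)" UNIV]
    by (force cong: measurable_cong_sets)
  show ?case unfolding jump_chain.simps
    by (rule measurable_compose_countable'[where I=UNIV]) (auto)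
qed simp

lemma emeasure_jump_chain_prefix:
  fixes x :: "'a::finite"
  assumes "p 0 = Some x"
  shows "emeasure (arrow_measure C \<kappa>) {U \<in> space (arrow_measure C \<kappa>). \<forall>i\<le>n. jump_chain U x i = p i} =
    (\<Prod>i<n. ennreal (pmf (jump_pmf C \<kappa> (p i)) (p (Suc i))))"
proof -
  let ?Q = "\<lambda>i::nat \<times> 'a option. measure_pmf (jump_pmf C \<kappa> (snd i))"
  interpret product_prob_space ?Q UNIV
    by (standard) (auto intro: prob_space_imp_sigma_finite measure_pmf.prob_space_axioms
        measure_pmf.sigma_finite_countable measure_pmf.emeasure_space_1)
  define J where "J = (\<lambda>i. (i, p i)) ` {..<n}"
  have inj: "inj_on (\<lambda>i. (i, p i)) {..<n}" by (rule inj_onI) simp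
  have "(\<forall>i\<le>n. jump_chain U x i = p i) \<longleftrightarrow> (\<forall>i<n. U (i, p i) = p (Suc i))" for U
    using assms by (induction n) (auto simp: less_Suc_eq le_Suc_eq)
  then have "{U \<in> space (arrow_measure C \<kappa>). \<forall>i\<le>n. jump_chain U x i = p i} =
    prod_emb UNIV ?Q J (\<Pi>\<^sub>E j\<in>J. {p (Suc (fst j))})"
    by (auto simp: arrow_measure_def prod_emb_def space_PiM J_def restrict_def PiE_def extensional_def Pi_iff)
  also have "emeasure (arrow_measure C \<kappa>) \<dots> = (\<Prod>j\<in>J. emeasure (?Q j) {p (Suc (fst j))})"
    unfolding arrow_measure_def J_def by (intro emeasure_PiM_emb) auto
  also have "\<dots> = (\<Prod>i<n. ennreal (pmf (jump_pmf C \<kappa> (p i)) (p (Suc i))))"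
    unfolding J_def by (simp add: prod.reindex[OF inj] emeasure_pmf_single)
  finally show ?thesis .
qed

lemma measurable_chain [measurable]:
  "(\<lambda>(U, \<tau>) n. (jump_chain U (x::'a::finite) n, \<tau> n))
     \<in> measurable (arrow_measure C \<kappa> \<Otimes>\<^sub>M holding_measure) trajectory_space"
proof -
  have [measurable]: "(\<lambda>\<tau>. \<tau> n) \<in> measurable holding_measure borel" for n
    unfolding holding_measure_def using measurable_component_singleton[of n UNIV]
    by (force cong: measurable_cong_sets)
  have "(\<lambda>p. (jump_chain (fst p) x n, snd p n))
      \<in> measurable (arrow_measure C \<kappa> \<Otimes>\<^sub>M holding_measure) (count_space UNIV \<Otimes>\<^sub>M borel)" for n
    by measurable
  then show ?thesis unfolding trajectory_space_def case_prod_beta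
    by (intro measurable_PiM_single') (auto simp: space_pair_measure)
qed

lemma sets_chain_law [measurable_cong]: "sets (chain_law C \<kappa> x) = sets trajectory_space"
  by (simp add: chain_law_def)

lemma prob_space_chain_law: "prob_space (chain_law C \<kappa> (x::'a::finite))"
proof -
  interpret a: prob_space "arrow_measure C \<kappa>" by (rule prob_space_arrow_measure)
  interpret h: prob_space holding_measure by (rule prob_space_holding_measure)
  interpret pair_prob_space "arrow_measure C \<kappa>" holding_measure ..
  show ?thesis unfolding chain_law_def by (rule prob_space_distr) measurable
qed

lemma measurable_trajectory [measurable]:
  "(\<lambda>z. z n) \<in> measurable (trajectory_space :: 'a trajectory measure) (count_space UNIV \<Otimes>\<^sub>M borel)"
  unfolding trajectory_space_def by measurable

lemma space_path_space [simp]: "space path_space = UNIV"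
  by (simp add: path_space_def)

lemma measurable_jump_count:
  "(\<lambda>(t, z). jump_count t z) \<in> measurable (borel \<Otimes>\<^sub>M (trajectory_space :: 'a trajectory measure)) (count_space UNIV)"
  unfolding jump_count_def by measurable

lemma measurable_path_until:
  "(\<lambda>(t, z). path_until t z) \<in> measurable (borel \<Otimes>\<^sub>M (trajectory_space :: 'a trajectory measure)) path_space"
proof -
  let ?B = "borel \<Otimes>\<^sub>M (trajectory_space :: 'a trajectory measure)"
  let ?P = "\<lambda>n (t, z). map z [0..<n] @ [(fst (z n), t - (\<Sum>i<n. snd (z i)))] :: 'a path"
  have 1: "?P n \<in> measurable ?B path_space" for n
  proof -
    let ?g = "\<lambda>i x. if i < n then snd x i else if i = n
        then (fst (snd x n), fst x - (\<Sum>i<n. snd (snd x i))) else (None, 0) :: 'a option \<times> real"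
    have [measurable]: "(\<lambda>x. ?g i x) \<in> measurable ?B (count_space UNIV \<Otimes>\<^sub>M borel)" for i
      by (cases "i < n"; cases "i = n") measurable
    have *: "(\<lambda>x. (length (?P n x), \<lambda>i. if i < length (?P n x) then ?P n x ! i else (None, 0)))
        = (\<lambda>x. (Suc n, \<lambda>i. ?g i x))"
      by (auto simp: fun_eq_iff nth_append split: prod.split)
    have "(\<lambda>x i. ?g i x) \<in> measurable ?B (\<Pi>\<^sub>M i\<in>UNIV. count_space UNIV \<Otimes>\<^sub>M borel)"
      by (rule measurable_PiM_single') (auto simp: space_pair_measure)
    then have "(\<lambda>x. (Suc n, \<lambda>i. ?g i x))
        \<in> measurable ?B (count_space UNIV \<Otimes>\<^sub>M (\<Pi>\<^sub>M i\<in>UNIV. count_space UNIV \<Otimes>\<^sub>M borel))"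
      by (intro measurable_Pair) simp_all
    then show ?thesis unfolding path_space_def
      by (intro measurable_vimage_algebra2) (simp_all only: *, simp)
  qed
  have "(\<lambda>x. ?P (case x of (t, z) \<Rightarrow> jump_count t z) x) \<in> measurable ?B path_space"
    by (rule measurable_compose_countable[OF 1 measurable_jump_count])
  also have "(\<lambda>x. ?P (case x of (t, z) \<Rightarrow> jump_count t z) x) = (\<lambda>(t, z). path_until t z)"
    by (auto simp: path_until_def Let_def fun_eq_iff)
  finally show ?thesis .
qed

lemma measurable_state_at:
  "(\<lambda>(t, z). state_at t z) \<in> measurable (borel \<Otimes>\<^sub>M (trajectory_space :: 'a trajectory measure)) (count_space UNIV)"
proof -
  let ?B = "borel \<Otimes>\<^sub>M (trajectory_space :: 'a trajectory measure)"
  have 1: "(\<lambda>x. fst (snd x n)) \<in> measurable ?B (count_space UNIV)" for n by measurable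
  show ?thesis
    using measurable_compose_countable[OF 1 measurable_jump_count]
    by (simp add: state_at_def case_prod_beta)
qed

lemma sets_loop_measure [measurable_cong]: "sets (loop_measure C \<kappa>) = sets path_space"
  using sets.sigma_sets_eq[of path_space] by (simp add: loop_measure_def)

lemma emeasure_loop_measure:
  fixes C :: "'a::finite \<Rightarrow> 'a \<Rightarrow> real"
  assumes "A \<in> sets path_space"
  shows "emeasure (loop_measure C \<kappa>) A = (\<Sum>x\<in>UNIV.
     \<integral>\<^sup>+ t\<in>{0<..}. ennreal (1 / t) * bridge_measure C \<kappa> x t A * ennreal (weight C \<kappa> x) \<partial>lborel)"
proof -
  let ?S = "\<lambda>x t A. {z \<in> space (chain_law C \<kappa> x). path_until t z \<in> A \<and> state_at t z = Some x}"
  let ?f = "\<lambda>x t A. ennreal (1 / t) * bridge_measure C \<kappa> x t A * ennreal (weight C \<kappa> x)"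
  have [measurable]: "{z \<in> space (borel \<Otimes>\<^sub>M trajectory_space :: (real \<times> 'a trajectory) measure).
      path_until (fst z) (snd z) \<in> A \<and> state_at (fst z) (snd z) = Some x}
      \<in> sets (borel \<Otimes>\<^sub>M trajectory_space)" if [measurable]: "A \<in> sets path_space" for A x
  proof -
    have [measurable]: "(\<lambda>z. path_until (fst z) (snd z)) \<in> measurable (borel \<Otimes>\<^sub>M trajectory_space) path_space"
      "(\<lambda>z. state_at (fst z) (snd z)) \<in> measurable (borel \<Otimes>\<^sub>M (trajectory_space::'a trajectory measure)) (count_space UNIV)"
      using measurable_path_until measurable_state_at by (simp_all add: case_prod_beta')
    show ?thesis by measurable
  qed
  note Q = this
  have S: "?S x t A \<in> sets (chain_law C \<kappa> x)" if "A \<in> sets path_space" for x t A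
    using measurable_sets[OF measurable_Pair1'[of t borel trajectory_space] Q[OF that, of x]]
    by (simp add: sets_chain_law vimage_def space_pair_measure Int_def conj_ac
        sets_eq_imp_space_eq[OF sets_chain_law])
  have meas: "(\<lambda>t. bridge_measure C \<kappa> x t A) \<in> borel_measurable lborel"
    if "A \<in> sets path_space" for x A
  proof -
    interpret prob_space "chain_law C \<kappa> x" by (rule prob_space_chain_law)
    have "(\<lambda>t. emeasure (chain_law C \<kappa> x) (Pair t -` {z \<in> space (borel \<Otimes>\<^sub>M trajectory_space).
      path_until (fst z) (snd z) \<in> A \<and> state_at (fst z) (snd z) = Some x})) \<in> borel_measurable borel"
      by (intro measurable_emeasure_Pair) (use Q[OF that] in \<open>simp add: sets_chain_law cong: sets_pair_measure_cong\<close>)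
    also have "(\<lambda>t. emeasure (chain_law C \<kappa> x) (Pair t -` {z \<in> space (borel \<Otimes>\<^sub>M trajectory_space).
      path_until (fst z) (snd z) \<in> A \<and> state_at (fst z) (snd z) = Some x})) =
      (\<lambda>t. emeasure (chain_law C \<kappa> x) (?S x t A))"
      by (simp add: vimage_def space_pair_measure sets_eq_imp_space_eq[OF sets_chain_law])
    finally show ?thesis unfolding bridge_measure_def by measurable
  qed
  show ?thesis
  proof (rule emeasure_measure_of[OF loop_measure_def])
    show "sets (path_space :: 'a path measure) \<subseteq> Pow UNIV" by simp
    show "A \<in> sets (loop_measure C \<kappa>)" using assms by (simp add: sets_loop_measure)
    show "positive (sets (loop_measure C \<kappa>)) (\<lambda>A. \<Sum>x\<in>UNIV. \<integral>\<^sup>+ t\<in>{0<..}. ?f x t A \<partial>lborel)"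
      by (simp add: positive_def bridge_measure_def)
    show "countably_additive (sets (loop_measure C \<kappa>)) (\<lambda>A. \<Sum>x\<in>UNIV. \<integral>\<^sup>+ t\<in>{0<..}. ?f x t A \<partial>lborel)"
    proof (rule countably_additiveI)
      fix B :: "nat \<Rightarrow> 'a path set"
      assume B: "range B \<subseteq> sets (loop_measure C \<kappa>)" and d: "disjoint_family B"
      then have Bm: "B i \<in> sets path_space" for i by (auto simp: sets_loop_measure)
      have add: "(\<Sum>i. bridge_measure C \<kappa> x t (B i)) = bridge_measure C \<kappa> x t (\<Union>i. B i)" for x t
      proof -
        have "(\<Sum>i. emeasure (chain_law C \<kappa> x) (?S x t (B i))) =
            emeasure (chain_law C \<kappa> x) (\<Union>i. ?S x t (B i))"
          using d S[OF Bm] by (intro suminf_emeasure) (auto simp: disjoint_family_on_def)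
        also have "(\<Union>i. ?S x t (B i)) = ?S x t (\<Union>i. B i)" by auto
        finally show ?thesis by (simp add: bridge_measure_def)
      qed
      have "(\<Sum>i. \<Sum>x\<in>UNIV. \<integral>\<^sup>+ t\<in>{0<..}. ?f x t (B i) \<partial>lborel) =
        (\<Sum>x\<in>UNIV. \<Sum>i. \<integral>\<^sup>+ t\<in>{0<..}. ?f x t (B i) \<partial>lborel)"
        by (rule suminf_sum) simp
      also have "\<dots> = (\<Sum>x\<in>UNIV. \<integral>\<^sup>+ t. (\<Sum>i. ?f x t (B i) * indicator {0<..} t) \<partial>lborel)"
      proof (rule sum.cong[OF refl], rule nn_integral_suminf[symmetric])
        fix x i
        note [measurable] = meas[OF Bm]
        show "(\<lambda>t. ?f x t (B i) * indicator {0<..} t) \<in> borel_measurable lborel" by measurable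
      qed
      also have "\<dots> = (\<Sum>x\<in>UNIV. \<integral>\<^sup>+ t\<in>{0<..}. ?f x t (\<Union>i. B i) \<partial>lborel)"
        by (simp add: add)
      finally show "(\<Sum>i. \<Sum>x\<in>UNIV. \<integral>\<^sup>+ t\<in>{0<..}. ?f x t (B i) \<partial>lborel) =
        (\<Sum>x\<in>UNIV. \<integral>\<^sup>+ t\<in>{0<..}. ?f x t (\<Union>i. B i) \<partial>lborel)" .
    qed
  qed
qed

fun path_jumps :: "'a option list \<Rightarrow> 'a \<Rightarrow> 'a \<Rightarrow> nat" where
  "path_jumps (u # v # vs) x y = of_bool (u = Some x \<and> v = Some y) + path_jumps (v # vs) x y"
| "path_jumps vs x y = 0"

lemma path_jumps_conv:
  "path_jumps vs x y = card {i. Suc i < length vs \<and> vs ! i = Some x \<and> vs ! Suc i = Some y}"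
proof (induction vs x y rule: path_jumps.induct)
  case (1 u v vs x y)
  let ?A = "{i. Suc i < length (v # vs) \<and> (v # vs) ! i = Some x \<and> (v # vs) ! Suc i = Some y}"
  have "{i. Suc i < length (u # v # vs) \<and> (u # v # vs) ! i = Some x \<and> (u # v # vs) ! Suc i = Some y}
    = (if u = Some x \<and> v = Some y then {0} else {}) \<union> Suc ` ?A" (is "?L = ?R")
  proof (rule set_eqI)
    show "i \<in> ?L \<longleftrightarrow> i \<in> ?R" for i by (cases i) auto
  qed
  moreover have "finite ?A" by (rule finite_subset[of _ "{..length vs}"]) auto
  ultimately show ?case using 1 by (simp add: card_Un_disjoint card_image)
qed auto

lemma path_jumps_append:
  "path_jumps (us @ v # vs) x y = path_jumps (us @ [v]) x y + path_jumps (v # vs) x y"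
proof (induction us)
  case (Cons u us) then show ?case by (cases us) auto
qed simp

lemma traversals_conv:
  assumes "l \<noteq> []"
  shows "traversals l x y = path_jumps (map fst l @ [fst (hd l)]) x y"
  unfolding traversals_def path_jumps_conv
proof (rule arg_cong[of _ _ card], rule Collect_cong)
  fix i
  have "fst (l ! (Suc i mod length l)) = (map fst l @ [fst (hd l)]) ! Suc i" if "i < length l"
    using that assms by (cases "Suc i = length l") (auto simp: nth_append hd_conv_nth)
  then show "(i < length l \<and> fst (l ! i) = Some x \<and> fst (l ! (Suc i mod length l)) = Some y) \<longleftrightarrow>
    (Suc i < length (map fst l @ [fst (hd l)]) \<and> (map fst l @ [fst (hd l)]) ! i = Some x \<and>
      (map fst l @ [fst (hd l)]) ! Suc i = Some y)"
    by (auto simp: nth_append)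
qed

lemma erase_step_jumps:
  assumes "erase_step (v, r) (\<gamma>, L) = (\<gamma>', L')"
  shows "path_jumps (map fst \<gamma> @ [v]) x y + (\<Sum>l\<leftarrow>L. traversals l x y) =
    path_jumps (map fst \<gamma>') x y + (\<Sum>l\<leftarrow>L'. traversals l x y)"
proof (cases "v \<in> fst ` set \<gamma>")
  case True
  let ?a = "takeWhile (\<lambda>p. fst p \<noteq> v) \<gamma>" and ?b = "dropWhile (\<lambda>p. fst p \<noteq> v) \<gamma>"
  from True have ne: "?b \<noteq> []" by (auto simp: dropWhile_eq_Nil_conv)
  have hd: "fst (hd ?b) = v" using hd_dropWhile[OF ne] by simp
  have "map fst \<gamma> = map fst ?a @ map fst ?b" by (simp flip: map_append)
  also have "map fst ?b = v # map fst (tl ?b)" using ne hd by (cases ?b) auto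
  finally have "path_jumps (map fst \<gamma> @ [v]) x y =
    path_jumps (map fst ?a @ [v]) x y + path_jumps (map fst ?b @ [v]) x y"
    using path_jumps_append[of "map fst ?a" v "map fst (tl ?b) @ [v]" x y] ne hd
    by (cases ?b) auto
  moreover from True assms have "\<gamma>' = ?a @ [(v, r)]" "L' = L @ [?b]" by auto
  ultimately show ?thesis using traversals_conv[OF ne, of x y] hd by simp
qed (use assms in auto)

lemma traversals_point: "x \<noteq> y \<Longrightarrow> traversals [q] x y = 0"
  by (simp add: traversals_conv)

lemma loop_erasure_traversals_aux:
  "fold erase_step p (\<gamma>, L) = (\<gamma>', L') \<Longrightarrow>
   path_jumps (map fst \<gamma> @ map fst p @ [w]) x y + (\<Sum>l\<leftarrow>L. traversals l x y) =
   path_jumps (map fst \<gamma>' @ [w]) x y + (\<Sum>l\<leftarrow>L'. traversals l x y)"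
proof (induction p arbitrary: \<gamma> L)
  case (Cons q p)
  obtain v r where q: "q = (v, r)" by force
  obtain \<gamma>1 L1 where s: "erase_step (v, r) (\<gamma>, L) = (\<gamma>1, L1)" by force
  obtain u where u: "map fst \<gamma>1 = u @ [v]" using s by (auto split: if_splits)
  obtain a as where a: "map fst p @ [w] = a # as" by (cases p) auto
  have "path_jumps (map fst \<gamma> @ [v] @ a # as) x y = path_jumps (map fst \<gamma> @ [v]) x y + path_jumps (v # a # as) x y"
    using path_jumps_append[of "map fst \<gamma>" v "a # as"] by simp
  moreover have "path_jumps (u @ [v] @ a # as) x y = path_jumps (u @ [v]) x y + path_jumps (v # a # as) x y"
    using path_jumps_append[of u v "a # as"] by simp
  ultimately show ?case using Cons.IH[of \<gamma>1 L1] Cons.prems erase_step_jumps[OF s, of x y] u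
    by (simp add: q s a del: erase_step.simps)
qed simp

text \<open>The number of jumps of a trajectory equals the number of traversals by its erased loops plus
  the number of traversals by its loop erasure.\<close>

lemma loop_erasure_traversals:
  assumes "loop_erasure p = (\<gamma>, L)" "x \<noteq> y"
  shows "path_jumps (map fst p @ [w]) x y =
    (\<Sum>l\<leftarrow>L. traversals l x y) + path_jumps (\<gamma> @ [w]) x y"
proof -
  obtain \<gamma>' L' where f: "fold erase_step p ([], []) = (\<gamma>', L')" by force
  with assms(1) have *: "\<gamma> = map fst \<gamma>'" "L = L' @ map (\<lambda>q. [q]) \<gamma>'"
    by (auto simp: loop_erasure_def)
  have "(\<Sum>q\<leftarrow>\<gamma>'. traversals [q] x y) = 0"
    using assms(2) by (induction \<gamma>') (auto simp: traversals_point)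
  then show ?thesis using loop_erasure_traversals_aux[OF f, of w x y] * by (simp add: o_def)
qed

lemma distinct_loop_erasure: "distinct (fst (loop_erasure p))"
proof -
  have "distinct (map fst \<gamma>) \<Longrightarrow> distinct (map fst (fst (fold erase_step p (\<gamma>, L))))" for \<gamma> L
  proof (induction p arbitrary: \<gamma> L)
    case (Cons q p)
    obtain v r where q: "q = (v, r)" by force
    obtain \<gamma>1 L1 where s: "erase_step (v, r) (\<gamma>, L) = (\<gamma>1, L1)" by force
    have "map fst (takeWhile (\<lambda>p. fst p \<noteq> v) \<gamma>) = takeWhile (\<lambda>u. u \<noteq> v) (map fst \<gamma>)"
      by (simp add: takeWhile_map o_def)
    then have "distinct (map fst (takeWhile (\<lambda>p. fst p \<noteq> v) \<gamma>))"
      using Cons.prems by simp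
    then have "distinct (map fst \<gamma>1)" using s Cons.prems
      by (auto split: if_splits dest: set_takeWhileD)
    then show ?case using Cons.IH by (simp add: q s del: erase_step.simps)
  qed simp
  from this[of "[]"] show ?thesis by (auto simp: loop_erasure_def split: prod.split)
      (metis fst_conv)
qed

lemma local_time_conv:
  assumes "\<And>q. q \<in> set l \<Longrightarrow> snd q \<ge> 0"
  shows "local_time C \<kappa> l x =
    ennreal (1 / weight C \<kappa> x) * (\<Sum>q\<leftarrow>l. if fst q = Some x then ennreal (snd q) else 0)"
proof -
  let ?I = "\<lambda>l. \<integral>\<^sup>+ s. indicator {s \<in> {0..duration l}. path_at l s = Some x} s \<partial>lborel"
  have m: "{s. path_at l s = v} \<in> sets borel" for l v
  proof (induction l)
    case (Cons q l)
    obtain u r where q: "q = (u, r)" by force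
    have "{s. path_at (q # l) s = v} = (if u = v then (if l = [] then UNIV else {..<r}) else {}) \<union>
        (if l = [] then {} else {r..} \<inter> (\<lambda>s. s - r) -` {s. path_at l s = v})"
      by (auto simp: q)
    moreover have "(\<lambda>s. s - r) -` {s. path_at l s = v} \<in> sets borel"
      using measurable_sets[OF _ Cons.IH, of "\<lambda>s. s - r" borel] by simp
    ultimately show ?case by simp
  qed (cases v; simp)
  have mI: "indicator {s \<in> {0..duration l}. path_at l s = Some x}
      \<in> borel_measurable (borel :: real measure)" for l
  proof -
    have "{s \<in> {0..duration l}. path_at l s = Some x} = {0..duration l} \<inter> {s. path_at l s = Some x}"
      by auto
    then show ?thesis using m[of l "Some x"] by (intro borel_measurable_indicator) auto
  qed
  have d: "0 \<le> duration l" if "\<And>q. q \<in> set l \<Longrightarrow> snd q \<ge> 0" for l :: "'a path"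
    unfolding duration_def using that by (intro sum_list_nonneg) auto
  have "?I l = (\<Sum>q\<leftarrow>l. if fst q = Some x then ennreal (snd q) else 0)"
    using assms
  proof (induction l)
    case Nil
    then show ?case by simp
  next
    case (Cons q l)
    obtain u r where q: "q = (u, r)" by force
    have r: "r \<ge> 0" using Cons.prems[of q] by (simp add: q)
    have d0: "0 \<le> duration l" using Cons.prems by (intro d) auto
    have dq: "duration (q # l) = r + duration l" by (simp add: duration_def q)
    show ?case
    proof (cases "l = []")
      case True
      then have "{s \<in> {0..duration (q # l)}. path_at (q # l) s = Some x} = (if u = Some x then {0..r} else {})"
        by (auto simp: q duration_def)
      then show ?thesis using r by (simp add: True q)
    next
      case False
      have "?I (q # l) = (\<integral>\<^sup>+ s. (if u = Some x then indicator {0..<r} s else 0) +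
        indicator {s \<in> {0..duration l}. path_at l s = Some x} (- r + 1 * s) \<partial>lborel)"
        using False r d0 by (intro nn_integral_cong) (auto simp: q dq[unfolded q] indicator_def)
      also have "\<dots> = (\<integral>\<^sup>+ s. (if u = Some x then indicator {0..<r} s else 0) \<partial>lborel) +
        (\<integral>\<^sup>+ s. indicator {s \<in> {0..duration l}. path_at l s = Some x} (- r + 1 * s) \<partial>lborel)"
        using mI by (intro nn_integral_add measurable_compose[OF _ mI[of l]]) auto
      also have "(\<integral>\<^sup>+ s. indicator {s \<in> {0..duration l}. path_at l s = Some x} (- r + 1 * s) \<partial>lborel) = ?I l"
        using nn_integral_real_affine[OF mI[of l], of 1 "- r"] by simp
      finally have *: "?I (q # l) = (\<integral>\<^sup>+ s. (if u = Some x then indicator {0..<r} s else 0) \<partial>lborel) + ?I l" .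
      have IH: "?I l = (\<Sum>q\<leftarrow>l. if fst q = Some x then ennreal (snd q) else 0)"
        by (rule Cons.IH) (rule Cons.prems, simp)
      show ?thesis unfolding * IH using r by (cases "u = Some x") (simp_all add: q)
    qed
  qed
  then show ?thesis by (simp add: local_time_def)
qed

text \<open>The erased loops account for the whole time spent by the trajectory.\<close>

lemma loop_erasure_local_time:
  assumes "loop_erasure p = (\<gamma>, L)" "\<And>q. q \<in> set p \<Longrightarrow> snd q \<ge> 0"
  shows "(\<Sum>l\<leftarrow>L. local_time C \<kappa> l x) = local_time C \<kappa> p x"
proof -
  let ?t = "\<lambda>l :: 'a path. \<Sum>q\<leftarrow>l. if fst q = Some x then ennreal (snd q) else 0"
  define nn where "nn l \<longleftrightarrow> (\<forall>q\<in>set l. snd q \<ge> (0::real))" for l :: "'a path"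
  have *: "fold erase_step p (\<gamma>, L) = (\<gamma>', L') \<Longrightarrow> nn p \<Longrightarrow> nn \<gamma> \<Longrightarrow> (\<forall>l\<in>set L. nn l) \<Longrightarrow>
     ?t \<gamma> + ?t p + (\<Sum>l\<leftarrow>L. ?t l) = ?t \<gamma>' + (\<Sum>l\<leftarrow>L'. ?t l) \<and> nn \<gamma>' \<and> (\<forall>l\<in>set L'. nn l)" for p \<gamma> L \<gamma>' L'
  proof (induction p arbitrary: \<gamma> L)
    case (Cons q p)
    obtain v r where q: "q = (v, r)" by force
    obtain \<gamma>1 L1 where s: "erase_step (v, r) (\<gamma>, L) = (\<gamma>1, L1)" by force
    have "?t \<gamma> = ?t (takeWhile (\<lambda>p. fst p \<noteq> v) \<gamma>) + ?t (dropWhile (\<lambda>p. fst p \<noteq> v) \<gamma>)"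
      by (simp flip: sum_list_append map_append)
    then have "?t \<gamma> + ?t [q] + (\<Sum>l\<leftarrow>L. ?t l) = ?t \<gamma>1 + (\<Sum>l\<leftarrow>L1. ?t l)"
      using s by (auto simp: q ac_simps split: if_splits)
    moreover have "nn (takeWhile (\<lambda>p. fst p \<noteq> v) \<gamma>)" "nn (dropWhile (\<lambda>p. fst p \<noteq> v) \<gamma>)"
      using Cons.prems by (auto simp: nn_def dest: set_takeWhileD set_dropWhileD)
    then have "nn \<gamma>1" "\<forall>l\<in>set L1. nn l"
      using s Cons.prems by (auto simp: nn_def q split: if_splits) fastforce+
    moreover have "nn p" using Cons.prems by (simp add: nn_def)
    moreover have "?t \<gamma> + ?t (q # p) + (\<Sum>l\<leftarrow>L. ?t l) = (?t \<gamma> + ?t [q] + (\<Sum>l\<leftarrow>L. ?t l)) + ?t p"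
      by (simp add: ac_simps)
    moreover have "?t \<gamma>1 + ?t p + (\<Sum>l\<leftarrow>L1. ?t l) = (?t \<gamma>1 + (\<Sum>l\<leftarrow>L1. ?t l)) + ?t p"
      by (simp only: ac_simps)
    moreover have "fold erase_step p (\<gamma>1, L1) = (\<gamma>', L')"
      using Cons.prems s by (simp add: q del: erase_step.simps)
    ultimately show ?case using Cons.IH[of \<gamma>1 L1] by (simp only: simp_thms) blast
  qed simp
  obtain \<gamma>' L' where f: "fold erase_step p ([], []) = (\<gamma>', L')" by force
  with assms(1) have L: "L = L' @ map (\<lambda>q. [q]) \<gamma>'"
    by (auto simp: loop_erasure_def)
  have p: "nn p" using assms(2) by (simp add: nn_def)
  have t: "?t p = ?t \<gamma>' + (\<Sum>l\<leftarrow>L'. ?t l)" and nn: "nn \<gamma>'" "\<forall>l\<in>set L'. nn l"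
    using *[OF f p] by (auto simp: nn_def)
  have lt: "local_time C \<kappa> l x = ennreal (1 / weight C \<kappa> x) * ?t l" if "nn l" for l
    using that by (intro local_time_conv) (auto simp: nn_def)
  have "\<forall>l\<in>set L. nn l" using nn by (auto simp: L nn_def)
  then have "(\<Sum>l\<leftarrow>L. local_time C \<kappa> l x) = (\<Sum>l\<leftarrow>L. ennreal (1 / weight C \<kappa> x) * ?t l)"
    by (intro arg_cong[of _ _ sum_list] map_cong) (auto simp: lt)
  also have "\<dots> = ennreal (1 / weight C \<kappa> x) * (\<Sum>l\<leftarrow>L. ?t l)"
    by (rule sum_list_const_mult)
  also have "(\<Sum>l\<leftarrow>L. ?t l) = ?t p" by (simp add: L t o_def add.commute)
  finally show ?thesis by (simp add: lt[OF p])
qed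

end

theory Submission
  imports Defs
begin

text \<open>Both networks are compared through the Laplace transforms
  \<open>E exp (- \<Sum> k\<^sub>x L\<^sup>x - \<Sum> m\<^sub>x\<^sub>y N\<^sub>x\<^sub>y)\<close>. Tilting the transition probabilities by
  \<open>1 / (1 + k\<^sub>x / \<lambda>\<^sub>x)\<close> and \<open>exp (- m\<^sub>x\<^sub>y)\<close> turns them into sums of weights of walks.
  Splitting a walk at its last visits to the vertices of its loop erasure, the weight of all walks
  with a given loop erasure is the weight of the latter times a product of Green functions of
  decreasing domains. Such a product telescopes to \<open>\<Phi> U / \<Phi> (U - \<gamma>)\<close>, where \<open>\<Phi> U\<close> is the exponential of
  \<open>\<Sum> w p / length p\<close> over the closed walks \<open>p\<close> in \<open>U\<close>: a closed walk with \<open>j\<close> visits to \<open>x\<close> has \<open>j\<close> rotations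
  starting at \<open>x\<close>, so that the closed walks through \<open>x\<close> contribute \<open>\<Sum> F\<^sup>j / j\<close>, with \<open>F\<close> the weight of
  the first returns, while the Green function is \<open>\<Sum> F\<^sup>j\<close>. Hence, whatever the ordering, the
  transform on the event that the tree is \<open>T\<close> is a weight of \<open>T\<close> times \<open>\<Phi>\<close>. On the Poisson side,
  \<open>\<Phi>\<close> comes out of Campbell's formula \<open>exp (- \<integral> (1 - exp (- \<phi>)) d\<mu>)\<close> once \<open>1 / t\<close> is written as the
  integral of \<open>exp (- u t)\<close>.\<close>

section \<open>Weighted walks and loops\<close>

text \<open>Loops reduced to a point have infinite total mass, as exp (- t) / t is not integrable at
  0, so the exponent in Campbell's formula is not a difference of two masses. Only the loops with a
  jump, of finite mass, are compared in this way; point loops are integrated apart and give the sum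
  of the ln (1 + \<open>rate\<close>). In Wilson's algorithm the same factor comes from the last
  visit to each vertex: its holding time is left behind as a point loop, and every vertex ends on
  exactly one branch. A bridge with n jumps has n + 1 holding times, because the visit to its base
  point is cut in two. Averaging over rotations turns the surplus factor into a sum over letters;
  the integrand in \<open>u\<close> is then minus the derivative of a product, and the weight 1 / n
  of a cyclic word remains. Natural numbers suffice as parameters of the transforms: after exp (- y)
  in each coordinate these are the moments of a vector in the unit cube. No value of
  \<open>\<Phi>\<close> is computed: the transforms are compared after multiplication by
  \<open>\<Phi>\<close> of the untilted chain, which is positive and finite and cancels.\<close>

fun walk_weight :: "('b \<Rightarrow> 'b \<Rightarrow> ennreal) \<Rightarrow> 'b list \<Rightarrow> ennreal" where
  "walk_weight w (u # v # vs) = w u v * walk_weight w (v # vs)"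
| "walk_weight w vs = 1"

lemma walk_weight_append:
  "walk_weight w (us @ v # vs) = walk_weight w (us @ [v]) * walk_weight w (v # vs)"
proof (induction us)
  case (Cons u us)
  then show ?case by (cases us) (auto simp: mult.assoc)
qed simp

lemma walk_weight_mono:
  "(\<And>u v. w u v \<le> w' u v) \<Longrightarrow> walk_weight w p \<le> walk_weight w' p"
  by (induction w p rule: walk_weight.induct) (auto intro: mult_mono)

lemma walk_weight_conv_prod:
  "walk_weight w p = (\<Prod>i<length p - 1. w (p ! i) (p ! Suc i))"
proof (induction w p rule: walk_weight.induct)
  case (1 w u v vs)
  then show ?case by (simp add: prod.lessThan_Suc_shift del: prod.lessThan_Suc)
qed auto

text \<open>The word is closed up by a step back to its first letter, so it stands for a closed walk
  with a base point; a one-letter word is a step from a vertex to itself.\<close>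

definition cycle_weight :: "('b \<Rightarrow> 'b \<Rightarrow> ennreal) \<Rightarrow> 'b list \<Rightarrow> ennreal" where
  "cycle_weight w p = walk_weight w (p @ [hd p])"

lemma cycle_weight_rotate1: "cycle_weight w (rotate1 p) = cycle_weight w p"
proof (cases p)
  case (Cons v vs)
  then show ?thesis
  proof (cases vs)
    case (Cons u us)
    then show ?thesis using \<open>p = v # vs\<close> walk_weight_append[of w "u # us" v "[u]"]
      by (simp add: cycle_weight_def mult.commute)
  qed (simp add: cycle_weight_def)
qed (simp add: cycle_weight_def)

definition words :: "'b set \<Rightarrow> nat \<Rightarrow> 'b list set" where
  "words U n = {p. set p \<subseteq> U \<and> length p = n}"

lemma finite_words [simp]: "finite U \<Longrightarrow> finite (words U n)"
  unfolding words_def by (rule finite_lists_length_eq)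

lemma bij_betw_rotate_words: "bij_betw (rotate n) (words U m) (words U m)"
\<comment> \<open>The two rotations add up to \<open>m * n\<close>, a multiple of the length
  \<open>m\<close>. The truncated subtraction fails only for \<open>m = 0\<close>, where the empty
  word is the only one.\<close>
proof (rule bij_betw_byWitness[where f' = "rotate (m * n - n)"])
  have *: "rotate (m * n - n) (rotate n p) = p" "rotate n (rotate (m * n - n) p) = p"
    if "p \<in> words U m" for p
  proof -
    have "m = 0 \<or> n \<le> m * n" by (cases m) auto
    moreover have "length p = m" using that by (simp add: words_def)
    ultimately show "rotate (m * n - n) (rotate n p) = p" "rotate n (rotate (m * n - n) p) = p"
      by (auto simp: rotate_rotate intro: rotate_id)
  qed
  then show "\<forall>p\<in>words U m. rotate (m * n - n) (rotate n p) = p"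
    "\<forall>p\<in>words U m. rotate n (rotate (m * n - n) p) = p" by auto
qed (auto simp: words_def)

text \<open>Rotations permute the words of length \<open>n\<close> and preserve \<open>f\<close>,
  and each position becomes the head under one of them. With \<open>h\<close> the indicator of a
  vertex this counts visits; with \<open>h\<close> a resolvent factor it redistributes the cut
  holding time of a bridge.\<close>

lemma sum_words_rotation:
  fixes f :: "'b list \<Rightarrow> ennreal"
  assumes f: "\<And>p. f (rotate1 p) = f p"
  shows "(\<Sum>p\<in>words U n. f p * (\<Sum>v\<leftarrow>p. h v)) = of_nat n * (\<Sum>p\<in>words U n. f p * h (hd p))"
proof -
  have fr: "f (rotate i p) = f p" for i p
    by (induction i) (auto simp: f)
  have "(\<Sum>p\<in>words U n. f p * (\<Sum>v\<leftarrow>p. h v)) = (\<Sum>p\<in>words U n. \<Sum>i<n. f p * h (p ! i))"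
    by (intro sum.cong refl)
      (auto simp: words_def sum_list_sum_nth sum_distrib_left atLeast0LessThan)
  also have "\<dots> = (\<Sum>i<n. \<Sum>p\<in>words U n. f p * h (p ! i))" by (rule sum.swap)
  also have "\<dots> = (\<Sum>i<n. \<Sum>p\<in>words U n. f p * h (hd p))"
  proof (rule sum.cong[OF refl])
    fix i assume "i \<in> {..<n}"
    then have "hd (rotate i p) = p ! i" if "p \<in> words U n" for p
      using that by (subst hd_rotate_conv_nth) (auto simp: words_def)
    then have "(\<Sum>p\<in>words U n. f p * h (p ! i)) = (\<Sum>p\<in>words U n. f (rotate i p) * h (hd (rotate i p)))"
      by (intro sum.cong refl) (simp add: fr)
    also have "\<dots> = (\<Sum>p\<in>words U n. f p * h (hd p))"
      by (rule sum.reindex_bij_betw[OF bij_betw_rotate_words])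
    finally show "(\<Sum>p\<in>words U n. f p * h (p ! i)) = (\<Sum>p\<in>words U n. f p * h (hd p))" .
  qed
  finally show ?thesis by simp
qed

section \<open>Sums over countable families\<close>

lemma nn_integral_count_space_partition:
  fixes f :: "'a \<Rightarrow> ennreal"
  assumes "countable J" "\<And>x. x \<in> A \<Longrightarrow> g x \<in> J"
  shows "(\<integral>\<^sup>+x. f x \<partial>count_space A) = (\<integral>\<^sup>+j. \<integral>\<^sup>+x. f x \<partial>count_space {x\<in>A. g x = j} \<partial>count_space J)"
proof -
  have *: "(\<integral>\<^sup>+j. f x * indicator {g x} j \<partial>count_space J) = f x" if "x \<in> A" for x
    using assms(2)[OF that] by (subst nn_integral_count_space'[of "{g x}"]) auto
  have "(\<integral>\<^sup>+x. f x \<partial>count_space A) = (\<integral>\<^sup>+x. \<integral>\<^sup>+j. f x * indicator {g x} j \<partial>count_space J \<partial>count_space A)"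
    by (intro nn_integral_cong) (simp add: *)
  also have "\<dots> = (\<integral>\<^sup>+j. \<integral>\<^sup>+x. f x * indicator {g x} j \<partial>count_space A \<partial>count_space J)"
    by (rule nn_integral_count_space_nn_integral[OF assms(1)]) simp
  also have "\<dots> = (\<integral>\<^sup>+j. \<integral>\<^sup>+x. f x \<partial>count_space {x\<in>A. g x = j} \<partial>count_space J)"
  proof (rule nn_integral_cong)
    fix j
    have "(\<integral>\<^sup>+x. f x \<partial>count_space {x\<in>A. g x = j}) = (\<integral>\<^sup>+x. f x * indicator {g x} j \<partial>count_space {x\<in>A. g x = j})"
      by (rule nn_integral_cong) auto
    also have "\<dots> = (\<integral>\<^sup>+x. f x * indicator {g x} j \<partial>count_space A)"
      by (rule nn_integral_count_space_eq) (auto simp: indicator_def)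
    finally show "(\<integral>\<^sup>+x. f x * indicator {g x} j \<partial>count_space A) = (\<integral>\<^sup>+x. f x \<partial>count_space {x\<in>A. g x = j})"
      by simp
  qed
  finally show ?thesis .
qed

lemma nn_integral_count_space_times:
  fixes f :: "'a \<times> 'b \<Rightarrow> ennreal"
  assumes "countable A"
  shows "(\<integral>\<^sup>+x. f x \<partial>count_space (A \<times> B)) = (\<integral>\<^sup>+a. \<integral>\<^sup>+b. f (a, b) \<partial>count_space B \<partial>count_space A)"
proof -
  have "(\<integral>\<^sup>+x. f x \<partial>count_space (A \<times> B)) = (\<integral>\<^sup>+a. \<integral>\<^sup>+x. f x \<partial>count_space {x\<in>A\<times>B. fst x = a} \<partial>count_space A)"
    by (rule nn_integral_count_space_partition[OF assms]) auto
  also have "\<dots> = (\<integral>\<^sup>+a. \<integral>\<^sup>+b. f (a, b) \<partial>count_space B \<partial>count_space A)"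
  proof (rule nn_integral_cong)
    fix a assume "a \<in> space (count_space A)"
    then have "bij_betw (Pair a) B {x\<in>A\<times>B. fst x = a}"
      by (auto simp: bij_betw_def inj_on_def)
    from nn_integral_bij_count_space[OF this, of f]
    show "(\<integral>\<^sup>+x. f x \<partial>count_space {x\<in>A\<times>B. fst x = a}) = (\<integral>\<^sup>+b. f (a, b) \<partial>count_space B)" by simp
  qed
  finally show ?thesis .
qed

lemma nn_integral_count_space_product:
  fixes f :: "'a \<Rightarrow> ennreal" and g :: "'b \<Rightarrow> ennreal"
  assumes "countable A"
  shows "(\<integral>\<^sup>+x. f (fst x) * g (snd x) \<partial>count_space (A \<times> B)) =
    (\<integral>\<^sup>+a. f a \<partial>count_space A) * (\<integral>\<^sup>+b. g b \<partial>count_space B)"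
  by (simp add: nn_integral_count_space_times[OF assms] nn_integral_cmult nn_integral_multc)

lemma nn_integral_lists_by_length:
  fixes f :: "'b::countable list \<Rightarrow> ennreal"
  assumes "finite U"
  shows "(\<integral>\<^sup>+p. f p \<partial>count_space {p. set p \<subseteq> U \<and> R p}) = (\<Sum>n. \<Sum>p\<in>{p\<in>words U n. R p}. f p)"
proof -
  have *: "{p. set p \<subseteq> U \<and> R p \<and> length p = n} = {p\<in>words U n. R p}" for n
    by (auto simp: words_def)
  show ?thesis
    by (subst nn_integral_count_space_partition[of UNIV _ length])
      (use assms in \<open>auto simp: nn_integral_count_space_nat * nn_integral_count_space_finite\<close>)
qed

section \<open>Green functions, first returns and closed walks\<close>

definition green :: "('b \<Rightarrow> 'b \<Rightarrow> ennreal) \<Rightarrow> 'b set \<Rightarrow> 'b \<Rightarrow> ennreal" where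
  "green w U x = (\<integral>\<^sup>+p. walk_weight w (p @ [x]) \<partial>count_space {p. set p \<subseteq> U \<and> hd (p @ [x]) = x})"

definition first_return :: "('b \<Rightarrow> 'b \<Rightarrow> ennreal) \<Rightarrow> 'b set \<Rightarrow> 'b \<Rightarrow> ennreal" where
  "first_return w U x = (\<integral>\<^sup>+e. walk_weight w (x # e @ [x]) \<partial>count_space {e. set e \<subseteq> U - {x}})"

text \<open>With \<open>w\<close> on a finite \<open>U\<close> seen as a matrix, this is the sum of
  the traces of its powers, each divided by the exponent: minus the logarithm of the determinant of
  the identity minus \<open>w\<close>, whenever the series converges.\<close>

definition loop_mass :: "('b \<Rightarrow> 'b \<Rightarrow> ennreal) \<Rightarrow> 'b set \<Rightarrow> ennreal" where
  "loop_mass w U = (\<integral>\<^sup>+p. cycle_weight w p / of_nat (length p) \<partial>count_space {p. set p \<subseteq> U \<and> p \<noteq> []})"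

text \<open>Cutting after the first excursion is a bijection: \<open>x # e @ p\<close>, where
  \<open>e\<close> avoids \<open>x\<close> and \<open>p\<close> is empty or starts at
  \<open>x\<close> again, with one visit fewer. The final visit is not part of the list, so
  \<open>k\<close> visits in it mean \<open>k\<close> excursions.\<close>

lemma nn_integral_returns:
  fixes w :: "'b::countable \<Rightarrow> 'b \<Rightarrow> ennreal"
  assumes "x \<in> U"
  shows "(\<integral>\<^sup>+p. walk_weight w (p @ [x]) \<partial>count_space {p. set p \<subseteq> U \<and> hd (p @ [x]) = x \<and> count_list p x = k}) =
    first_return w U x ^ k"
proof (induction k)
  case 0
  have "{p. set p \<subseteq> U \<and> hd (p @ [x]) = x \<and> count_list p x = 0} = {[]}"
  proof (intro set_eqI iffI)
    fix p assume "p \<in> {p. set p \<subseteq> U \<and> hd (p @ [x]) = x \<and> count_list p x = 0}"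
    then show "p \<in> {[]}" by (cases p) (auto simp: count_list_0_iff)
  qed simp
  then show ?case by (simp add: nn_integral_count_space_finite)
next
  case (Suc k)
  let ?A = "\<lambda>k. {p. set p \<subseteq> U \<and> hd (p @ [x]) = x \<and> count_list p x = k}"
  let ?E = "{e. set e \<subseteq> U - {x}}"
  have "bij_betw (\<lambda>(e, p). x # e @ p) (?E \<times> ?A k) (?A (Suc k))"
  \<comment> \<open>The excursion is read off up to the next \<open>x\<close>; if none follows, it
    is the whole remaining list and the rest is empty.\<close>
  proof (rule bij_betw_byWitness[where f' = "\<lambda>p. (takeWhile (\<lambda>v. v \<noteq> x) (tl p), dropWhile (\<lambda>v. v \<noteq> x) (tl p))"])
    show "\<forall>a\<in>?E \<times> ?A k. (\<lambda>p. (takeWhile (\<lambda>v. v \<noteq> x) (tl p), dropWhile (\<lambda>v. v \<noteq> x) (tl p))) ((\<lambda>(e, p). x # e @ p) a) = a"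
    proof
      fix a assume "a \<in> ?E \<times> ?A k"
      then obtain e p where a: "a = (e, p)" and e: "set e \<subseteq> U - {x}" and p: "hd (p @ [x]) = x" by auto
      have "takeWhile (\<lambda>v. v \<noteq> x) p = []" "dropWhile (\<lambda>v. v \<noteq> x) p = p"
        using p by (cases p; simp)+
      then show "(\<lambda>p. (takeWhile (\<lambda>v. v \<noteq> x) (tl p), dropWhile (\<lambda>v. v \<noteq> x) (tl p))) ((\<lambda>(e, p). x # e @ p) a) = a"
        using e unfolding a by (auto simp: takeWhile_append dropWhile_append)
    qed
    show "\<forall>p\<in>?A (Suc k). (\<lambda>(e, p). x # e @ p) (takeWhile (\<lambda>v. v \<noteq> x) (tl p), dropWhile (\<lambda>v. v \<noteq> x) (tl p)) = p"
    proof
      fix p assume "p \<in> ?A (Suc k)"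
      then have p: "hd (p @ [x]) = x" "count_list p x = Suc k" by auto
      then have "p \<noteq> []" by auto
      with p show "(\<lambda>(e, p). x # e @ p) (takeWhile (\<lambda>v. v \<noteq> x) (tl p), dropWhile (\<lambda>v. v \<noteq> x) (tl p)) = p"
        by (cases p) auto
    qed
    show "(\<lambda>(e, p). x # e @ p) ` (?E \<times> ?A k) \<subseteq> ?A (Suc k)"
    proof
      fix a assume "a \<in> (\<lambda>(e, p). x # e @ p) ` (?E \<times> ?A k)"
      then obtain e p where a: "a = x # e @ p" and e: "set e \<subseteq> U - {x}" and p: "p \<in> ?A k" by auto
      from e have "count_list e x = 0" by (intro count_notin) auto
      with e p assms show "a \<in> ?A (Suc k)" by (auto simp: a)
    qed
    show "(\<lambda>p. (takeWhile (\<lambda>v. v \<noteq> x) (tl p), dropWhile (\<lambda>v. v \<noteq> x) (tl p))) ` ?A (Suc k) \<subseteq> ?E \<times> ?A k"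
    proof
      fix a assume "a \<in> (\<lambda>p. (takeWhile (\<lambda>v. v \<noteq> x) (tl p), dropWhile (\<lambda>v. v \<noteq> x) (tl p))) ` ?A (Suc k)"
      then obtain p where p: "set p \<subseteq> U" "hd (p @ [x]) = x" "count_list p x = Suc k"
        and a: "a = (takeWhile (\<lambda>v. v \<noteq> x) (tl p), dropWhile (\<lambda>v. v \<noteq> x) (tl p))" by auto
      from p obtain q where q: "p = x # q" by (cases p) auto
      have "count_list (takeWhile (\<lambda>v. v \<noteq> x) q @ dropWhile (\<lambda>v. v \<noteq> x) q) x = k"
        using p q by (simp only: takeWhile_dropWhile_id) simp
      moreover have "count_list (takeWhile (\<lambda>v. v \<noteq> x) q) x = 0"
        by (auto simp: count_list_0_iff dest: set_takeWhileD)
      ultimately have "count_list (dropWhile (\<lambda>v. v \<noteq> x) q) x = k"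
        by (simp only: count_list_append)
      moreover have "hd (dropWhile (\<lambda>v. v \<noteq> x) q @ [x]) = x" for q
        by (induction q) auto
      moreover have "set q \<subseteq> U" using p q by auto
      ultimately show "a \<in> ?E \<times> ?A k"
        by (auto simp: a q dest: set_takeWhileD set_dropWhileD)
    qed
  qed
  from nn_integral_bij_count_space[OF this, of "\<lambda>p. walk_weight w (p @ [x])"]
  have "(\<integral>\<^sup>+p. walk_weight w (p @ [x]) \<partial>count_space (?A (Suc k))) =
    (\<integral>\<^sup>+a. walk_weight w ((case a of (e, p) \<Rightarrow> x # e @ p) @ [x]) \<partial>count_space (?E \<times> ?A k))" by simp
  also have "\<dots> = (\<integral>\<^sup>+a. walk_weight w (x # fst a @ [x]) * walk_weight w (snd a @ [x]) \<partial>count_space (?E \<times> ?A k))"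
  proof (rule nn_integral_cong)
    fix a assume "a \<in> space (count_space (?E \<times> ?A k))"
    then obtain e p where a: "a = (e, p)" "hd (p @ [x]) = x" by auto
    obtain r where "p @ [x] = x # r" using a(2) by (cases p) auto
    then show "walk_weight w ((case a of (e, p) \<Rightarrow> x # e @ p) @ [x]) = walk_weight w (x # fst a @ [x]) * walk_weight w (snd a @ [x])"
      using walk_weight_append[of w "x # e" x r] by (simp add: a)
  qed
  also have "\<dots> = first_return w U x * first_return w U x ^ k"
    by (subst nn_integral_count_space_product) (auto simp: Suc.IH first_return_def)
  finally show ?case by simp
qed

lemma green_eq_suminf:
  fixes w :: "'b::countable \<Rightarrow> 'b \<Rightarrow> ennreal"
  assumes "x \<in> U"
  shows "green w U x = (\<Sum>k. first_return w U x ^ k)"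
proof -
  have "green w U x = (\<Sum>k. \<integral>\<^sup>+p. walk_weight w (p @ [x])
      \<partial>count_space {p. set p \<subseteq> U \<and> hd (p @ [x]) = x \<and> count_list p x = k})"
    unfolding green_def
    by (subst nn_integral_count_space_partition[of UNIV _ "\<lambda>p. count_list p x"])
      (auto simp: nn_integral_count_space_nat conj_assoc)
  then show ?thesis by (simp only: nn_integral_returns[OF assms])
qed

lemma loop_mass_remove:
  fixes w :: "'b::countable \<Rightarrow> 'b \<Rightarrow> ennreal"
  assumes "x \<in> U" "finite U"
  shows "loop_mass w U = loop_mass w (U - {x}) + (\<Sum>k. first_return w U x ^ Suc k / of_nat (Suc k))"
proof -
  let ?f = "\<lambda>p. cycle_weight w p / of_nat (length p)"
  let ?g = "\<lambda>p. cycle_weight w p / of_nat (count_list p x)"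
  have "loop_mass w U = (\<integral>\<^sup>+p. ?f p * indicator {p. x \<notin> set p} p + ?f p * indicator {p. x \<in> set p} p \<partial>count_space {p. set p \<subseteq> U \<and> p \<noteq> []})"
    unfolding loop_mass_def by (intro nn_integral_cong) (auto simp: indicator_def)
  also have "\<dots> = (\<integral>\<^sup>+p. ?f p * indicator {p. x \<notin> set p} p \<partial>count_space {p. set p \<subseteq> U \<and> p \<noteq> []}) +
     (\<integral>\<^sup>+p. ?f p * indicator {p. x \<in> set p} p \<partial>count_space {p. set p \<subseteq> U \<and> p \<noteq> []})"
    by (intro nn_integral_add) auto
  also have "(\<integral>\<^sup>+p. ?f p * indicator {p. x \<notin> set p} p \<partial>count_space {p. set p \<subseteq> U \<and> p \<noteq> []}) =
     (\<integral>\<^sup>+p. ?f p * indicator {p. x \<notin> set p} p \<partial>count_space {p. set p \<subseteq> U - {x} \<and> p \<noteq> []})"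
    by (rule nn_integral_count_space_eq) (auto simp: indicator_def)
  also have "\<dots> = loop_mass w (U - {x})"
    unfolding loop_mass_def by (intro nn_integral_cong) (auto simp: indicator_def)
  also have "(\<integral>\<^sup>+p. ?f p * indicator {p. x \<in> set p} p \<partial>count_space {p. set p \<subseteq> U \<and> p \<noteq> []}) =
    (\<integral>\<^sup>+p. ?f p * indicator {p. x \<in> set p} p \<partial>count_space {p. set p \<subseteq> U \<and> True})"
    by (rule nn_integral_count_space_eq) (auto simp: indicator_def)
  also have "\<dots> = (\<Sum>n. \<Sum>p\<in>words U n. ?f p * indicator {p. x \<in> set p} p)"
    by (subst nn_integral_lists_by_length[OF assms(2)]) auto
  also have "\<dots> = (\<Sum>n. \<Sum>p\<in>words U n. ?g p * indicator {p. x \<in> set p} p * indicator {x} (hd p))"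
  proof (rule suminf_cong)
    fix n
    let ?h = "\<lambda>p. cycle_weight w p / of_nat n / of_nat (count_list p x) * indicator {p. x \<in> set p} p"
    have cl: "(\<Sum>v\<leftarrow>p. indicator {x} v) = (of_nat (count_list p x) :: ennreal)" for p
      by (induction p) auto
    have r: "count_list (rotate1 p) x = count_list p x" for p by (cases p) auto
    have d: "b / of_nat m * of_nat m = b" if "m > 0" for b :: ennreal and m :: nat
      using that by (simp add: ennreal_divide_times ennreal_divide_self of_nat_less_top)
    \<comment> \<open>The weight 1 / n is written as 1 / (n j) times the number j of letters equal
      to \<open>x\<close>, the form in which the sum over rotations applies.\<close>
    have "(\<Sum>p\<in>words U n. ?f p * indicator {p. x \<in> set p} p) = (\<Sum>p\<in>words U n. ?h p * (\<Sum>v\<leftarrow>p. indicator {x} v))"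
    proof (rule sum.cong[OF refl])
      fix p assume p: "p \<in> words U n"
      show "?f p * indicator {p. x \<in> set p} p = ?h p * (\<Sum>v\<leftarrow>p. indicator {x} v)"
      proof (cases "x \<in> set p")
        case True
        then have "0 < count_list p x" by (metis count_list_0_iff gr0I)
        then show ?thesis using p True unfolding cl by (simp add: words_def d)
      qed simp
    qed
    also have "\<dots> = of_nat n * (\<Sum>p\<in>words U n. ?h p * indicator {x} (hd p))"
      by (rule sum_words_rotation) (simp add: cycle_weight_rotate1 r indicator_def)
    also have "\<dots> = (\<Sum>p\<in>words U n. ?g p * indicator {p. x \<in> set p} p * indicator {x} (hd p))"
      unfolding sum_distrib_left
    proof (rule sum.cong[OF refl])
      fix p assume p: "p \<in> words U n"
      show "of_nat n * (?h p * indicator {x} (hd p)) = ?g p * indicator {p. x \<in> set p} p * indicator {x} (hd p)"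
      proof (cases "x \<in> set p")
        case True
        then have "0 < n" using p by (auto simp: words_def)
        have "of_nat n * (cycle_weight w p / of_nat n / of_nat (count_list p x)) = 
           cycle_weight w p / of_nat n * of_nat n / of_nat (count_list p x)"
          by (simp add: divide_ennreal_def mult_ac)
        then show ?thesis using d[OF \<open>0 < n\<close>, of "cycle_weight w p"] True
          by (simp add: mult.assoc[symmetric])
      qed simp
    qed
    finally show "(\<Sum>p\<in>words U n. ?f p * indicator {p. x \<in> set p} p) =
      (\<Sum>p\<in>words U n. ?g p * indicator {p. x \<in> set p} p * indicator {x} (hd p))" .
  qed
  \<comment> \<open>From here on only the words based at \<open>x\<close> count, with weight 1 / j
    instead of 1 / n.\<close>
  also have "\<dots> = (\<integral>\<^sup>+p. ?g p * indicator {p. x \<in> set p} p * indicator {x} (hd p) \<partial>count_space {p. set p \<subseteq> U \<and> True})"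
    by (subst nn_integral_lists_by_length[OF assms(2)]) auto
  also have "\<dots> = (\<integral>\<^sup>+p. ?g p * indicator {p. x \<in> set p} p * indicator {x} (hd p) \<partial>count_space {p. set p \<subseteq> U \<and> hd (p @ [x]) = x})"
    by (rule nn_integral_count_space_eq) (auto simp: indicator_def hd_append split: if_splits)
  also have "\<dots> = (\<integral>\<^sup>+p. walk_weight w (p @ [x]) * (indicator {p. x \<in> set p} p / of_nat (count_list p x)) \<partial>count_space {p. set p \<subseteq> U \<and> hd (p @ [x]) = x})"
  proof (rule nn_integral_cong)
    fix p assume "p \<in> space (count_space {p. set p \<subseteq> U \<and> hd (p @ [x]) = x})"
    then show "?g p * indicator {p. x \<in> set p} p * indicator {x} (hd p) =
      walk_weight w (p @ [x]) * (indicator {p. x \<in> set p} p / of_nat (count_list p x))"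
      by (cases p) (auto simp: cycle_weight_def divide_ennreal_def mult_ac)
  qed
  also have "\<dots> = (\<Sum>k. \<integral>\<^sup>+p. walk_weight w (p @ [x]) * (indicator {p. x \<in> set p} p / of_nat (count_list p x))
      \<partial>count_space {p. set p \<subseteq> U \<and> hd (p @ [x]) = x \<and> count_list p x = k})"
    by (subst nn_integral_count_space_partition[of UNIV _ "\<lambda>p. count_list p x"])
      (auto simp: nn_integral_count_space_nat conj_assoc)
  also have "\<dots> = (\<Sum>k. first_return w U x ^ k * (if k = 0 then 0 else 1 / of_nat k))"
  proof (rule suminf_cong)
    fix k
    have "(\<integral>\<^sup>+p. walk_weight w (p @ [x]) * (indicator {p. x \<in> set p} p / of_nat (count_list p x))
      \<partial>count_space {p. set p \<subseteq> U \<and> hd (p @ [x]) = x \<and> count_list p x = k}) =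
      (\<integral>\<^sup>+p. walk_weight w (p @ [x]) * (if k = 0 then 0 else 1 / of_nat k)
      \<partial>count_space {p. set p \<subseteq> U \<and> hd (p @ [x]) = x \<and> count_list p x = k})"
    proof (rule nn_integral_cong)
      fix p assume "p \<in> space (count_space {p. set p \<subseteq> U \<and> hd (p @ [x]) = x \<and> count_list p x = k})"
      then have "count_list p x = k" by simp
      moreover have "x \<in> set p \<longleftrightarrow> count_list p x \<noteq> 0" by (simp add: count_list_0_iff)
      ultimately show "walk_weight w (p @ [x]) * (indicator {p. x \<in> set p} p / of_nat (count_list p x)) =
        walk_weight w (p @ [x]) * (if k = 0 then 0 else 1 / of_nat k)" by simp
    qed
    also have "\<dots> = first_return w U x ^ k * (if k = 0 then 0 else 1 / of_nat k)"
      by (simp add: nn_integral_multc nn_integral_returns[OF assms(1)])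
    finally show "(\<integral>\<^sup>+p. walk_weight w (p @ [x]) * (indicator {p. x \<in> set p} p / of_nat (count_list p x))
      \<partial>count_space {p. set p \<subseteq> U \<and> hd (p @ [x]) = x \<and> count_list p x = k}) =
      first_return w U x ^ k * (if k = 0 then 0 else 1 / of_nat k)" .
  qed
  \<comment> \<open>The term \<open>k = 0\<close> vanishes, which allows the shift of the
    index.\<close>
  also have "\<dots> = (\<Sum>k. first_return w U x ^ Suc k / of_nat (Suc k))"
    by (subst suminf_offset[OF summableI, of _ 1]) (simp add: divide_ennreal_def)
  finally show ?thesis .
qed

text \<open>The inverse determinant of the identity minus \<open>w\<close> on \<open>U\<close>. It
  has this meaning only for a finite \<open>loop_mass\<close>, since \<open>enn2real\<close> sends
  an infinite one to 0.\<close>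

definition loop_exp :: "('b \<Rightarrow> 'b \<Rightarrow> ennreal) \<Rightarrow> 'b set \<Rightarrow> ennreal" where
  "loop_exp w U = ennreal (exp (enn2real (loop_mass w U)))"

lemma loop_exp_remove:
  fixes w :: "'b::countable \<Rightarrow> 'b \<Rightarrow> ennreal"
  assumes "x \<in> U" "finite U" "green w U x < \<top>" "loop_mass w (U - {x}) < \<top>"
  shows "loop_mass w U < \<top>" "loop_exp w U = green w U x * loop_exp w (U - {x})"
proof -
  let ?F = "first_return w U x"
  \<comment> \<open>Otherwise every term of the series for the Green function would be at least
    1.\<close>
  have F1: "?F < 1"
  proof (rule ccontr)
    assume "\<not> ?F < 1"
    then have "1 \<le> ?F ^ k" for k by (simp add: one_le_power)
    then have "(\<Sum>k. (1::ennreal)) \<le> (\<Sum>k. ?F ^ k)" by (intro suminf_le) auto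
    moreover have "(\<Sum>k::nat. (1::ennreal)) = \<top>"
      using nn_integral_count_space_nat[of "\<lambda>_. 1"] by (simp add: emeasure_count_space_infinite)
    ultimately have "\<top> \<le> green w U x" unfolding green_eq_suminf[OF assms(1)] by simp
    then show False using assms(3) by (simp add: top_unique)
  qed
  then obtain F where F: "?F = ennreal F" "0 \<le> F" "F < 1"
    by (cases ?F) (auto simp: ennreal_less_one_iff)
  have g: "green w U x = ennreal (1 / (1 - F))"
  proof -
    have "(\<Sum>k. ennreal F ^ k) = (\<Sum>k. ennreal (F ^ k))" using F by (simp add: ennreal_power)
    also have "\<dots> = ennreal (\<Sum>k. F ^ k)" using F by (intro suminf_ennreal2 summable_geometric) auto
    finally show ?thesis using F by (simp add: green_eq_suminf[OF assms(1)] suminf_geometric)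
  qed
  \<comment> \<open>The logarithmic series at \<open>- F\<close>; the exponential of its sum is 1 /
    (1 - F), the value just found for the Green function.\<close>
  have s: "(\<lambda>k. F ^ Suc k / real (Suc k)) sums (- ln (1 - F))"
  proof -
    have "(\<lambda>n. - ((- (- F)) ^ n / real n)) sums ln (1 + (- F))"
      using ln_series'[of "- F"] F by simp
    from sums_minus[OF this] have "(\<lambda>n. F ^ n / real n) sums (- ln (1 - F))" by simp
    then show ?thesis using sums_Suc_iff[of "\<lambda>n. F ^ n / real n" "- ln (1 - F)"] by simp
  qed
  have l: "(\<Sum>k. ?F ^ Suc k / of_nat (Suc k)) = ennreal (- ln (1 - F))"
  proof -
    have "(\<Sum>k. ?F ^ Suc k / of_nat (Suc k)) = (\<Sum>k. ennreal (F ^ Suc k / real (Suc k)))"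
    proof (rule suminf_cong)
      fix k
      have "ennreal F ^ Suc k / of_nat (Suc k) = ennreal (F ^ Suc k) / ennreal (real (Suc k))"
        using F by (simp only: ennreal_power ennreal_of_nat_eq_real_of_nat)
      also have "\<dots> = ennreal (F ^ Suc k / real (Suc k))" using F by (intro divide_ennreal) auto
      finally show "?F ^ Suc k / of_nat (Suc k) = ennreal (F ^ Suc k / real (Suc k))" by (simp only: F(1))
    qed
    also have "\<dots> = ennreal (\<Sum>k. F ^ Suc k / real (Suc k))"
      using F s by (intro suminf_ennreal2) (auto intro: sums_summable simp del: power_Suc)
    also have "\<dots> = ennreal (- ln (1 - F))" using s sums_unique by metis
    finally show ?thesis .
  qed
  have m: "loop_mass w U = loop_mass w (U - {x}) + ennreal (- ln (1 - F))"
    by (simp only: loop_mass_remove[OF assms(1,2)] l)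
  then show "loop_mass w U < \<top>" using assms(4) by simp
  obtain a where a: "loop_mass w (U - {x}) = ennreal a" "a \<ge> 0" using assms(4) by (cases "loop_mass w (U - {x})") auto
  have "ln (1 - F) \<le> 0" using F by simp
  then have "enn2real (loop_mass w U) = a + - ln (1 - F)"
    using a by (simp add: m ennreal_plus[symmetric] del: ennreal_plus)
  then have "exp (enn2real (loop_mass w U)) = exp a / (1 - F)"
    using F by (simp only: exp_add exp_minus) (simp add: divide_inverse)
  then show "loop_exp w U = green w U x * loop_exp w (U - {x})"
    using a F by (simp add: loop_exp_def g ennreal_mult[symmetric])
qed

lemma loop_mass_empty [simp]: "loop_mass w {} = 0"
proof -
  have "{p. set p \<subseteq> {} \<and> p \<noteq> []} = {}" by auto
  then show ?thesis unfolding loop_mass_def by (simp add: nn_integral_empty)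
qed

lemma green_mono:
  assumes "\<And>u v. w u v \<le> w' u v" shows "green w U x \<le> green w' U x"
  unfolding green_def by (intro nn_integral_mono walk_weight_mono assms)

text \<open>Vertices are added one at a time, and each new vertex brings in the Green function of
  the domain reached so far; hence the assumption on all subdomains.\<close>

lemma loop_mass_finite:
  fixes w :: "'b::countable \<Rightarrow> 'b \<Rightarrow> ennreal"
  assumes "finite U" "\<And>V x. V \<subseteq> U \<Longrightarrow> x \<in> V \<Longrightarrow> green w V x < \<top>"
  shows "loop_mass w U < \<top>"
  using assms
proof (induction U)
  case (insert x U)
  have g: "green w (insert x U) x < \<top>" using insert.prems by simp
  have m: "loop_mass w (insert x U - {x}) < \<top>" using insert by (simp add: subset_insertI2)
  show ?case using insert.hyps(1) by (intro loop_exp_remove(1)[OF insertI1 _ g m]) simp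
qed simp

section \<open>Loop-erased walks\<close>

text \<open>Loop erasure compares vertices only, so it commutes with every change of the holding
  times. This separates the combinatorics from the times, which are replaced below by 0 or by the
  indices of the steps.\<close>

lemma fold_erase_step_map:
  "fold erase_step (map (map_prod id f) p) (map (map_prod id f) \<gamma>, map (map (map_prod id f)) L) =
   map_prod (map (map_prod id f)) (map (map (map_prod id f))) (fold erase_step p (\<gamma>, L))"
proof (induction p arbitrary: \<gamma> L)
  case (Cons q p)
  obtain v r where q: "q = (v, r)" by force
  have tw: "takeWhile (\<lambda>p. fst p \<noteq> v) (map (map_prod id f) \<gamma>) = map (map_prod id f) (takeWhile (\<lambda>p. fst p \<noteq> v) \<gamma>)"
    "dropWhile (\<lambda>p. fst p \<noteq> v) (map (map_prod id f) \<gamma>) = map (map_prod id f) (dropWhile (\<lambda>p. fst p \<noteq> v) \<gamma>)" for \<gamma>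
    by (simp_all add: takeWhile_map dropWhile_map o_def)
  have s: "erase_step (map_prod id f q) (map (map_prod id f) \<gamma>, map (map (map_prod id f)) L) =
      map_prod (map (map_prod id f)) (map (map (map_prod id f))) (erase_step q (\<gamma>, L))"
    by (auto simp: q tw image_image)
  obtain \<gamma>1 L1 where e: "erase_step q (\<gamma>, L) = (\<gamma>1, L1)" by force
  show ?case using Cons.IH[of \<gamma>1 L1]
    by (simp only: list.map fold.simps(2) o_apply s e map_prod_simp)
qed simp

lemma loop_erasure_map:
  "loop_erasure (map (map_prod id f) p) =
   (fst (loop_erasure p), map (map (map_prod id f)) (snd (loop_erasure p)))"
  using fold_erase_step_map[of f p "[]" "[]"]
  by (simp add: loop_erasure_def o_def split: prod.split)

text \<open>The holding times 0 are dummies: by \<open>loop_erasure_map\<close> the vertices of the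
  loop erasure do not depend on them.\<close>

definition erased_path :: "'a option list \<Rightarrow> 'a option list" where
  "erased_path p = map fst (fst (fold erase_step (map (\<lambda>v. (v, 0)) p) ([], [])))"

lemma fst_loop_erasure: "fst (loop_erasure p) = erased_path (map fst p)"
proof -
  have *: "map (map_prod id (\<lambda>_. 0)) p = map (\<lambda>v. (v, 0)) (map fst p)"
    by (induction p) auto
  have "fst (loop_erasure (map (\<lambda>v. (v, 0)) (map fst p))) = fst (loop_erasure p)"
    unfolding *[symmetric] by (simp only: loop_erasure_map fst_conv)
  then show ?thesis
    by (simp only: erased_path_def loop_erasure_def Let_def case_prod_beta fst_conv)
qed

lemma fst_fold_erase_step: "fst (fold erase_step p (\<gamma>, L)) = fst (fold erase_step p (\<gamma>, []))"
proof (induction p arbitrary: \<gamma> L)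
  case (Cons q p)
  obtain v r where q: "q = (v, r)" by force
  obtain \<gamma>1 L1 where e: "erase_step q (\<gamma>, L) = (\<gamma>1, L1)" by force
  then obtain L2 where e': "erase_step q (\<gamma>, []) = (\<gamma>1, L2)"
    by (cases "v \<in> fst ` set \<gamma>") (auto simp: q)
  have "fst (fold erase_step p (\<gamma>1, L1)) = fst (fold erase_step p (\<gamma>1, L2))"
    using Cons.IH[of \<gamma>1 L1] Cons.IH[of \<gamma>1 L2] by simp
  then show ?case by (simp add: e e')
qed simp

text \<open>A cut at a vertex other than \<open>x\<close> keeps everything before the earlier visit
  of that vertex, in particular a leading \<open>x\<close>. As long as \<open>x\<close> is not
  revisited, it merely stands in front of the erasure of the rest.\<close>

lemma fold_erase_step_avoid:
  assumes "x \<notin> fst ` set q"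
  shows "fold erase_step q ((x, r) # \<gamma>, L) = map_prod (Cons (x, r)) id (fold erase_step q (\<gamma>, L))"
  using assms
proof (induction q arbitrary: \<gamma> L)
  case (Cons a q)
  obtain v s where a: "a = (v, s)" by force
  have s: "erase_step a ((x, r) # \<gamma>, L) = map_prod (Cons (x, r)) id (erase_step a (\<gamma>, L))"
    using Cons.prems by (auto simp: a)
  obtain \<gamma>1 L1 where e: "erase_step a (\<gamma>, L) = (\<gamma>1, L1)" by force
  show ?case using Cons.IH[of \<gamma>1 L1] Cons.prems by (simp add: s e)
qed simp

text \<open>The starting vertex is never erased: a return to it replaces its entry by one with the
  same vertex and a new holding time, which is why only \<open>fst\<close> of the entry is
  preserved.\<close>

lemma fst_hd_fold_erase_step:
  "p \<noteq> [] \<Longrightarrow> fst (fold erase_step p ([], [])) \<noteq> [] \<and>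
    fst (hd (fst (fold erase_step p ([], [])))) = fst (hd p)"
proof (induction p rule: rev_induct)
  case (snoc a p)
  obtain v s where a: "a = (v, s)" by force
  show ?case
  proof (cases "p = []")
    case False
    obtain \<gamma> L where e: "fold erase_step p ([], []) = (\<gamma>, L)" by force
    with snoc.IH False obtain b \<gamma>1 where "\<gamma> = b # \<gamma>1" "fst b = fst (hd p)" by (cases \<gamma>) auto
    then show ?thesis using False by (auto simp: e a)
  qed (simp add: a)
qed simp

lemma erased_path_Nil [simp]: "erased_path [] = []"
  by (simp add: erased_path_def)

lemma erased_path_nonempty:
  assumes "p \<noteq> []" shows "erased_path p \<noteq> []" "hd (erased_path p) = hd p"
  using fst_hd_fold_erase_step[of "map (\<lambda>v. (v, 0)) p"] assms
  by (auto simp: erased_path_def hd_map)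

lemma hd_erased_path_append: "hd (erased_path p @ [y]) = hd (p @ [y])"
  using erased_path_nonempty[of p] by (cases "p = []") (auto simp: hd_append)

text \<open>At the last visit of the starting vertex \<open>x\<close> everything before it is erased
  and the current path is \<open>[x]\<close>; afterwards \<open>x\<close> is not touched
  again.\<close>

lemma erased_path_last_exit:
  assumes "hd (l @ [x]) = x" "x \<notin> set q"
  shows "erased_path (l @ x # q) = x # erased_path q"
proof -
  let ?z = "map (\<lambda>v. (v, 0 :: real))"
  obtain \<gamma> L where e: "fold erase_step (?z l) ([], []) = (\<gamma>, L)" by force
  obtain L' where s: "erase_step (x, 0) (\<gamma>, L) = ([(x, 0)], L')"
  proof (cases "l = []")
    case True
    then show ?thesis using e that by auto
  next
    case False
    then have "\<gamma> \<noteq> []" "fst (hd \<gamma>) = x"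
      using fst_hd_fold_erase_step[of "?z l"] e assms(1) by (auto simp: hd_map)
    then show ?thesis using that by (cases \<gamma>) auto
  qed
  have "fold erase_step (?z (l @ x # q)) ([], []) = fold erase_step (?z q) ([(x, 0)], L')"
    using e s by (simp del: erase_step.simps)
  also have "\<dots> = map_prod (Cons (x, 0)) id (fold erase_step (?z q) ([], L'))"
    using assms(2) by (intro fold_erase_step_avoid) (auto simp: image_image)
  finally show ?thesis
    using fst_fold_erase_step[of "?z q" "[]" L'] by (simp add: erased_path_def)
qed

lemma erased_path_cases:
  assumes "erased_path p = x # \<gamma>"
  obtains l q where "p = l @ x # q" "hd (l @ [x]) = x" "x \<notin> set q" "erased_path q = \<gamma>"
proof -
  have "p \<noteq> []" using assms by auto
  then have hd: "hd p = x" using erased_path_nonempty[of p] assms by simp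
  then have "x \<in> set p" using \<open>p \<noteq> []\<close> by auto
  from split_list_last[OF this] obtain l q where p: "p = l @ x # q" "x \<notin> set q" by auto
  moreover have l: "hd (l @ [x]) = x" using p hd by (cases l) auto
  moreover have "erased_path q = \<gamma>" using erased_path_last_exit[OF l p(2)] assms p by simp
  ultimately show ?thesis using that by blast
qed

lemma bij_betw_last_exit:
  assumes "x \<in> U"
  shows "bij_betw (\<lambda>(l, q). l @ x # q)
    ({l. set l \<subseteq> U \<and> hd (l @ [x]) = x} \<times> {q. set q \<subseteq> U - {x}}) {p. p \<noteq> [] \<and> hd p = x \<and> set p \<subseteq> U}"
    (is "bij_betw _ (?L \<times> ?Q) _")
proof (rule bij_betw_imageI)
  show "inj_on (\<lambda>(l, q). l @ x # q) (?L \<times> ?Q)"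
  proof (rule inj_onI, safe)
    fix l q l' q' assume q: "set q \<subseteq> U - {x}" "set q' \<subseteq> U - {x}" and e: "l @ x # q = l' @ x # q'"
    \<comment> \<open>Read backwards, the walk shows \<open>q\<close> up to the first
      \<open>x\<close>, so \<open>l @ x # q\<close> determines \<open>q\<close>.\<close>
    have *: "takeWhile (\<lambda>v. v \<noteq> x) (rev (l @ x # q)) = rev q" if "set q \<subseteq> U - {x}" for l q
      using that by (auto simp: takeWhile_append)
    have "rev q = rev q'" using *[OF q(1), of l] *[OF q(2), of l'] e by simp
    then have "q = q'" by simp
    with e show "l = l'" "q = q'" by auto
  qed
  show "(\<lambda>(l, q). l @ x # q) ` (?L \<times> ?Q) = {p. p \<noteq> [] \<and> hd p = x \<and> set p \<subseteq> U}"
  proof (intro set_eqI iffI)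
    fix p assume "p \<in> (\<lambda>(l, q). l @ x # q) ` (?L \<times> ?Q)"
    then obtain l q where p: "p = l @ x # q" "l \<in> ?L" "q \<in> ?Q" by auto
    then show "p \<in> {p. p \<noteq> [] \<and> hd p = x \<and> set p \<subseteq> U}" using assms by (cases l) auto
  next
    fix p assume p: "p \<in> {p. p \<noteq> [] \<and> hd p = x \<and> set p \<subseteq> U}"
    then have "x \<in> set p" by auto
    from split_list_last[OF this] obtain l q where lq: "p = l @ x # q" "x \<notin> set q" by auto
    then have "(l, q) \<in> ?L \<times> ?Q" using p by (cases l) auto
    then show "p \<in> (\<lambda>(l, q). l @ x # q) ` (?L \<times> ?Q)" using lq(1) by force
  qed
qed

text \<open>The walks whose loop erasure is \<open>x # \<gamma>\<close> split uniquely, at the last visit of \<open>x\<close>, into a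
  closed walk from \<open>x\<close> to \<open>x\<close> and a walk avoiding \<open>x\<close> whose loop erasure is \<open>\<gamma>\<close>.\<close>

lemma sum_walks_loop_erasure:
  fixes w :: "'a::countable option \<Rightarrow> 'a option \<Rightarrow> ennreal"
  assumes "finite U" "\<And>V x. V \<subseteq> U \<Longrightarrow> x \<in> V \<Longrightarrow> green w V x < \<top>"
    and "distinct \<gamma>" "set \<gamma> \<subseteq> U"
  shows "(\<integral>\<^sup>+p. walk_weight w (p @ [y]) \<partial>count_space {p. set p \<subseteq> U \<and> erased_path p = \<gamma>}) * loop_exp w (U - set \<gamma>) =
    walk_weight w (\<gamma> @ [y]) * loop_exp w U"
  using assms
proof (induction \<gamma> arbitrary: U)
  case Nil
  have "{p :: 'a option list. set p \<subseteq> U \<and> erased_path p = []} = {[]}"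
    using erased_path_nonempty(1) by force
  then show ?case by (simp add: nn_integral_count_space_finite)
next
  case (Cons x \<gamma>)
  let ?L = "{l. set l \<subseteq> U \<and> hd (l @ [x]) = x}"
  let ?A = "\<lambda>U \<gamma>. {p. set p \<subseteq> U \<and> erased_path p = \<gamma>}"
  have x: "x \<in> U" using Cons.prems by simp
  have b: "bij_betw (\<lambda>(l, q). l @ x # q) (?L \<times> ?A (U - {x}) \<gamma>) (?A U (x # \<gamma>))"
  proof (rule bij_betw_imageI)
    show "inj_on (\<lambda>(l, q). l @ x # q) (?L \<times> ?A (U - {x}) \<gamma>)"
      by (rule inj_on_subset[OF bij_betw_imp_inj_on[OF bij_betw_last_exit[OF x]]]) auto
    show "(\<lambda>(l, q). l @ x # q) ` (?L \<times> ?A (U - {x}) \<gamma>) = ?A U (x # \<gamma>)"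
    proof (intro set_eqI iffI)
      fix p assume "p \<in> (\<lambda>(l, q). l @ x # q) ` (?L \<times> ?A (U - {x}) \<gamma>)"
      then obtain l q where p: "p = l @ x # q" "l \<in> ?L" "q \<in> ?A (U - {x}) \<gamma>" by auto
      then have "erased_path p = x # \<gamma>" using erased_path_last_exit[of l x q] by auto
      with p x show "p \<in> ?A U (x # \<gamma>)" by auto
    next
      fix p assume "p \<in> ?A U (x # \<gamma>)"
      then have "set p \<subseteq> U" and "erased_path p = x # \<gamma>" by auto
      then obtain l q where lq: "p = l @ x # q" "hd (l @ [x]) = x" "x \<notin> set q" "erased_path q = \<gamma>"
        using erased_path_cases by metis
      then have "(l, q) \<in> ?L \<times> ?A (U - {x}) \<gamma>" using \<open>set p \<subseteq> U\<close> by auto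
      then show "p \<in> (\<lambda>(l, q). l @ x # q) ` (?L \<times> ?A (U - {x}) \<gamma>)" using lq(1) by force
    qed
  qed
  let ?S = "\<integral>\<^sup>+q. walk_weight w (q @ [y]) \<partial>count_space (?A (U - {x}) \<gamma>)"
  have "(\<integral>\<^sup>+p. walk_weight w (p @ [y]) \<partial>count_space (?A U (x # \<gamma>))) =
    (\<integral>\<^sup>+a. walk_weight w (fst a @ [x]) * (w x (hd (\<gamma> @ [y])) * walk_weight w (snd a @ [y])) \<partial>count_space (?L \<times> ?A (U - {x}) \<gamma>))"
    unfolding nn_integral_bij_count_space[OF b, symmetric]
  proof (rule nn_integral_cong)
    fix a assume "a \<in> space (count_space (?L \<times> ?A (U - {x}) \<gamma>))"
    then obtain l q where a: "a = (l, q)" "erased_path q = \<gamma>" by auto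
    \<comment> \<open>The vertex after the last exit from \<open>x\<close> is the same for the walk
      and for its loop erasure, so the weight of this step does not depend on the walk.\<close>
    obtain z zs where z: "q @ [y] = z # zs" by (cases q) auto
    then have "z = hd (\<gamma> @ [y])" using hd_erased_path_append[of q y] a by simp
    then show "walk_weight w ((case a of (l, q) \<Rightarrow> l @ x # q) @ [y]) =
      walk_weight w (fst a @ [x]) * (w x (hd (\<gamma> @ [y])) * walk_weight w (snd a @ [y]))"
      using walk_weight_append[of w l x "q @ [y]"] by (simp add: a z)
  qed
  also have "\<dots> = green w U x * (w x (hd (\<gamma> @ [y])) * ?S)"
    by (subst nn_integral_count_space_product) (auto simp: green_def nn_integral_cmult)
  finally have 1: "(\<integral>\<^sup>+p. walk_weight w (p @ [y]) \<partial>count_space (?A U (x # \<gamma>))) = green w U x * (w x (hd (\<gamma> @ [y])) * ?S)" .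
  have IH: "?S * loop_exp w (U - {x} - set \<gamma>) = walk_weight w (\<gamma> @ [y]) * loop_exp w (U - {x})"
  proof (rule Cons.IH)
    show "green w V v < \<top>" if "V \<subseteq> U - {x}" "v \<in> V" for V v
      using Cons.prems(2)[of V v] that by auto
  qed (use Cons.prems in auto)
  have "loop_mass w (U - {x}) < \<top>"
  proof (rule loop_mass_finite)
    show "green w V v < \<top>" if "V \<subseteq> U - {x}" "v \<in> V" for V v
      using Cons.prems(2)[of V v] that by auto
  qed (use Cons.prems in auto)
  \<comment> \<open>The telescoping step: the sum over the closed walks at \<open>x\<close> is the
    quotient of the factors of \<open>U\<close> and \<open>U - {x}\<close>.\<close>
  from loop_exp_remove(2)[OF x Cons.prems(1) Cons.prems(2)[OF order_refl x] this]
  have 2: "loop_exp w U = green w U x * loop_exp w (U - {x})" .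
  have 3: "walk_weight w ((x # \<gamma>) @ [y]) = w x (hd (\<gamma> @ [y])) * walk_weight w (\<gamma> @ [y])"
    by (cases \<gamma>) auto
  have 4: "U - set (x # \<gamma>) = U - {x} - set \<gamma>" by auto
  have "green w U x * (w x (hd (\<gamma> @ [y])) * ?S) * loop_exp w (U - {x} - set \<gamma>) =
    green w U x * (w x (hd (\<gamma> @ [y])) * (?S * loop_exp w (U - {x} - set \<gamma>)))"
    by (simp only: mult.assoc)
  also have "\<dots> = walk_weight w ((x # \<gamma>) @ [y]) * loop_exp w U"
    unfolding IH 2 3 by (simp only: mult_ac)
  finally show ?case unfolding 1 4 .
qed

text \<open>Last-exit decomposition with only the end point prescribed. Summed over \<open>y\<close>
  outside \<open>U\<close>, the left side becomes a total probability, and this bounds the Green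
  function.\<close>

lemma green_times_escape:
  fixes w :: "'b::countable \<Rightarrow> 'b \<Rightarrow> ennreal"
  assumes "x \<in> U"
  shows "(\<integral>\<^sup>+p. walk_weight w (p @ [y]) \<partial>count_space {p. p \<noteq> [] \<and> hd p = x \<and> set p \<subseteq> U}) =
    green w U x * (\<integral>\<^sup>+q. walk_weight w (x # q @ [y]) \<partial>count_space {q. set q \<subseteq> U - {x}})"
proof -
  let ?L = "{l. set l \<subseteq> U \<and> hd (l @ [x]) = x}" and ?Q = "{q. set q \<subseteq> U - {x}}"
  note b = bij_betw_last_exit[OF assms]
  have "(\<integral>\<^sup>+p. walk_weight w (p @ [y]) \<partial>count_space {p. p \<noteq> [] \<and> hd p = x \<and> set p \<subseteq> U}) =
    (\<integral>\<^sup>+a. walk_weight w (fst a @ [x]) * walk_weight w (x # snd a @ [y]) \<partial>count_space (?L \<times> ?Q))"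
    unfolding nn_integral_bij_count_space[OF b, symmetric]
    using walk_weight_append[of w _ x "_ @ [y]"] by (intro nn_integral_cong) (auto)
  also have "\<dots> = green w U x * (\<integral>\<^sup>+q. walk_weight w (x # q @ [y]) \<partial>count_space ?Q)"
    by (subst nn_integral_count_space_product) (auto simp: green_def)
  finally show ?thesis .
qed

section \<open>The killed chain\<close>

abbreviation unit_exponential :: "real measure" where
  "unit_exponential \<equiv> density lborel (exponential_density 1)"

lemma prob_space_unit_exponential: "prob_space unit_exponential"
  by (rule prob_space_exponential_density) simp

lemma sets_holding_measure [measurable_cong]: "sets holding_measure = sets (\<Pi>\<^sub>M n\<in>UNIV. borel)"
  unfolding holding_measure_def by (intro sets_PiM_cong) auto

lemma space_holding_measure: "space holding_measure = UNIV"
  using sets_eq_imp_space_eq[OF sets_holding_measure] by (simp add: space_PiM)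

text \<open>The integrand sees finitely many coordinates, so the infinite product measure may be
  projected to a finite one, where the integral factorises.\<close>

lemma nn_integral_holding_prod:
  assumes [measurable]: "\<And>i. g i \<in> borel_measurable borel"
  shows "(\<integral>\<^sup>+\<tau>. (\<Prod>i<n. g i (\<tau> i)) \<partial>holding_measure) = (\<Prod>i<n. \<integral>\<^sup>+r. g i r \<partial>unit_exponential)"
proof -
  interpret product_prob_space "\<lambda>_::nat. unit_exponential" UNIV
    using prob_space_unit_exponential
    by (simp add: product_prob_space_def product_prob_space_axioms_def product_sigma_finite_def prob_space_imp_sigma_finite)
  have "(\<Prod>i<n. \<integral>\<^sup>+r. g i r \<partial>unit_exponential) = (\<integral>\<^sup>+\<tau>. (\<Prod>i<n. g i (\<tau> i)) \<partial>(\<Pi>\<^sub>M i\<in>{..<n}. unit_exponential))"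
    by (rule product_nn_integral_prod[symmetric]) auto
  also have "\<dots> = (\<integral>\<^sup>+\<tau>. (\<Prod>i<n. g i (\<tau> i)) \<partial>distr (\<Pi>\<^sub>M i\<in>UNIV. unit_exponential) (\<Pi>\<^sub>M i\<in>{..<n}. unit_exponential) (\<lambda>x. restrict x {..<n}))"
    by (subst distr_PiM_restrict_finite) auto
  also have "\<dots> = (\<integral>\<^sup>+\<tau>. (\<Prod>i<n. g i (\<tau> i)) \<partial>(\<Pi>\<^sub>M i\<in>UNIV. unit_exponential))"
    by (subst nn_integral_distr) (auto intro!: nn_integral_cong prod.cong)
  finally show ?thesis by (simp add: holding_measure_def)
qed

lemma nn_integral_exp:
  assumes "b > 0"
  shows "(\<integral>\<^sup>+r\<in>{0..}. ennreal (exp (- (b * r))) \<partial>lborel) = ennreal (1 / b)"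
proof -
  interpret prob_space "density lborel (exponential_density b)"
    by (rule prob_space_exponential_density[OF assms])
  have "1 = (\<integral>\<^sup>+r. ennreal (exponential_density b r) \<partial>lborel)"
    using emeasure_space_1 by (subst (asm) emeasure_density) auto
  also have "\<dots> = (\<integral>\<^sup>+r. ennreal b * (ennreal (exp (- (b * r))) * indicator {0..} r) \<partial>lborel)"
    using assms by (intro nn_integral_cong)
      (auto simp: exponential_density_def ennreal_mult[symmetric] mult.commute split: split_indicator)
  also have "\<dots> = ennreal b * (\<integral>\<^sup>+r\<in>{0..}. ennreal (exp (- (b * r))) \<partial>lborel)"
    by (subst nn_integral_cmult) auto
  finally have "1 = ennreal b * (\<integral>\<^sup>+r\<in>{0..}. ennreal (exp (- (b * r))) \<partial>lborel)" .
  then have "ennreal (1 / b) * 1 = ennreal (1 / b) * (ennreal b * (\<integral>\<^sup>+r\<in>{0..}. ennreal (exp (- (b * r))) \<partial>lborel))"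
    by simp
  also have "\<dots> = (\<integral>\<^sup>+r\<in>{0..}. ennreal (exp (- (b * r))) \<partial>lborel)"
    using assms by (simp add: mult.assoc[symmetric] ennreal_mult[symmetric])
  finally show ?thesis by simp
qed

lemma nn_integral_unit_exponential:
  assumes [measurable]: "g \<in> borel_measurable borel"
  shows "(\<integral>\<^sup>+r. g r \<partial>unit_exponential) = (\<integral>\<^sup>+r\<in>{0..}. g r * ennreal (exp (- r)) \<partial>lborel)"
proof -
  have "(\<integral>\<^sup>+r. g r \<partial>unit_exponential) = (\<integral>\<^sup>+r. ennreal (exponential_density 1 r) * g r \<partial>lborel)"
    by (rule nn_integral_density) auto
  also have "\<dots> = (\<integral>\<^sup>+r\<in>{0..}. g r * ennreal (exp (- r)) \<partial>lborel)"
    by (intro nn_integral_cong) (auto simp: exponential_density_def mult.commute split: split_indicator)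
  finally show ?thesis .
qed

lemma nn_integral_unit_exponential_exp:
  assumes "c \<ge> 0"
  shows "(\<integral>\<^sup>+r. ennreal (exp (- (c * r))) \<partial>unit_exponential) = ennreal (1 / (1 + c))"
proof -
  have "(\<integral>\<^sup>+r. ennreal (exp (- (c * r))) \<partial>unit_exponential) = (\<integral>\<^sup>+r\<in>{0..}. ennreal (exp (- ((1 + c) * r))) \<partial>lborel)"
    by (subst nn_integral_unit_exponential)
      (auto intro!: nn_integral_cong simp: ennreal_mult[symmetric] exp_add[symmetric] algebra_simps split: split_indicator)
  then show ?thesis using assms by (simp add: nn_integral_exp)
qed

lemma measurable_state: "(\<lambda>z. fst (z i)) \<in> measurable trajectory_space (count_space UNIV)"
  by measurable

lemma measurable_prefix:
  "(\<lambda>z. map (fst \<circ> z) [0..<n]) \<in> measurable trajectory_space (count_space (UNIV :: 'a::finite option list set))"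
proof (induction n)
  case (Suc n)
  have "(\<lambda>z. map (fst \<circ> z) [0..<n] @ [fst (z n)]) \<in> measurable trajectory_space (count_space (UNIV :: 'a option list set))"
    by (rule measurable_compose_countable'[where I = UNIV, OF _ Suc.IH])
      (auto intro: measurable_compose_countable'[where I = UNIV, OF _ measurable_state])
  then show ?case by (simp add: o_def)
qed simp

lemma measurable_holding: "(\<lambda>z. snd \<circ> z) \<in> measurable trajectory_space holding_measure"
  unfolding o_def
  by (subst measurable_cong_sets[OF refl sets_holding_measure])
    (rule measurable_PiM_single', measurable)

lemma AE_holding_pos: "AE \<tau> in holding_measure. \<forall>i. \<tau> i > 0"
proof -
  have "AE r in unit_exponential. 0 < r"
  proof (subst AE_density)
    have "AE r in lborel. r \<noteq> (0::real)" by (rule AE_lborel_singleton)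
    then show "AE r in lborel. 0 < ennreal (exponential_density 1 r) \<longrightarrow> 0 < r"
      by eventually_elim (auto simp: exponential_density_def split: if_splits)
  qed simp
  then have "AE \<tau> in holding_measure. \<tau> i > 0" for i
    unfolding holding_measure_def
    by (intro AE_PiM_component prob_space_unit_exponential) auto
  then show ?thesis by (simp add: AE_all_countable)
qed

locale killed_chain =
  fixes C :: "'a::finite \<Rightarrow> 'a \<Rightarrow> real" and \<kappa> :: "'a \<Rightarrow> real"
  assumes C_nonneg: "\<And>x y. C x y \<ge> 0"
    and C_diag: "\<And>x. C x x = 0"
    and connected: "\<And>x y. (x, y) \<in> (edge_pairs C)\<^sup>*"
    and kappa_nonneg: "\<And>x. \<kappa> x \<ge> 0"
    and kappa_nonzero: "\<exists>x. \<kappa> x \<noteq> 0"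
begin

abbreviation wt :: "'a \<Rightarrow> real" where
  "wt \<equiv> weight C \<kappa>"

lemma w_pos: "wt x > 0"
  by (rule weight_pos[OF C_nonneg connected kappa_nonneg kappa_nonzero])

abbreviation jp :: "'a option \<Rightarrow> 'a option \<Rightarrow> ennreal" where
  "jp u v \<equiv> ennreal (pmf (jump_pmf C \<kappa> u) v)"

lemma jp_Some: "jp (Some x) (Some y) = ennreal (C x y / wt x)"
  using pmf_jump_pmf_Some[OF C_nonneg kappa_nonneg w_pos] by simp_all

lemma weight_sum: "\<kappa> x / wt x + (\<Sum>y\<in>UNIV. C x y / wt x) = 1"
proof -
  have "\<kappa> x / wt x + (\<Sum>y\<in>UNIV. C x y / wt x) = (\<kappa> x + (\<Sum>y\<in>UNIV. C x y)) / wt x"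
    by (simp add: add_divide_distrib sum_divide_distrib)
  also have "\<dots> = wt x / wt x" by (simp only: weight_def)
  finally have "\<kappa> x / wt x + (\<Sum>y\<in>UNIV. C x y / wt x) = wt x / wt x" .
  then show ?thesis using w_pos[of x] by simp
qed

section \<open>Finite-dimensional laws of the chain\<close>

definition prefixes :: "'a \<Rightarrow> nat \<Rightarrow> 'a option list set" where
  "prefixes x n = {q. length q = Suc n \<and> hd q = Some x}"

lemma finite_prefixes [simp]: "finite (prefixes x n)"
  by (rule finite_subset[OF _ finite_lists_length_eq[of "UNIV :: 'a option set" "Suc n"]])
    (auto simp: prefixes_def)

lemma nn_integral_jump_chain_prefix:
  "(\<integral>\<^sup>+U. f (map (jump_chain U x) [0..<Suc n]) \<partial>arrow_measure C \<kappa>) =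
    (\<Sum>q\<in>prefixes x n. f q * walk_weight jp q)"
proof -
  let ?A = "arrow_measure C \<kappa>"
  let ?E = "\<lambda>q. {U \<in> space ?A. \<forall>i\<le>n. jump_chain U x i = q ! i}"
  have pref: "map (jump_chain U x) [0..<Suc n] = q \<longleftrightarrow> (\<forall>i\<le>n. jump_chain U x i = q ! i)"
    if "length q = Suc n" for U q
    using that by (auto simp: list_eq_iff_nth_eq less_Suc_eq_le simp del: upt_Suc)
  have in_pref: "map (jump_chain U x) [0..<Suc n] \<in> prefixes x n" for U
    by (simp add: prefixes_def hd_map del: upt_Suc)
  have "(\<integral>\<^sup>+U. f (map (jump_chain U x) [0..<Suc n]) \<partial>?A) =
    (\<integral>\<^sup>+U. (\<Sum>q\<in>prefixes x n. f q * indicator (?E q) U) \<partial>?A)"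
  proof (rule nn_integral_cong)
    fix U assume U: "U \<in> space ?A"
    let ?q = "map (jump_chain U x) [0..<Suc n]"
    have "(\<Sum>q\<in>prefixes x n. f q * indicator (?E q) U) = (\<Sum>q\<in>{?q}. f q * indicator (?E q) U)"
    proof (rule sum.mono_neutral_right)
      show "\<forall>q\<in>prefixes x n - {?q}. f q * indicator (?E q) U = 0"
      proof
        fix q assume q: "q \<in> prefixes x n - {?q}"
        then have "\<not> (\<forall>i\<le>n. jump_chain U x i = q ! i)"
          using pref[of q U] by (auto simp: prefixes_def simp del: upt_Suc)
        then show "f q * indicator (?E q) U = 0" by simp
      qed
      show "{?q} \<subseteq> prefixes x n" using in_pref by blast
    qed simp
    also have "\<dots> = f ?q"
    proof -
      have "U \<in> ?E ?q" using U by (auto simp: less_Suc_eq_le simp del: upt_Suc)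
      then show ?thesis by (simp del: upt_Suc)
    qed
    finally show "f ?q = (\<Sum>q\<in>prefixes x n. f q * indicator (?E q) U)" by simp
  qed
  also have "\<dots> = (\<Sum>q\<in>prefixes x n. f q * emeasure ?A (?E q))"
    by (subst nn_integral_sum) (auto simp: nn_integral_cmult)
  also have "\<dots> = (\<Sum>q\<in>prefixes x n. f q * walk_weight jp q)"
  proof (rule sum.cong[OF refl])
    fix q assume q: "q \<in> prefixes x n"
    then have "q ! 0 = Some x" by (cases q) (auto simp: prefixes_def)
    then show "f q * emeasure ?A (?E q) = f q * walk_weight jp q"
      using q by (subst emeasure_jump_chain_prefix) (auto simp: walk_weight_conv_prod prefixes_def)
  qed
  finally show ?thesis .
qed

text \<open>Jump chain and holding times are independent, so fixing the first \<open>n\<close> jumps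
  leaves the law of all holding times unchanged. The kernel may use any of them, in particular the
  one that a given time interrupts.\<close>

lemma nn_integral_chain_prefix:
  assumes k[measurable]: "\<And>q. k q \<in> borel_measurable holding_measure"
  shows "(\<integral>\<^sup>+z. k (map (fst \<circ> z) [0..<Suc n]) (snd \<circ> z) \<partial>chain_law C \<kappa> x) =
    (\<Sum>q\<in>prefixes x n. walk_weight jp q * (\<integral>\<^sup>+\<tau>. k q \<tau> \<partial>holding_measure))"
proof -
  let ?A = "arrow_measure C \<kappa>"
  interpret h: prob_space holding_measure by (rule prob_space_holding_measure)
  have m: "(\<lambda>z. k (map (fst \<circ> z) [0..<Suc n]) (snd \<circ> z)) \<in> borel_measurable trajectory_space"
    by (rule measurable_compose_countable'[where I = UNIV, OF _ measurable_prefix])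
      (rule measurable_compose[OF measurable_holding k], simp)
  have "(\<integral>\<^sup>+z. k (map (fst \<circ> z) [0..<Suc n]) (snd \<circ> z) \<partial>chain_law C \<kappa> x) =
    (\<integral>\<^sup>+p. k (map (jump_chain (fst p) x) [0..<Suc n]) (snd p) \<partial>(?A \<Otimes>\<^sub>M holding_measure))"
    unfolding chain_law_def
    by (subst nn_integral_distr[OF measurable_chain])
      (use m in \<open>auto simp: o_def case_prod_beta simp del: upt_Suc\<close>)
  also have "\<dots> = (\<integral>\<^sup>+U. \<integral>\<^sup>+\<tau>. k (map (jump_chain U x) [0..<Suc n]) \<tau> \<partial>holding_measure \<partial>?A)"
  proof (subst h.nn_integral_fst[symmetric])
    show "(\<lambda>p. k (map (jump_chain (fst p) x) [0..<Suc n]) (snd p)) \<in> borel_measurable (?A \<Otimes>\<^sub>M holding_measure)"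
      using measurable_compose[OF measurable_chain m]
      by (simp add: o_def case_prod_beta del: upt_Suc)
  qed simp
  also have "\<dots> = (\<Sum>q\<in>prefixes x n. walk_weight jp q * (\<integral>\<^sup>+\<tau>. k q \<tau> \<partial>holding_measure))"
    by (subst nn_integral_jump_chain_prefix) (simp add: mult.commute)
  finally show ?thesis .
qed

section \<open>Transience\<close>

text \<open>The probability that the chain started at \<open>x\<close> makes \<open>n\<close> jumps
  without being killed.\<close>

primrec survival :: "nat \<Rightarrow> 'a \<Rightarrow> real" where
  "survival 0 x = 1"
| "survival (Suc n) x = (\<Sum>y\<in>UNIV. C x y / wt x * survival n y)"

lemma C_div_nonneg: "0 \<le> C x y / wt x"
  using C_nonneg[of x y] w_pos[of x] by simp

lemma survival_nonneg: "0 \<le> survival n x"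
proof (induction n arbitrary: x)
  case (Suc n)
  show ?case unfolding survival.simps
    by (intro sum_nonneg mult_nonneg_nonneg C_div_nonneg Suc.IH)
qed simp

lemma survival_Suc_le: "survival (Suc n) x \<le> survival n x"
proof (induction n arbitrary: x)
  case 0
  have "0 \<le> \<kappa> x / wt x" using kappa_nonneg[of x] w_pos[of x] by simp
  then show ?case using weight_sum[of x] by simp
next
  case (Suc n)
  show ?case unfolding survival.simps(2)[of "Suc n"] survival.simps(2)[of n x]
    by (intro sum_mono mult_left_mono Suc.IH C_div_nonneg)
qed

text \<open>The decreasing limit is harmonic for the killed chain. By the maximum principle and
  connectedness it is constant, and a vertex with killing forces the constant to be 0.\<close>

lemma survival_tendsto_0: "(\<lambda>n. survival n x) \<longlonglongrightarrow> 0"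
proof -
  have dec: "decseq (\<lambda>n. survival n x)" for x
    by (rule decseq_SucI) (rule survival_Suc_le)
  have "\<exists>l. (\<lambda>n. survival n x) \<longlonglongrightarrow> l" for x
    using decseq_convergent[OF dec[of x], of 0] survival_nonneg by metis
  then obtain h where h: "\<And>x. (\<lambda>n. survival n x) \<longlonglongrightarrow> h x" by metis
  have h0: "0 \<le> h x" for x by (rule LIMSEQ_le_const[OF h]) (auto intro: survival_nonneg)
  have harm: "h x = (\<Sum>y\<in>UNIV. C x y / wt x * h y)" for x
  proof (rule LIMSEQ_unique)
    show "(\<lambda>n. survival (Suc n) x) \<longlonglongrightarrow> h x" using h by (rule LIMSEQ_Suc)
    show "(\<lambda>n. survival (Suc n) x) \<longlonglongrightarrow> (\<Sum>y\<in>UNIV. C x y / wt x * h y)"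
      unfolding survival.simps(2) by (intro tendsto_intros h)
  qed
  define m where "m = Max (range h)"
  have le: "h y \<le> m" for y by (simp add: m_def)
  have m: "m \<in> range h" unfolding m_def by (rule Max_in) auto
  \<comment> \<open>maximum principle: a vertex of maximal value has no killing and forces its neighbours\<close>
  have key: "\<kappa> x / wt x * m = 0 \<and> (\<forall>y. C x y > 0 \<longrightarrow> h y = m)" if "h x = m" for x
  proof -
    have nn: "0 \<le> C x y / wt x * (m - h y)" for y
      using C_div_nonneg[of x y] le[of y] by (intro mult_nonneg_nonneg) auto
    \<comment> \<open>Since the transition probabilities, killing included, add up to 1, harmonicity
      writes 0 = \<open>m - h x\<close> as a sum of nonnegative terms, all of which must
      vanish.\<close>
    have "\<kappa> x / wt x * m + (\<Sum>y\<in>UNIV. C x y / wt x * (m - h y)) =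
      (\<kappa> x / wt x + (\<Sum>y\<in>UNIV. C x y / wt x)) * m - (\<Sum>y\<in>UNIV. C x y / wt x * h y)"
      by (simp add: sum_subtractf algebra_simps sum_distrib_left diff_divide_distrib)
    also have "\<dots> = 0" using weight_sum[of x] harm[of x] that by simp
    finally have s: "\<kappa> x / wt x * m + (\<Sum>y\<in>UNIV. C x y / wt x * (m - h y)) = 0" .
    have k: "0 \<le> \<kappa> x / wt x * m"
      using kappa_nonneg[of x] w_pos[of x] h0[of x] that by (intro mult_nonneg_nonneg) auto
    have "(\<Sum>y\<in>UNIV. C x y / wt x * (m - h y)) = 0"
      using s k sum_nonneg[of UNIV "\<lambda>y. C x y / wt x * (m - h y)"] nn by auto
    then have "\<forall>y. C x y / wt x * (m - h y) = 0"
      using nn by (subst (asm) sum_nonneg_eq_0_iff) auto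
    then have "\<forall>y. C x y > 0 \<longrightarrow> h y = m" using w_pos[of x] by (auto simp: less_le)
    moreover have "\<kappa> x / wt x * m = 0" using s \<open>(\<Sum>y\<in>UNIV. C x y / wt x * (m - h y)) = 0\<close> by simp
    ultimately show ?thesis by simp
  qed
  obtain x0 where x0: "h x0 = m" using m by auto
  have all: "h y = m" for y
    using connected[of x0 y]
  proof (induction rule: rtrancl_induct)
    case (step y z)
    then show ?case using key[OF step.IH] by (auto simp: edge_pairs_def)
  qed (rule x0)
  obtain z where "\<kappa> z \<noteq> 0" using kappa_nonzero by blast
  then have "m = 0" using key[OF all[of z]] w_pos[of z] by auto
  then show ?thesis using h[of x] all[of x] by simp
qed

lemma survival_eq: "(\<Sum>q\<in>{q\<in>prefixes x n. None \<notin> set q}. walk_weight jp q) = ennreal (survival n x)"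
proof (induction n arbitrary: x)
  case 0
  have "{q\<in>prefixes x 0. None \<notin> set q} = {[Some x]}"
    by (auto simp: prefixes_def length_Suc_conv)
  then show ?case by simp
next
  case (Suc n)
  let ?B = "\<lambda>n x. {q\<in>prefixes x n. None \<notin> set q}"
  have B: "?B (Suc n) x = (\<Union>y\<in>UNIV. Cons (Some x) ` ?B n y)"
  proof (intro set_eqI iffI)
    fix q assume q: "q \<in> ?B (Suc n) x"
    then obtain q' where q': "q = Some x # q'" "length q' = Suc n" "None \<notin> set q'"
      by (cases q) (auto simp: prefixes_def)
    then obtain v vs where "q' = v # vs" by (cases q') auto
    with q'(3) obtain y where "q' = Some y # vs" by (cases v) auto
    with q' have "q' \<in> ?B n y" by (auto simp: prefixes_def)
    with q'(1) show "q \<in> (\<Union>y\<in>UNIV. Cons (Some x) ` ?B n y)" by blast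
  qed (auto simp: prefixes_def)
  have "(\<Sum>q\<in>?B (Suc n) x. walk_weight jp q) = (\<Sum>y\<in>UNIV. \<Sum>q\<in>Cons (Some x) ` ?B n y. walk_weight jp q)"
    unfolding B by (rule sum.UNION_disjoint) (simp, simp, auto simp: prefixes_def)
  also have "\<dots> = (\<Sum>y\<in>UNIV. \<Sum>q\<in>?B n y. jp (Some x) (Some y) * walk_weight jp q)"
  proof (rule sum.cong[OF refl])
    fix y
    have "walk_weight jp (Some x # q) = jp (Some x) (Some y) * walk_weight jp q" if "q \<in> ?B n y" for q
      using that by (cases q) (auto simp: prefixes_def)
    then show "(\<Sum>q\<in>Cons (Some x) ` ?B n y. walk_weight jp q) = (\<Sum>q\<in>?B n y. jp (Some x) (Some y) * walk_weight jp q)"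
      by (subst sum.reindex) auto
  qed
  also have "\<dots> = (\<Sum>y\<in>UNIV. ennreal (C x y / wt x) * ennreal (survival n y))"
    by (simp add: sum_distrib_left[symmetric] Suc.IH jp_Some)
  also have "\<dots> = ennreal (survival (Suc n) x)"
    unfolding survival.simps
    by (subst sum_ennreal[symmetric])
      (simp_all only: ennreal_mult[OF C_div_nonneg survival_nonneg] mult_nonneg_nonneg[OF C_div_nonneg survival_nonneg])
  finally show ?case .
qed

lemma AE_jump_chain_killed: "AE U in arrow_measure C \<kappa>. \<exists>n. jump_chain U x n = None"
proof -
  let ?A = "arrow_measure C \<kappa>"
  let ?N = "{U \<in> space ?A. \<forall>n. jump_chain U x n \<noteq> None}"
  have [measurable]: "?N \<in> sets ?A" by measurable
  have le: "emeasure ?A ?N \<le> ennreal (survival n x)" for n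
  proof -
    let ?f = "\<lambda>q. of_bool (None \<notin> set q) :: ennreal"
    have "emeasure ?A ?N = (\<integral>\<^sup>+U. indicator ?N U \<partial>?A)" by simp
    also have "\<dots> \<le> (\<integral>\<^sup>+U. ?f (map (jump_chain U x) [0..<Suc n]) \<partial>?A)"
      by (intro nn_integral_mono) (auto simp: indicator_def of_bool_def image_iff simp del: upt_Suc not_None_eq, metis)
    also have "\<dots> = (\<Sum>q\<in>prefixes x n. ?f q * walk_weight jp q)"
      by (rule nn_integral_jump_chain_prefix)
    also have "\<dots> = (\<Sum>q\<in>{q\<in>prefixes x n. None \<notin> set q}. walk_weight jp q)"
      by (intro sum.mono_neutral_cong_right) auto
    finally show ?thesis by (simp add: survival_eq)
  qed
  have "emeasure ?A ?N \<le> ennreal 0"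
    by (rule LIMSEQ_le_const[OF tendsto_ennrealI[OF survival_tendsto_0[of x]]]) (use le in auto)
  then have "emeasure ?A ?N = 0" by simp
  then show ?thesis by (intro AE_I[of _ _ ?N]) auto
qed

lemma AE_chain_killed: "AE z in chain_law C \<kappa> x. \<exists>n. fst (z n) = None"
proof -
  interpret h: prob_space holding_measure by (rule prob_space_holding_measure)
  interpret a: prob_space "arrow_measure C \<kappa>" by (rule prob_space_arrow_measure)
  interpret ah: pair_prob_space "arrow_measure C \<kappa>" holding_measure ..
  have "AE p in arrow_measure C \<kappa> \<Otimes>\<^sub>M holding_measure. \<exists>n. jump_chain (fst p) x n = None"
    by (rule ah.AE_pair_measure) (use AE_jump_chain_killed[of x] in auto)
  then show ?thesis unfolding chain_law_def
    by (subst AE_distr_iff[OF measurable_chain]) (auto simp: case_prod_beta)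
qed

lemma AE_chain_holding_pos: "AE z in chain_law C \<kappa> x. \<forall>i. snd (z i) > 0"
proof -
  interpret h: prob_space holding_measure by (rule prob_space_holding_measure)
  interpret a: prob_space "arrow_measure C \<kappa>" by (rule prob_space_arrow_measure)
  interpret ah: pair_prob_space "arrow_measure C \<kappa>" holding_measure ..
  have [measurable]: "(\<lambda>\<tau>. \<tau> n) \<in> measurable holding_measure borel" for n
    by measurable
  have "AE p in arrow_measure C \<kappa> \<Otimes>\<^sub>M holding_measure. \<forall>i. snd p i > 0"
    by (rule ah.AE_pair_measure) (use AE_holding_pos in auto)
  then show ?thesis unfolding chain_law_def
    by (subst AE_distr_iff[OF measurable_chain]) (auto simp: case_prod_beta)
qed

text \<open>Decomposition according to the hitting time \<open>n\<close>: the first \<open>n\<close>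
  states form a walk outside \<open>V\<close>, the next one lies in \<open>V\<close>, and the
  holding times are integrated out visit by visit. \<open>Q\<close> is an arbitrary function of the
  walk and its end point, \<open>g\<close> a factor for each visit.\<close>

lemma nn_integral_chain_hitting:
  assumes V: "None \<in> V" "Some x \<notin> V" and g[measurable]: "\<And>v. g v \<in> borel_measurable borel"
  shows "(\<integral>\<^sup>+z. Q (map (fst \<circ> z) [0..<hitting_index z V]) (fst (z (hitting_index z V))) *
      (\<Prod>i<hitting_index z V. g (fst (z i)) (snd (z i))) \<partial>chain_law C \<kappa> x) =
    (\<Sum>y\<in>V. \<integral>\<^sup>+p. Q p y * (walk_weight jp (p @ [y]) * (\<Prod>v\<leftarrow>p. \<integral>\<^sup>+r. g v r \<partial>unit_exponential))
      \<partial>count_space {p. set p \<subseteq> - V \<and> p \<noteq> [] \<and> hd p = Some x})"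
proof -
  define k where "k n q \<tau> = of_bool (set (butlast q) \<subseteq> - V \<and> last q \<in> V) *
    (Q (butlast q) (last q) * (\<Prod>i<n. g (q ! i) (\<tau> i)))" for n :: nat and q \<tau>
  have km[measurable]: "k n q \<in> borel_measurable holding_measure" for n q
    unfolding k_def by measurable
  let ?P = "\<lambda>n z. map (fst \<circ> z) [0..<Suc n]"
  have "(\<integral>\<^sup>+z. Q (map (fst \<circ> z) [0..<hitting_index z V]) (fst (z (hitting_index z V))) *
      (\<Prod>i<hitting_index z V. g (fst (z i)) (snd (z i))) \<partial>chain_law C \<kappa> x) =
    (\<integral>\<^sup>+z. (\<Sum>n. k n (?P n z) (snd \<circ> z)) \<partial>chain_law C \<kappa> x)"
  proof (rule nn_integral_cong_AE)
    show "AE z in chain_law C \<kappa> x. Q (map (fst \<circ> z) [0..<hitting_index z V]) (fst (z (hitting_index z V))) *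
      (\<Prod>i<hitting_index z V. g (fst (z i)) (snd (z i))) = (\<Sum>n. k n (?P n z) (snd \<circ> z))"
      using AE_chain_killed[of x]
    proof eventually_elim
      case (elim z)
      let ?h = "hitting_index z V"
      from elim V have ex: "\<exists>n. fst (z n) \<in> V" by metis
      have h: "fst (z ?h) \<in> V" unfolding hitting_index_def using ex by (rule LeastI_ex)
      have before: "fst (z i) \<notin> V" if "i < ?h" for i
        using not_less_Least[OF that[unfolded hitting_index_def]] .
      \<comment> \<open>Exactly one \<open>n\<close> satisfies the condition built into
        \<open>k\<close>, so the series over \<open>n\<close> has a single nonzero term.\<close>
      have iff: "(set (map (fst \<circ> z) [0..<n]) \<subseteq> - V \<and> fst (z n) \<in> V) \<longleftrightarrow> n = ?h" for n
      proof
        assume n: "set (map (fst \<circ> z) [0..<n]) \<subseteq> - V \<and> fst (z n) \<in> V"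
        then have "\<not> n < ?h" using before by blast
        moreover have "\<not> ?h < n"
        proof
          assume "?h < n"
          then have "fst (z ?h) \<in> set (map (fst \<circ> z) [0..<n])" by auto
          then show False using n h by blast
        qed
        ultimately show "n = ?h" by simp
      qed (use h before in auto)
      have kk: "k n (?P n z) (snd \<circ> z) = of_bool (n = ?h) *
        (Q (map (fst \<circ> z) [0..<n]) (fst (z n)) * (\<Prod>i<n. g (fst (z i)) (snd (z i))))" for n
      proof -
        have "(\<Prod>i<n. g (?P n z ! i) ((snd \<circ> z) i)) = (\<Prod>i<n. g (fst (z i)) (snd (z i)))"
          by (intro prod.cong) (auto simp: nth_append)
        then show ?thesis unfolding k_def iff[symmetric] by (simp add: butlast_append)
      qed
      have "(\<Sum>n. k n (?P n z) (snd \<circ> z)) = (\<Sum>n\<in>{?h}. k n (?P n z) (snd \<circ> z))"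
        by (rule suminf_finite) (auto simp: kk simp del: upt_Suc)
      then show ?case by (simp add: kk del: upt_Suc)
    qed
  qed
  also have "\<dots> = (\<Sum>n. \<integral>\<^sup>+z. k n (?P n z) (snd \<circ> z) \<partial>chain_law C \<kappa> x)"
  proof (rule nn_integral_suminf)
    fix n
    have "(\<lambda>z. k n (?P n z) (snd \<circ> z)) \<in> borel_measurable trajectory_space"
      by (rule measurable_compose_countable'[where I = UNIV, OF _ measurable_prefix])
        (rule measurable_compose[OF measurable_holding km], simp)
    then show "(\<lambda>z. k n (?P n z) (snd \<circ> z)) \<in> borel_measurable (chain_law C \<kappa> x)"
      by (simp add: measurable_cong_sets[OF sets_chain_law refl] del: upt_Suc)
  qed
  also have "\<dots> = (\<Sum>n. \<Sum>y\<in>V. \<Sum>p\<in>{p\<in>words (- V) n. p \<noteq> [] \<and> hd p = Some x}.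
     Q p y * (walk_weight jp (p @ [y]) * (\<Prod>v\<leftarrow>p. \<integral>\<^sup>+r. g v r \<partial>unit_exponential)))"
  proof (rule suminf_cong)
    fix n
    let ?W = "{p\<in>words (- V) n. p \<noteq> [] \<and> hd p = Some x}"
    let ?F = "\<lambda>q. walk_weight jp q * (\<integral>\<^sup>+\<tau>. k n q \<tau> \<partial>holding_measure)"
    have "(\<integral>\<^sup>+z. k n (?P n z) (snd \<circ> z) \<partial>chain_law C \<kappa> x) = (\<Sum>q\<in>prefixes x n. ?F q)"
      by (rule nn_integral_chain_prefix) measurable
    also have "\<dots> = (\<Sum>q\<in>(\<lambda>(y, p). p @ [y]) ` (V \<times> ?W). ?F q)"
    proof (rule sum.mono_neutral_right)
      show "(\<lambda>(y, p). p @ [y]) ` (V \<times> ?W) \<subseteq> prefixes x n"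
        by (auto simp: prefixes_def words_def)
      show "\<forall>q\<in>prefixes x n - (\<lambda>(y, p). p @ [y]) ` (V \<times> ?W). ?F q = 0"
      proof
        fix q assume q: "q \<in> prefixes x n - (\<lambda>(y, p). p @ [y]) ` (V \<times> ?W)"
        have "\<not> (set (butlast q) \<subseteq> - V \<and> last q \<in> V)"
        proof
          assume a: "set (butlast q) \<subseteq> - V \<and> last q \<in> V"
          from q have ne: "q \<noteq> []" by (auto simp: prefixes_def)
          \<comment> \<open>A list with a single entry would be \<open>[Some x]\<close>, and this
            state is not in \<open>V\<close>.\<close>
          have "butlast q \<noteq> []"
          proof
            assume "butlast q = []"
            then have "q = [last q]" using append_butlast_last_id[OF ne] by simp
            moreover have "hd q = Some x" using q by (simp add: prefixes_def)
            ultimately have "last q = Some x" by (metis list.sel(1))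
            then show False using a V by simp
          qed
          then have "(last q, butlast q) \<in> V \<times> ?W"
            using a q ne by (cases q) (auto simp: prefixes_def words_def split: if_splits)
          moreover have "q = butlast q @ [last q]" using ne by simp
          ultimately have "q \<in> (\<lambda>(y, p). p @ [y]) ` (V \<times> ?W)" by force
          then show False using q by simp
        qed
        then have "of_bool (set (butlast q) \<subseteq> - V \<and> last q \<in> V) = (0::ennreal)"
          by (simp only: of_bool_eq)
        then show "?F q = 0" unfolding k_def by (simp only:) simp
      qed
    qed simp
    also have "\<dots> = (\<Sum>a\<in>V \<times> ?W. ?F (snd a @ [fst a]))"
      by (subst sum.reindex) (auto simp: inj_on_def case_prod_beta)
    also have "\<dots> = (\<Sum>y\<in>V. \<Sum>p\<in>?W. ?F (p @ [y]))"
      by (subst sum.cartesian_product) (simp add: case_prod_beta)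
    also have "\<dots> = (\<Sum>y\<in>V. \<Sum>p\<in>?W. Q p y * (walk_weight jp (p @ [y]) * (\<Prod>v\<leftarrow>p. \<integral>\<^sup>+r. g v r \<partial>unit_exponential)))"
    proof (intro sum.cong refl)
      fix y p assume y: "y \<in> V" and p: "p \<in> ?W"
      then have len: "length p = n" "set p \<subseteq> - V" by (auto simp: words_def)
      have "(\<integral>\<^sup>+\<tau>. k n (p @ [y]) \<tau> \<partial>holding_measure) = (\<integral>\<^sup>+\<tau>. Q p y * (\<Prod>i<n. g (p ! i) (\<tau> i)) \<partial>holding_measure)"
        using y len by (intro nn_integral_cong) (auto simp: k_def nth_append intro!: prod.cong arg_cong2[of _ _ _ _ "(*)"])
      also have "\<dots> = Q p y * (\<Prod>i<n. \<integral>\<^sup>+r. g (p ! i) r \<partial>unit_exponential)"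
        by (subst nn_integral_cmult) (measurable, simp only: nn_integral_holding_prod[OF g])
      also have "(\<Prod>i<n. \<integral>\<^sup>+r. g (p ! i) r \<partial>unit_exponential) = (\<Prod>v\<leftarrow>p. \<integral>\<^sup>+r. g v r \<partial>unit_exponential)"
        using len(1) by (simp add: prod.list_conv_set_nth atLeast0LessThan)
      finally show "?F (p @ [y]) = Q p y * (walk_weight jp (p @ [y]) * (\<Prod>v\<leftarrow>p. \<integral>\<^sup>+r. g v r \<partial>unit_exponential))"
        by (simp add: mult_ac)
    qed
    finally show "(\<integral>\<^sup>+z. k n (?P n z) (snd \<circ> z) \<partial>chain_law C \<kappa> x) =
      (\<Sum>y\<in>V. \<Sum>p\<in>?W. Q p y * (walk_weight jp (p @ [y]) * (\<Prod>v\<leftarrow>p. \<integral>\<^sup>+r. g v r \<partial>unit_exponential)))" .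
  qed
  also have "\<dots> = (\<Sum>y\<in>V. \<Sum>n. \<Sum>p\<in>{p\<in>words (- V) n. p \<noteq> [] \<and> hd p = Some x}.
     Q p y * (walk_weight jp (p @ [y]) * (\<Prod>v\<leftarrow>p. \<integral>\<^sup>+r. g v r \<partial>unit_exponential)))"
    by (rule suminf_sum) simp
  also have "\<dots> = (\<Sum>y\<in>V. \<integral>\<^sup>+p. Q p y * (walk_weight jp (p @ [y]) * (\<Prod>v\<leftarrow>p. \<integral>\<^sup>+r. g v r \<partial>unit_exponential))
      \<partial>count_space {p. set p \<subseteq> - V \<and> p \<noteq> [] \<and> hd p = Some x})"
    by (intro sum.cong refl nn_integral_lists_by_length[symmetric]) simp
  finally show ?thesis .
qed

text \<open>With \<open>Q\<close> and \<open>g\<close> constant 1, the hitting formula says that the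
  chain leaves \<open>U\<close> with probability 1. By last exit, 1 is the Green function times an
  escape sum; an infinite first factor would make this product 0 or infinite.\<close>

lemma green_jp_finite:
  assumes "None \<notin> U" "v \<in> U"
  shows "green jp U v < \<top>"
proof -
  obtain x where v: "v = Some x" using assms by (cases v) auto
  interpret prob_space "chain_law C \<kappa> x" by (rule prob_space_chain_law)
  interpret e: prob_space unit_exponential by (rule prob_space_unit_exponential)
  have pl: "(\<Prod>v\<leftarrow>p. (1::ennreal)) = 1" for p :: "'a option list"
    by (induction p) auto
  have "1 = (\<Sum>y\<in>- U. \<integral>\<^sup>+p. 1 * (walk_weight jp (p @ [y]) * (\<Prod>v\<leftarrow>p. \<integral>\<^sup>+r. 1 \<partial>unit_exponential))
      \<partial>count_space {p. set p \<subseteq> - (- U) \<and> p \<noteq> [] \<and> hd p = Some x})"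
    using nn_integral_chain_hitting[of "- U" x "\<lambda>_ _. 1" "\<lambda>_ _. 1"] assms v emeasure_space_1
    by simp
  also have "\<dots> = (\<Sum>y\<in>- U. \<integral>\<^sup>+p. walk_weight jp (p @ [y]) \<partial>count_space {p. p \<noteq> [] \<and> hd p = v \<and> set p \<subseteq> U})"
    using e.emeasure_space_1 by (simp add: v conj_ac pl)
  also have "\<dots> = green jp U v * (\<Sum>y\<in>- U. \<integral>\<^sup>+q. walk_weight jp (v # q @ [y]) \<partial>count_space {q. set q \<subseteq> U - {v}})"
    unfolding green_times_escape[OF assms(2)] by (rule sum_distrib_left[symmetric])
  finally have *: "1 = green jp U v * (\<Sum>y\<in>- U. \<integral>\<^sup>+q. walk_weight jp (v # q @ [y]) \<partial>count_space {q. set q \<subseteq> U - {v}})" .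
  show ?thesis
  proof (rule ccontr)
    assume "\<not> green jp U v < \<top>"
    then have "green jp U v = \<top>" by (metis less_top)
    with * show False by (auto simp: ennreal_top_mult split: if_splits)
  qed
qed

end

section \<open>Measurability of the networks\<close>

lemma measurable_path_spaceI:
  assumes "\<And>i. i < n \<Longrightarrow> (\<lambda>\<omega>. f \<omega> ! i) \<in> measurable M (count_space UNIV \<Otimes>\<^sub>M borel)"
    and "\<And>\<omega>. length (f \<omega>) = n"
  shows "f \<in> measurable M path_space"
proof -
  have g: "(\<lambda>\<omega>. if i < n then f \<omega> ! i else (None, 0)) \<in> measurable M (count_space UNIV \<Otimes>\<^sub>M borel)" for i
    using assms(1)[of i] by (cases "i < n") (auto simp: space_pair_measure)
  have "(\<lambda>\<omega> i. if i < n then f \<omega> ! i else (None, 0)) \<in> measurable M (\<Pi>\<^sub>M i\<in>UNIV. count_space UNIV \<Otimes>\<^sub>M borel)"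
    by (rule measurable_PiM_single') (use g in \<open>auto simp: space_pair_measure\<close>)
  then have "(\<lambda>\<omega>. (n, \<lambda>i. if i < n then f \<omega> ! i else (None, 0)))
      \<in> measurable M (count_space UNIV \<Otimes>\<^sub>M (\<Pi>\<^sub>M i\<in>UNIV. count_space UNIV \<Otimes>\<^sub>M borel))"
    by (intro measurable_Pair) simp_all
  then show ?thesis unfolding path_space_def
    by (intro measurable_vimage_algebra2) (simp_all add: assms(2))
qed

lemma measurable_path_space_decode:
  shows measurable_length_path: "(length :: 'a path \<Rightarrow> nat) \<in> measurable path_space (count_space UNIV)"
    and measurable_nth_path: "(\<lambda>l :: 'a path. if i < length l then l ! i else (None, 0)) \<in> measurable path_space (count_space UNIV \<Otimes>\<^sub>M borel)"
proof -
  let ?g = "\<lambda>l :: 'a path. (length l, \<lambda>i. if i < length l then l ! i else (None, 0))"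
  let ?P = "\<Pi>\<^sub>M i\<in>(UNIV :: nat set). count_space (UNIV :: 'a option set) \<Otimes>\<^sub>M (borel :: real measure)"
  have g: "?g \<in> measurable path_space (count_space UNIV \<Otimes>\<^sub>M ?P)"
    unfolding path_space_def by (rule measurable_vimage_algebra1) (auto simp: space_pair_measure space_PiM)
  from measurable_compose[OF this measurable_fst]
  show "(length :: 'a path \<Rightarrow> nat) \<in> measurable path_space (count_space UNIV)" by simp
  from measurable_compose[OF measurable_compose[OF g measurable_snd] measurable_component_singleton[of i UNIV]]
  show "(\<lambda>l :: 'a path. if i < length l then l ! i else (None, 0)) \<in> measurable path_space (count_space UNIV \<Otimes>\<^sub>M borel)"
    by simp
qed

text \<open>A path is recovered from its length and from its entries padded to an infinite sequence,
  so measurability may be checked for each length separately.\<close>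

lemma measurable_from_path_space:
  assumes "\<And>n. (\<lambda>q. F (map q [0..<n])) \<in> measurable (\<Pi>\<^sub>M i\<in>UNIV. count_space UNIV \<Otimes>\<^sub>M borel) N"
  shows "F \<in> measurable path_space N"
proof -
  let ?s = "\<lambda>l i. if i < length l then l ! i else (None, 0) :: 'a option \<times> real"
  have s: "?s \<in> measurable path_space (\<Pi>\<^sub>M i\<in>UNIV. count_space UNIV \<Otimes>\<^sub>M borel)"
    by (rule measurable_PiM_single') (use measurable_nth_path in \<open>auto simp: space_pair_measure\<close>)
  have "(\<lambda>l. F (map (?s l) [0..<length l])) \<in> measurable path_space N"
    by (rule measurable_compose_countable[OF _ measurable_length_path])
      (rule measurable_compose[OF s assms])
  moreover have "map (?s l) [0..<length l] = l" for l
    by (rule nth_equalityI) auto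
  ultimately show ?thesis by simp
qed

text \<open>The recursion shifts the time by a holding time, so the induction has to carry both the
  entries and the time as measurable functions.\<close>

lemma measurable_path_at:
  assumes "\<And>f. f \<in> set fs \<Longrightarrow> f \<in> measurable M (count_space UNIV \<Otimes>\<^sub>M borel)" and "s \<in> borel_measurable M"
  shows "(\<lambda>\<omega>. path_at (map (\<lambda>f. f \<omega>) fs) (s \<omega>)) \<in> measurable M (count_space UNIV)"
  using assms
proof (induction fs arbitrary: s)
  case (Cons f fs)
  note [measurable] = Cons.prems(2)
  have [measurable]: "f \<in> measurable M (count_space UNIV \<Otimes>\<^sub>M borel)" using Cons.prems by simp
  have "(\<lambda>\<omega>. s \<omega> - snd (f \<omega>)) \<in> borel_measurable M" by measurable
  from Cons.IH[OF _ this] Cons.prems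
  have [measurable]: "(\<lambda>\<omega>. path_at (map (\<lambda>f. f \<omega>) fs) (s \<omega> - snd (f \<omega>))) \<in> measurable M (count_space UNIV)" by simp
  have "(\<lambda>\<omega>. if s \<omega> < snd (f \<omega>) \<or> fs = [] then fst (f \<omega>) else path_at (map (\<lambda>f. f \<omega>) fs) (s \<omega> - snd (f \<omega>)))
    \<in> measurable M (count_space UNIV)" by measurable
  also have "(\<lambda>\<omega>. if s \<omega> < snd (f \<omega>) \<or> fs = [] then fst (f \<omega>) else path_at (map (\<lambda>f. f \<omega>) fs) (s \<omega> - snd (f \<omega>))) =
    (\<lambda>\<omega>. path_at (map (\<lambda>f. f \<omega>) (f # fs)) (s \<omega>))"
  proof
    fix \<omega>
    obtain v r where "f \<omega> = (v, r)" by force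
    then show "(if s \<omega> < snd (f \<omega>) \<or> fs = [] then fst (f \<omega>) else path_at (map (\<lambda>f. f \<omega>) fs) (s \<omega> - snd (f \<omega>))) =
      path_at (map (\<lambda>f. f \<omega>) (f # fs)) (s \<omega>)" by simp
  qed
  finally show ?case .
qed simp

lemma measurable_local_time:
  "(\<lambda>l. local_time C \<kappa> l x) \<in> borel_measurable path_space"
proof (rule measurable_from_path_space)
  fix n
  let ?P = "\<Pi>\<^sub>M i\<in>(UNIV :: nat set). count_space (UNIV :: 'a option set) \<Otimes>\<^sub>M (borel :: real measure)"
  have c: "(\<lambda>p. fst p i) \<in> measurable (?P \<Otimes>\<^sub>M lborel) (count_space UNIV \<Otimes>\<^sub>M borel)" for i
    using measurable_compose[OF measurable_fst measurable_component_singleton[of i UNIV]] by simp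
  have "(\<lambda>p. path_at (map (\<lambda>f. f p) (map (\<lambda>i p. fst p i) [0..<n])) (snd p)) \<in> measurable (?P \<Otimes>\<^sub>M lborel) (count_space UNIV)"
    by (rule measurable_path_at) (use c in auto)
  then have p[measurable]: "(\<lambda>p. path_at (map (fst p) [0..<n]) (snd p)) \<in> measurable (?P \<Otimes>\<^sub>M lborel) (count_space UNIV)"
    by (simp add: o_def)
  have d[measurable]: "(\<lambda>p. duration (map (fst p) [0..<n])) \<in> borel_measurable (?P \<Otimes>\<^sub>M lborel)"
  proof -
    have "(\<lambda>p. \<Sum>i<n. snd (fst p i)) \<in> borel_measurable (?P \<Otimes>\<^sub>M lborel)"
      using measurable_compose[OF c measurable_snd] by (intro borel_measurable_sum) auto
    then show ?thesis
      by (simp add: duration_def sum_list_sum_nth atLeast0LessThan)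
  qed
  have "(\<lambda>p. indicator {s \<in> {0..duration (map (fst p) [0..<n])}. path_at (map (fst p) [0..<n]) s = Some x} (snd p) :: ennreal) =
    (\<lambda>p. of_bool (0 \<le> snd p \<and> snd p \<le> duration (map (fst p) [0..<n]) \<and> path_at (map (fst p) [0..<n]) (snd p) = Some x))"
    by (auto simp: indicator_def fun_eq_iff)
  also have "\<dots> \<in> borel_measurable (?P \<Otimes>\<^sub>M lborel)"
    unfolding of_bool_def by measurable
  finally have *: "(\<lambda>p. indicator {s \<in> {0..duration (map (fst p) [0..<n])}. path_at (map (fst p) [0..<n]) s = Some x} (snd p))
    \<in> (borel_measurable (?P \<Otimes>\<^sub>M lborel) :: (_ \<Rightarrow> ennreal) set)" .
  have "(\<lambda>q. \<integral>\<^sup>+s. indicator {s \<in> {0..duration (map q [0..<n])}. path_at (map q [0..<n]) s = Some x} s \<partial>lborel)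
    \<in> borel_measurable ?P"
    using lborel.borel_measurable_nn_integral[of "\<lambda>q s. indicator {s \<in> {0..duration (map q [0..<n])}. path_at (map q [0..<n]) s = Some x} s" ?P] *
    by (simp add: case_prod_beta')
  then show "(\<lambda>q. local_time C \<kappa> (map q [0..<n]) x) \<in> borel_measurable ?P"
    unfolding local_time_def by measurable
qed

lemma measurable_traversals:
  "(\<lambda>l. of_nat (traversals (l :: 'a::finite path) x y) :: ennreal) \<in> borel_measurable path_space"
proof (rule measurable_from_path_space)
  fix n
  let ?P = "\<Pi>\<^sub>M i\<in>(UNIV :: nat set). count_space (UNIV :: 'a option set) \<Otimes>\<^sub>M (borel :: real measure)"
  let ?t = "\<lambda>vs. of_nat (card {i. i < length vs \<and> vs ! i = Some x \<and> vs ! (Suc i mod length vs) = Some y}) :: ennreal"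
  have "(\<lambda>q. ?t (map (fst \<circ> q) [0..<n])) \<in> borel_measurable ?P"
    by (rule measurable_compose[OF measurable_prefix[of n, unfolded trajectory_space_def]])
      (simp only: measurable_count_space_eq1 space_borel Pi_UNIV UNIV_I)
  moreover have "?t (map (fst \<circ> q) [0..<n]) = of_nat (traversals (map q [0..<n]) x y)" for q
    unfolding traversals_def by (intro arg_cong[of _ _ of_nat] arg_cong[of _ _ card] Collect_cong) auto
  ultimately show "(\<lambda>q. of_nat (traversals (map q [0..<n]) x y) :: ennreal) \<in> borel_measurable ?P" by (simp only:)
qed

section \<open>Wilson's algorithm as a recursion over the ordering\<close>

definition first_path :: "'a trajectory \<Rightarrow> ('a option \<times> 'a option) set \<Rightarrow> 'a path" where
  "first_path y T = map y [0..<hitting_index y (tree_vertices T)]"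

definition branch :: "'a option list \<Rightarrow> 'a option \<Rightarrow> ('a option \<times> 'a option) set" where
  "branch \<gamma> w = set (zip \<gamma> (tl \<gamma> @ [w]))"

definition step_tree :: "'a trajectory \<Rightarrow> ('a option \<times> 'a option) set \<Rightarrow> ('a option \<times> 'a option) set" where
  "step_tree y T = T \<union> branch (erased_path (map fst (first_path y T))) (fst (y (hitting_index y (tree_vertices T))))"

definition step_loops :: "'a trajectory \<Rightarrow> ('a option \<times> 'a option) set \<Rightarrow> 'a path list" where
  "step_loops y T = snd (loop_erasure (first_path y T))"

text \<open>Starting from an arbitrary tree, with no loop collected yet, makes induction over the
  remaining ordering possible; loops erased earlier are merely put in front.\<close>

definition wilson_from :: "('a \<Rightarrow> 'a trajectory) \<Rightarrow> 'a list \<Rightarrow> ('a option \<times> 'a option) set \<Rightarrow>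
    ('a option \<times> 'a option) set \<times> 'a path list" where
  "wilson_from z xs T = fold (wilson_step z) xs (T, [])"

lemma wilson_step_eq:
  "wilson_step z x (T, L) =
    (if Some x \<in> tree_vertices T then (T, L) else (step_tree (z x) T, L @ step_loops (z x) T))"
proof -
  let ?h = "hitting_index (z x) (tree_vertices T)"
  obtain \<gamma> L' where e: "loop_erasure (map (z x) [0..<?h]) = (\<gamma>, L')" by force
  then have "erased_path (map fst (map (z x) [0..<?h])) = \<gamma>"
    using fst_loop_erasure[of "map (z x) [0..<?h]"] by simp
  then show ?thesis
    by (simp add: wilson_step_def step_tree_def step_loops_def first_path_def branch_def Let_def e)
qed

lemma fold_wilson_step:
  "fold (wilson_step z) xs (T, L) = (fst (wilson_from z xs T), L @ snd (wilson_from z xs T))"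
proof (induction xs arbitrary: T L)
  case (Cons x xs)
  show ?case
    by (simp add: wilson_from_def wilson_step_eq) (simp add: Cons.IH)
qed (simp add: wilson_from_def)

lemma wilson_from_Nil [simp]: "wilson_from z [] T = (T, [])"
  by (simp add: wilson_from_def)

lemma wilson_from_Cons:
  "wilson_from z (x # xs) T =
    (if Some x \<in> tree_vertices T then wilson_from z xs T
     else (fst (wilson_from z xs (step_tree (z x) T)),
           step_loops (z x) T @ snd (wilson_from z xs (step_tree (z x) T))))"
  by (simp add: wilson_from_def wilson_step_eq) (simp add: fold_wilson_step)

lemma wilson_from_cong:
  "(\<And>x. x \<in> set xs \<Longrightarrow> z x = z' x) \<Longrightarrow> wilson_from z xs T = wilson_from z' xs T"
  by (induction xs arbitrary: T) (simp_all add: wilson_from_Cons)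

lemma measurable_hitting_index:
  "(\<lambda>y. hitting_index y V) \<in> measurable trajectory_space (count_space UNIV)"
proof -
  have [measurable]: "Measurable.pred trajectory_space (\<lambda>y. fst (y n) \<in> V)" for n
    using measurable_compose[OF measurable_state, of "\<lambda>v. v \<in> V"] by simp
  show ?thesis unfolding hitting_index_def by measurable
qed

lemma measurable_step_tree:
  "(\<lambda>y. step_tree y T) \<in> measurable trajectory_space (count_space (UNIV :: ('a::finite option \<times> 'a option) set set))"
proof -
  have "(\<lambda>y. T \<union> branch (erased_path (map (fst \<circ> y) [0..<n])) (fst (y n))) \<in> measurable trajectory_space (count_space UNIV)" for n
    by (rule measurable_compose_countable'[where I = UNIV, OF _ measurable_prefix[of n]])
      (auto intro: measurable_compose_countable'[where I = UNIV, OF _ measurable_state])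
  from measurable_compose_countable[OF this measurable_hitting_index[of "tree_vertices T"]]
  show ?thesis by (simp add: step_tree_def first_path_def)
qed

lemma measurable_step_loops:
  fixes \<phi> :: "'a::finite path \<Rightarrow> ennreal"
  assumes \<phi>: "\<phi> \<in> borel_measurable path_space"
  shows "(\<lambda>y. \<Sum>l\<leftarrow>step_loops y T. \<phi> l) \<in> borel_measurable trajectory_space"
proof -
  have "(\<lambda>y. \<Sum>l\<leftarrow>snd (loop_erasure (map y [0..<n])). \<phi> l) \<in> borel_measurable trajectory_space" for n
  proof -
    \<comment> \<open>the holding times are replaced by the indices of the steps, from which they are recovered\<close>
    let ?f = "\<lambda>(y :: 'a trajectory) r. snd (y (nat \<lfloor>r\<rfloor>))"
    let ?L = "\<lambda>s. snd (loop_erasure (map (\<lambda>i. (s ! i, real i)) [0..<n]))"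
    have 1: "snd (loop_erasure (map y [0..<n])) =
      map (map (map_prod id (?f y))) (?L (map (fst \<circ> y) [0..<n]))" for y
    proof -
      have "map y [0..<n] = map (map_prod id (?f y)) (map (\<lambda>i. (map (fst \<circ> y) [0..<n] ! i, real i)) [0..<n])"
        by (rule nth_equalityI) auto
      then show ?thesis by (simp only: loop_erasure_map snd_conv)
    qed
    have 2: "(\<lambda>y. map (map_prod id (?f y)) l) \<in> measurable trajectory_space path_space" for l
    proof (rule measurable_path_spaceI[of "length l"])
      fix i assume "i < length l"
      have "(\<lambda>y. (fst (l ! i), ?f y (snd (l ! i)))) \<in> measurable trajectory_space (count_space UNIV \<Otimes>\<^sub>M borel)"
        by measurable
      then show "(\<lambda>y. map (map_prod id (?f y)) l ! i) \<in> measurable trajectory_space (count_space UNIV \<Otimes>\<^sub>M borel)"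
        using \<open>i < length l\<close> by (simp add: map_prod_def case_prod_beta)
    qed simp
    have 3: "(\<lambda>y. \<Sum>l\<leftarrow>ls. \<phi> (map (map_prod id (?f y)) l)) \<in> borel_measurable trajectory_space" for ls
    proof (induction ls)
      case (Cons l ls)
      then show ?case unfolding list.map sum_list.Cons
        by (intro borel_measurable_add measurable_compose[OF 2 \<phi>])
    qed simp
    have "(\<lambda>y. \<Sum>l\<leftarrow>?L (map (fst \<circ> y) [0..<n]). \<phi> (map (map_prod id (?f y)) l)) \<in> borel_measurable trajectory_space"
      by (rule measurable_compose_countable'[where I = UNIV, OF _ measurable_prefix[of n]]) (rule 3, simp)
    moreover have "(\<Sum>l\<leftarrow>snd (loop_erasure (map y [0..<n])). \<phi> l) =
      (\<Sum>l\<leftarrow>?L (map (fst \<circ> y) [0..<n]). \<phi> (map (map_prod id (?f y)) l))" for y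
      by (subst 1) (simp only: list.map_comp o_def)
    ultimately show ?thesis by (simp only:)
  qed
  from measurable_compose_countable[OF this measurable_hitting_index[of "tree_vertices T"]]
  show ?thesis by (simp add: step_loops_def first_path_def)
qed

lemma measurable_wilson_from:
  fixes \<phi> :: "'a::finite path \<Rightarrow> ennreal"
  assumes \<phi>: "\<phi> \<in> borel_measurable path_space" and "set xs \<subseteq> I"
  shows "(\<lambda>z. fst (wilson_from z xs T)) \<in> measurable (\<Pi>\<^sub>M x\<in>I. trajectory_space) (count_space UNIV)"
    and "(\<lambda>z. \<Sum>l\<leftarrow>snd (wilson_from z xs T). \<phi> l) \<in> borel_measurable (\<Pi>\<^sub>M x\<in>I. trajectory_space)"
proof -
  let ?P = "\<Pi>\<^sub>M x\<in>I. (trajectory_space :: 'a trajectory measure)"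
  have "(\<lambda>z. fst (wilson_from z xs T)) \<in> measurable ?P (count_space UNIV) \<and>
    (\<lambda>z. \<Sum>l\<leftarrow>snd (wilson_from z xs T). \<phi> l) \<in> borel_measurable ?P"
    using assms(2)
  proof (induction xs arbitrary: T)
    case (Cons x xs)
    show ?case
    proof (cases "Some x \<in> tree_vertices T")
      case True
      then show ?thesis using Cons by (simp add: wilson_from_Cons)
    next
      case False
      have x: "(\<lambda>z. z x) \<in> measurable ?P trajectory_space" using Cons.prems by (intro measurable_component_singleton) auto
      have t: "(\<lambda>z. step_tree (z x) T) \<in> measurable ?P (count_space UNIV)"
        by (rule measurable_compose[OF x measurable_step_tree])
      have "(\<lambda>z. fst (wilson_from z xs (step_tree (z x) T))) \<in> measurable ?P (count_space UNIV)"
        by (rule measurable_compose_countable'[where I = UNIV, OF _ t]) (use Cons in auto)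
      moreover have "(\<lambda>z. \<Sum>l\<leftarrow>snd (wilson_from z xs (step_tree (z x) T)). \<phi> l) \<in> borel_measurable ?P"
        by (rule measurable_compose_countable'[where I = UNIV, OF _ t]) (use Cons in auto)
      moreover have "(\<lambda>z. \<Sum>l\<leftarrow>step_loops (z x) T. \<phi> l) \<in> borel_measurable ?P"
        by (rule measurable_compose[OF x measurable_step_loops[OF \<phi>]])
      ultimately show ?thesis using False by (simp add: wilson_from_Cons)
    qed
  qed simp
  then show "(\<lambda>z. fst (wilson_from z xs T)) \<in> measurable ?P (count_space UNIV)"
    "(\<lambda>z. \<Sum>l\<leftarrow>snd (wilson_from z xs T). \<phi> l) \<in> borel_measurable ?P" by auto
qed

lemma wilson_network_eq:
  "wilson_network C \<kappa> z xs =
    (\<lambda>x. \<Sum>l\<leftarrow>snd (wilson_from z xs {}). local_time C \<kappa> l x,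
     \<lambda>(x, y)\<in>edge_pairs C. \<Sum>l\<leftarrow>snd (wilson_from z xs {}). of_nat (traversals l x y))"
  unfolding wilson_network_def network_def wilson_loops_def wilson_def wilson_from_def
  by (auto simp: fun_eq_iff restrict_def nn_integral_count_space_finite sum_list_sum_nth atLeast0LessThan)

lemma wilson_tree_eq: "wilson_tree z xs = fst (wilson_from z xs {})"
  by (simp add: wilson_tree_def wilson_def wilson_from_def)

lemma measurable_network_spaceI:
  fixes C :: "'a::finite \<Rightarrow> 'a \<Rightarrow> real"
  assumes "\<And>x. (\<lambda>\<omega>. f \<omega> x) \<in> borel_measurable M"
    and "\<And>x y. (x, y) \<in> edge_pairs C \<Longrightarrow> (\<lambda>\<omega>. g \<omega> x y) \<in> borel_measurable M"
  shows "(\<lambda>\<omega>. (f \<omega>, \<lambda>(x, y)\<in>edge_pairs C. g \<omega> x y)) \<in> measurable M (network_space C)"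
  unfolding network_space_def
proof (intro measurable_Pair)
  show "f \<in> measurable M (\<Pi>\<^sub>M x\<in>UNIV. borel)"
    by (rule measurable_PiM_single') (use assms(1) in auto)
  show "(\<lambda>\<omega>. \<lambda>(x, y)\<in>edge_pairs C. g \<omega> x y) \<in> measurable M (\<Pi>\<^sub>M e\<in>edge_pairs C. borel)"
    by (rule measurable_restrict) (use assms(2) in auto)
qed

lemma measurable_wilson_network:
  assumes "set xs \<subseteq> I"
  shows "(\<lambda>z. wilson_network C \<kappa> z xs) \<in> measurable (\<Pi>\<^sub>M x\<in>I. trajectory_space) (network_space C)"
  unfolding wilson_network_eq
  by (intro measurable_network_spaceI measurable_wilson_from(2)[OF measurable_local_time assms]
      measurable_wilson_from(2)[OF measurable_traversals assms])

section \<open>Laplace transforms\<close>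

text \<open>exp (- y) on [0, infinity], with value 0 at infinity: a network may have infinite
  entries, and the transform has to tell them from finite ones.\<close>

definition expm :: "ennreal \<Rightarrow> real" where
  "expm y = (if y = \<top> then 0 else exp (- enn2real y))"

lemma expm_0 [simp]: "expm 0 = 1"
  by (simp add: expm_def)

lemma expm_top [simp]: "expm \<top> = 0"
  by (simp add: expm_def)

lemma expm_ennreal: "r \<ge> 0 \<Longrightarrow> expm (ennreal r) = exp (- r)"
  by (simp add: expm_def)

lemma expm_nonneg [simp]: "0 \<le> expm y"
  by (simp add: expm_def)

lemma expm_le_1: "expm y \<le> 1"
  by (simp add: expm_def)

lemma expm_add: "expm (a + b) = expm a * expm b"
  by (cases a; cases b)
    (auto simp: expm_def ennreal_plus[symmetric] exp_add[symmetric] simp del: ennreal_plus)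

lemma expm_sum_list: "expm (\<Sum>l\<leftarrow>ls. f l) = (\<Prod>l\<leftarrow>ls. expm (f l))"
  by (induction ls) (auto simp: expm_add)

lemma measurable_expm [measurable]: "expm \<in> borel_measurable borel"
  unfolding expm_def by measurable

lemma walk_weight_mult:
  "walk_weight (\<lambda>u v. f u v * g u v) p = walk_weight f p * walk_weight g p"
  by (induction f p rule: walk_weight.induct) (auto simp: mult_ac)

text \<open>A weight attached to the source of each step is collected once for every entry except
  the end point \<open>y\<close>, where the trajectory is stopped.\<close>

lemma walk_weight_source: "walk_weight (\<lambda>u v. f u) (p @ [y]) = (\<Prod>v\<leftarrow>p. f v)"
proof (induction p)
  case (Cons u p)
  then show ?case by (cases p) auto
qed simp

section \<open>The law of the network and the tree in Wilson's algorithm\<close>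

text \<open>The jumps of a trajectory are those of its erased loops together with those of its loop
  erasure. This makes the natural subtraction in \<open>jump_factor\<close> exact.\<close>

lemma path_jumps_erased_path_le:
  assumes "x \<noteq> y"
  shows "path_jumps (erased_path p @ [w]) x y \<le> path_jumps (p @ [w]) x y"
proof -
  obtain \<gamma> L where e: "loop_erasure (map (\<lambda>v. (v, 0)) p) = (\<gamma>, L)" by force
  have "\<gamma> = erased_path p" using fst_loop_erasure[of "map (\<lambda>v. (v, 0)) p"] e by (simp add: o_def)
  then show ?thesis using loop_erasure_traversals[OF e assms, of w] by (simp add: o_def)
qed

lemma tree_vertices_branch:
  assumes "w \<in> tree_vertices T" "\<gamma> \<noteq> []"
  shows "tree_vertices (T \<union> branch \<gamma> w) = tree_vertices T \<union> set \<gamma>"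
proof -
  have l: "length \<gamma> = length (tl \<gamma> @ [w])" using assms(2) by simp
  have "Field (branch \<gamma> w) = set (map fst (zip \<gamma> (tl \<gamma> @ [w]))) \<union> set (map snd (zip \<gamma> (tl \<gamma> @ [w])))"
    by (auto simp: branch_def Field_def Domain_fst Range_snd)
  also have "\<dots> = set \<gamma> \<union> set (tl \<gamma> @ [w])"
    by (simp only: map_fst_zip[OF l] map_snd_zip[OF l])
  also have "\<dots> = insert w (set \<gamma>)" using assms(2) by (cases \<gamma>) auto
  finally show ?thesis using assms(1) by (auto simp: tree_vertices_def Field_Un)
qed

context killed_chain
begin

text \<open>The exponent that a single loop contributes to the Laplace transform of the network.
  Natural coefficients suffice, as they yield all moments of the encoded network.\<close>

definition test_fun :: "('a \<Rightarrow> nat) \<Rightarrow> ('a \<times> 'a \<Rightarrow> nat) \<Rightarrow> 'a path \<Rightarrow> ennreal" where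
  "test_fun k m l = (\<Sum>x\<in>UNIV. of_nat (k x) * local_time C \<kappa> l x) +
     (\<Sum>e\<in>edge_pairs C. of_nat (m e) * of_nat (traversals l (fst e) (snd e)))"

lemma measurable_test_fun [measurable]: "test_fun k m \<in> borel_measurable path_space"
proof -
  note [measurable] = measurable_local_time measurable_traversals
  show ?thesis unfolding test_fun_def by measurable
qed

text \<open>Discount per unit of holding time; the denominator is the one by which a local time
  divides the holding times.\<close>

definition rate :: "('a \<Rightarrow> nat) \<Rightarrow> 'a option \<Rightarrow> real" where
  "rate k v = (case v of None \<Rightarrow> 0 | Some x \<Rightarrow> real (k x) / wt x)"

lemma rate_nonneg: "0 \<le> rate k v"
  using w_pos by (auto simp: rate_def split: option.split intro!: divide_nonneg_pos)

text \<open>The expected discount of one visit: the Laplace transform of a unit exponential variable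
  at \<open>rate k v\<close>.\<close>

definition damping :: "('a \<Rightarrow> nat) \<Rightarrow> 'a option \<Rightarrow> ennreal" where
  "damping k v = ennreal (1 / (1 + rate k v))"

definition marking :: "('a \<times> 'a \<Rightarrow> nat) \<Rightarrow> 'a option \<Rightarrow> 'a option \<Rightarrow> ennreal" where
  "marking m u v = ennreal (exp (- (\<Sum>e\<in>edge_pairs C. real (m e) * of_bool (u = Some (fst e) \<and> v = Some (snd e)))))"

definition tilted :: "('a \<Rightarrow> nat) \<Rightarrow> ('a \<times> 'a \<Rightarrow> nat) \<Rightarrow> 'a option \<Rightarrow> 'a option \<Rightarrow> ennreal" where
  "tilted k m u v = jp u v * damping k u * marking m u v"

lemma damping_le_1: "damping k v \<le> 1"
  using rate_nonneg[of k v] by (simp add: damping_def ennreal_le_1 divide_le_eq)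

lemma marking_le_1: "marking m u v \<le> 1"
  by (simp add: marking_def ennreal_le_1 sum_nonneg)

lemma tilted_le: "tilted k m u v \<le> jp u v"
proof -
  have "jp u v * damping k u * marking m u v \<le> jp u v * 1 * 1"
    by (intro mult_mono damping_le_1 marking_le_1) auto
  then show ?thesis by (simp add: tilted_def)
qed

lemma walk_weight_marking:
  "walk_weight (marking m) q = ennreal (exp (- (\<Sum>e\<in>edge_pairs C. real (m e) * real (path_jumps q (fst e) (snd e)))))"
proof (induction "marking m" q rule: walk_weight.induct)
  case (1 u v vs)
  have "(\<Sum>e\<in>edge_pairs C. real (m e) * real (path_jumps (u # v # vs) (fst e) (snd e))) =
    (\<Sum>e\<in>edge_pairs C. real (m e) * of_bool (u = Some (fst e) \<and> v = Some (snd e))) +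
    (\<Sum>e\<in>edge_pairs C. real (m e) * real (path_jumps (v # vs) (fst e) (snd e)))"
    by (simp only: path_jumps.simps of_nat_add of_nat_of_bool distrib_left sum.distrib)
  then show ?case
    by (simp only: walk_weight.simps 1 marking_def minus_add_distrib exp_add ennreal_mult exp_ge_zero)
qed auto

lemma green_tilted_finite: "None \<notin> U \<Longrightarrow> v \<in> U \<Longrightarrow> green (tilted k m) U v < \<top>"
  using green_mono[of "tilted k m" jp U v, OF tilted_le] green_jp_finite[of U v] by auto

lemma loop_mass_tilted_finite: "None \<notin> U \<Longrightarrow> loop_mass (tilted k m) U < \<top>"
  by (rule loop_mass_finite) (auto intro: green_tilted_finite)

text \<open>The diagonal vanishes. A loop reduced to a point counts one cyclic jump from its vertex
  to itself, and such a pair is thus never an edge of the network.\<close>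

lemma edge_pairs_neq: "e \<in> edge_pairs C \<Longrightarrow> fst e \<noteq> snd e"
  using C_diag by (auto simp: edge_pairs_def)

text \<open>Discount for the jumps of the erased loops alone. The end point \<open>w\<close> is
  appended to both lists, so that the last step, which belongs to the branch, cancels.\<close>

definition jump_factor :: "('a \<times> 'a \<Rightarrow> nat) \<Rightarrow> 'a option list \<Rightarrow> 'a option \<Rightarrow> ennreal" where
  "jump_factor m p w = ennreal (exp (- (\<Sum>e\<in>edge_pairs C. real (m e) *
     real (path_jumps (p @ [w]) (fst e) (snd e) - path_jumps (erased_path p @ [w]) (fst e) (snd e)))))"

lemma jump_factor_marking:
  "jump_factor m p w * walk_weight (marking m) (erased_path p @ [w]) = walk_weight (marking m) (p @ [w])"
proof -
  let ?j = "\<lambda>q e. real (path_jumps (q @ [w]) (fst e) (snd e))"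
  have "(\<Sum>e\<in>edge_pairs C. real (m e) * real (path_jumps (p @ [w]) (fst e) (snd e) - path_jumps (erased_path p @ [w]) (fst e) (snd e))) +
     (\<Sum>e\<in>edge_pairs C. real (m e) * ?j (erased_path p) e) = (\<Sum>e\<in>edge_pairs C. real (m e) * ?j p e)"
    unfolding sum.distrib[symmetric]
  proof (rule sum.cong[OF refl])
    fix e assume "e \<in> edge_pairs C"
    from path_jumps_erased_path_le[OF edge_pairs_neq[OF this], of p w]
    show "real (m e) * real (path_jumps (p @ [w]) (fst e) (snd e) - path_jumps (erased_path p @ [w]) (fst e) (snd e)) +
      real (m e) * ?j (erased_path p) e = real (m e) * ?j p e"
      by (simp add: of_nat_diff algebra_simps)
  qed
  then show ?thesis unfolding jump_factor_def walk_weight_marking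
    by (simp add: ennreal_mult[symmetric] exp_add[symmetric])
qed

lemma local_time_part:
  assumes "\<And>q. q \<in> set p \<Longrightarrow> snd q \<ge> 0"
  shows "(\<Sum>x\<in>UNIV. of_nat (k x) * local_time C \<kappa> p x) = (\<Sum>q\<leftarrow>p. ennreal (rate k (fst q) * snd q))"
proof -
  have "(\<Sum>x\<in>UNIV. of_nat (k x) * local_time C \<kappa> p x) =
    (\<Sum>x\<in>UNIV. of_nat (k x) * (ennreal (1 / wt x) * (\<Sum>q\<leftarrow>p. if fst q = Some x then ennreal (snd q) else 0)))"
    using assms by (simp add: local_time_conv)
  also have "\<dots> = (\<Sum>q\<leftarrow>p. \<Sum>x\<in>UNIV. of_nat (k x) * (ennreal (1 / wt x) * (if fst q = Some x then ennreal (snd q) else 0)))"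
  proof (induction p)
    case (Cons q p)
    then show ?case by (simp add: distrib_left sum.distrib)
  qed simp
  also have "\<dots> = (\<Sum>q\<leftarrow>p. ennreal (rate k (fst q) * snd q))"
  proof (rule arg_cong[of _ _ sum_list], rule map_cong[OF refl])
    fix q assume "q \<in> set p"
    then have q: "snd q \<ge> 0" by (rule assms)
    show "(\<Sum>x\<in>UNIV. of_nat (k x) * (ennreal (1 / wt x) * (if fst q = Some x then ennreal (snd q) else 0))) =
      ennreal (rate k (fst q) * snd q)"
    proof (cases "fst q")
      case (Some x)
      then have "(\<Sum>x\<in>UNIV. of_nat (k x) * (ennreal (1 / wt x) * (if fst q = Some x then ennreal (snd q) else 0))) =
        of_nat (k x) * (ennreal (1 / wt x) * ennreal (snd q))"
        by (subst sum.remove[of _ x]) auto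
      also have "\<dots> = ennreal (real (k x)) * ennreal (1 / wt x * snd q)"
        using q w_pos[of x] by (simp add: ennreal_mult[symmetric] ennreal_of_nat_eq_real_of_nat)
      also have "\<dots> = ennreal (rate k (fst q) * snd q)"
        using q w_pos[of x] by (subst ennreal_mult[symmetric]) (auto simp: rate_def Some)
      finally show ?thesis .
    qed (simp add: rate_def)
  qed
  finally show ?thesis .
qed

text \<open>Conservation: the erased loops carry all the holding time of the trajectory, and exactly
  those jumps that its loop erasure does not make. The individual loops therefore disappear from the
  formula.\<close>

lemma expm_test_fun_loop_erasure:
  assumes "\<And>q. q \<in> set p \<Longrightarrow> snd q \<ge> 0"
  shows "ennreal (expm (\<Sum>l\<leftarrow>snd (loop_erasure p). test_fun k m l)) =
    jump_factor m (map fst p) w * (\<Prod>q\<leftarrow>p. ennreal (exp (- (rate k (fst q) * snd q))))"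
proof -
  obtain \<gamma> L where e: "loop_erasure p = (\<gamma>, L)" by force
  have g: "\<gamma> = erased_path (map fst p)" using fst_loop_erasure[of p] e by simp
  have "(\<Sum>l\<leftarrow>L. test_fun k m l) = (\<Sum>x\<in>UNIV. of_nat (k x) * (\<Sum>l\<leftarrow>L. local_time C \<kappa> l x)) +
    (\<Sum>e\<in>edge_pairs C. of_nat (m e) * of_nat (\<Sum>l\<leftarrow>L. traversals l (fst e) (snd e)))"
    by (induction L) (auto simp: test_fun_def distrib_left sum.distrib ac_simps)
  also have "(\<Sum>x\<in>UNIV. of_nat (k x) * (\<Sum>l\<leftarrow>L. local_time C \<kappa> l x)) = (\<Sum>q\<leftarrow>p. ennreal (rate k (fst q) * snd q))"
    using loop_erasure_local_time[OF e assms] local_time_part[OF assms] by simp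
  also have "(\<Sum>e\<in>edge_pairs C. of_nat (m e) * of_nat (\<Sum>l\<leftarrow>L. traversals l (fst e) (snd e))) =
    (\<Sum>e\<in>edge_pairs C. ennreal (real (m e) *
     real (path_jumps (map fst p @ [w]) (fst e) (snd e) - path_jumps (erased_path (map fst p) @ [w]) (fst e) (snd e))))"
  proof (rule sum.cong[OF refl])
    fix e' assume "e' \<in> edge_pairs C"
    from loop_erasure_traversals[OF e edge_pairs_neq[OF this], of w]
    show "of_nat (m e') * of_nat (\<Sum>l\<leftarrow>L. traversals l (fst e') (snd e')) = ennreal (real (m e') *
      real (path_jumps (map fst p @ [w]) (fst e') (snd e') - path_jumps (erased_path (map fst p) @ [w]) (fst e') (snd e')))"
      by (simp add: g ennreal_mult ennreal_of_nat_eq_real_of_nat)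
  qed
  finally have "expm (\<Sum>l\<leftarrow>L. test_fun k m l) = (\<Prod>q\<leftarrow>p. expm (ennreal (rate k (fst q) * snd q))) *
    expm (ennreal (\<Sum>e\<in>edge_pairs C. real (m e) *
     real (path_jumps (map fst p @ [w]) (fst e) (snd e) - path_jumps (erased_path (map fst p) @ [w]) (fst e) (snd e))))"
    by (simp add: expm_add expm_sum_list sum_ennreal)
  also have "(\<Prod>q\<leftarrow>p. expm (ennreal (rate k (fst q) * snd q))) = (\<Prod>q\<leftarrow>p. exp (- (rate k (fst q) * snd q)))"
    using assms rate_nonneg by (intro arg_cong[of _ _ prod_list] map_cong) (auto simp: expm_ennreal)
  also have "ennreal (\<dots> * expm (ennreal (\<Sum>e\<in>edge_pairs C. real (m e) *
     real (path_jumps (map fst p @ [w]) (fst e) (snd e) - path_jumps (erased_path (map fst p) @ [w]) (fst e) (snd e))))) =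
     ennreal (\<Prod>q\<leftarrow>p. exp (- (rate k (fst q) * snd q))) * jump_factor m (map fst p) w"
    unfolding jump_factor_def
    by (subst expm_ennreal) (auto simp: ennreal_mult'' intro!: sum_nonneg)
  also have "ennreal (\<Prod>q\<leftarrow>p. exp (- (rate k (fst q) * snd q))) = (\<Prod>q\<leftarrow>p. ennreal (exp (- (rate k (fst q) * snd q))))"
    by (induction p) (auto simp: ennreal_mult')
  finally show ?thesis using e by (simp add: mult.commute)
qed

text \<open>Total weight of the loops still to be erased when \<open>U\<close> is the set of
  vertices outside the tree: closed walks give \<open>loop_exp\<close>, and the last visit to each
  vertex, left as a loop reduced to a point, gives one more \<open>damping\<close>.\<close>

definition loop_factor :: "('a \<Rightarrow> nat) \<Rightarrow> ('a \<times> 'a \<Rightarrow> nat) \<Rightarrow> 'a option set \<Rightarrow> ennreal" where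
  "loop_factor k m U = (\<Prod>v\<in>U. damping k v) * loop_exp (tilted k m) U"

definition branches :: "'a \<Rightarrow> 'a option set \<Rightarrow> 'a option list set" where
  "branches x U = {\<gamma>. distinct \<gamma> \<and> set \<gamma> \<subseteq> U \<and> \<gamma> \<noteq> [] \<and> hd \<gamma> = Some x}"

text \<open>Weight of growing \<open>T\<close> into \<open>T'\<close> by branches started from the
  remaining vertices. It is built from \<open>jp\<close> alone, without the parameters
  \<open>k\<close> and \<open>m\<close>; this separates the tree from the network.\<close>

primrec tree_weight :: "'a list \<Rightarrow> ('a option \<times> 'a option) set \<Rightarrow> ('a option \<times> 'a option) set \<Rightarrow> ennreal" where
  "tree_weight [] T T' = of_bool (T = T')"
| "tree_weight (x # xs) T T' = (if Some x \<in> tree_vertices T then tree_weight xs T T' else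
    (\<Sum>w\<in>tree_vertices T. \<integral>\<^sup>+\<gamma>. walk_weight jp (\<gamma> @ [w]) * tree_weight xs (T \<union> branch \<gamma> w) T'
      \<partial>count_space (branches x (- tree_vertices T))))"

text \<open>The discount of the erased loops lacks the marking of the branch. Multiplication by this
  marking completes the weight of the walk to \<open>tilted\<close>, to which the identity for loop
  erasures applies; being positive and finite, the marking cancels afterwards.\<close>

lemma sum_walks_to_branch:
  assumes U: "None \<notin> U" and \<gamma>: "distinct \<gamma>" "set \<gamma> \<subseteq> U"
  shows "(\<integral>\<^sup>+p. jump_factor m p w * (walk_weight jp (p @ [w]) * (\<Prod>v\<leftarrow>p. damping k v))
      \<partial>count_space {p. set p \<subseteq> U \<and> erased_path p = \<gamma>}) * loop_factor k m (U - set \<gamma>) =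
    walk_weight jp (\<gamma> @ [w]) * loop_factor k m U"
proof -
  let ?S = "walk_weight (marking m) (\<gamma> @ [w])" and ?P = "{p. set p \<subseteq> U \<and> erased_path p = \<gamma>}"
  let ?I = "\<integral>\<^sup>+p. jump_factor m p w * (walk_weight jp (p @ [w]) * (\<Prod>v\<leftarrow>p. damping k v)) \<partial>count_space ?P"
  have t: "walk_weight (tilted k m) (p @ [w]) =
      walk_weight jp (p @ [w]) * (\<Prod>v\<leftarrow>p. damping k v) * walk_weight (marking m) (p @ [w])" for p
    unfolding tilted_def walk_weight_mult walk_weight_source ..
  have "?S * ?I = (\<integral>\<^sup>+p. ?S * (jump_factor m p w * (walk_weight jp (p @ [w]) * (\<Prod>v\<leftarrow>p. damping k v))) \<partial>count_space ?P)"
    by (rule nn_integral_cmult[symmetric]) simp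
  also have "\<dots> = (\<integral>\<^sup>+p. walk_weight (tilted k m) (p @ [w]) \<partial>count_space ?P)"
  proof (rule nn_integral_cong)
    fix p assume "p \<in> space (count_space ?P)"
    then have "jump_factor m p w * ?S = walk_weight (marking m) (p @ [w])"
      using jump_factor_marking[of m p w] by simp
    moreover have "?S * (jump_factor m p w * (walk_weight jp (p @ [w]) * (\<Prod>v\<leftarrow>p. damping k v))) =
      walk_weight jp (p @ [w]) * (\<Prod>v\<leftarrow>p. damping k v) * (jump_factor m p w * ?S)"
      by (simp only: mult_ac)
    ultimately show "?S * (jump_factor m p w * (walk_weight jp (p @ [w]) * (\<Prod>v\<leftarrow>p. damping k v))) = walk_weight (tilted k m) (p @ [w])"
      by (simp only: t)
  qed
  finally have "?S * ?I * loop_exp (tilted k m) (U - set \<gamma>) = walk_weight (tilted k m) (\<gamma> @ [w]) * loop_exp (tilted k m) U"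
  proof (simp only:, intro sum_walks_loop_erasure)
    show "green (tilted k m) V v < \<top>" if "V \<subseteq> U" "v \<in> V" for V v
      using that U by (intro green_tilted_finite) auto
  qed (use \<gamma> in auto)
  then have "?S * (?I * loop_exp (tilted k m) (U - set \<gamma>)) =
    ?S * (walk_weight jp (\<gamma> @ [w]) * (\<Prod>v\<leftarrow>\<gamma>. damping k v) * loop_exp (tilted k m) U)"
    by (simp add: t mult_ac)
  moreover have "?S \<noteq> 0" "?S \<noteq> \<top>" by (auto simp: walk_weight_marking)
  ultimately have *: "?I * loop_exp (tilted k m) (U - set \<gamma>) =
    walk_weight jp (\<gamma> @ [w]) * (\<Prod>v\<leftarrow>\<gamma>. damping k v) * loop_exp (tilted k m) U"
    by (simp add: ennreal_mult_cancel_left)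
  \<comment> \<open>The dampings left over along the branch are exactly those that the product over
    \<open>U - set \<gamma>\<close> lacks.\<close>
  have "(\<Prod>v\<in>U. damping k v) = (\<Prod>v\<in>U - set \<gamma>. damping k v) * (\<Prod>v\<in>set \<gamma>. damping k v)"
    using \<gamma> by (intro prod.subset_diff) auto
  also have "(\<Prod>v\<in>set \<gamma>. damping k v) = (\<Prod>v\<leftarrow>\<gamma>. damping k v)"
    using \<gamma> by (simp add: prod.distinct_set_conv_list)
  finally have d: "(\<Prod>v\<in>U. damping k v) = (\<Prod>v\<in>U - set \<gamma>. damping k v) * (\<Prod>v\<leftarrow>\<gamma>. damping k v)" .
  have "?I * loop_factor k m (U - set \<gamma>) = (\<Prod>v\<in>U - set \<gamma>. damping k v) * (?I * loop_exp (tilted k m) (U - set \<gamma>))"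
    by (simp add: loop_factor_def mult_ac)
  also have "\<dots> = walk_weight jp (\<gamma> @ [w]) * loop_factor k m U"
    unfolding * loop_factor_def d by (simp add: mult_ac)
  finally show ?thesis .
qed

lemma distinct_erased_path: "distinct (erased_path p)"
  using distinct_loop_erasure[of "map (\<lambda>v. (v, 0)) p"] fst_loop_erasure[of "map (\<lambda>v. (v, 0)) p"]
  by (simp add: o_def)

lemma set_erased_path: "set (erased_path p) \<subseteq> set p"
proof (induction p rule: length_induct)
  case (1 p)
  show ?case
  proof (cases "erased_path p")
    case (Cons x \<gamma>)
    then obtain l q where lq: "p = l @ x # q" "erased_path q = \<gamma>" by (rule erased_path_cases)
    then have "length q < length p" by simp
    with 1 have "set (erased_path q) \<subseteq> set q" by blast
    with lq Cons show ?thesis by auto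
  qed simp
qed

text \<open>Weighted by \<open>loop_factor\<close> of the vertices outside the tree, a step of the
  algorithm is balanced: for each branch, the loops erased along it together with the factor of the
  vertices left over give the factor before the step. The function \<open>h\<close> stands for the
  rest of the run.\<close>

lemma nn_integral_wilson_step:
  assumes x: "Some x \<notin> tree_vertices T"
  shows "(\<integral>\<^sup>+y. ennreal (expm (\<Sum>l\<leftarrow>step_loops y T. test_fun k m l)) *
      (h (step_tree y T) * loop_factor k m (- tree_vertices (step_tree y T))) \<partial>chain_law C \<kappa> x) =
    (\<Sum>w\<in>tree_vertices T. \<integral>\<^sup>+\<gamma>. walk_weight jp (\<gamma> @ [w]) * h (T \<union> branch \<gamma> w)
      \<partial>count_space (branches x (- tree_vertices T))) * loop_factor k m (- tree_vertices T)"
proof -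
  let ?V = "tree_vertices T" and ?U = "- tree_vertices T"
  let ?H = "\<lambda>T. h T * loop_factor k m (- tree_vertices T)"
  let ?Q = "\<lambda>p w. ?H (T \<union> branch (erased_path p) w) * jump_factor m p w"
  let ?g = "\<lambda>v r. ennreal (exp (- (rate k v * r)))"
  have N: "None \<in> ?V" by (simp add: tree_vertices_def)
  have "(\<integral>\<^sup>+y. ennreal (expm (\<Sum>l\<leftarrow>step_loops y T. test_fun k m l)) * ?H (step_tree y T) \<partial>chain_law C \<kappa> x) =
    (\<integral>\<^sup>+y. ?Q (map (fst \<circ> y) [0..<hitting_index y ?V]) (fst (y (hitting_index y ?V))) *
      (\<Prod>i<hitting_index y ?V. ?g (fst (y i)) (snd (y i))) \<partial>chain_law C \<kappa> x)"
  proof (rule nn_integral_cong_AE)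
    \<comment> \<open>Holding times are nonnegative only almost surely, and the formula for local
      times needs this.\<close>
    show "AE y in chain_law C \<kappa> x. ennreal (expm (\<Sum>l\<leftarrow>step_loops y T. test_fun k m l)) * ?H (step_tree y T) =
      ?Q (map (fst \<circ> y) [0..<hitting_index y ?V]) (fst (y (hitting_index y ?V))) *
      (\<Prod>i<hitting_index y ?V. ?g (fst (y i)) (snd (y i)))"
      using AE_chain_holding_pos[of x]
    proof eventually_elim
      case (elim y)
      let ?h = "hitting_index y ?V"
      have p: "map fst (first_path y T) = map (fst \<circ> y) [0..<?h]" by (simp add: first_path_def)
      have "(\<Prod>q\<leftarrow>first_path y T. ?g (fst q) (snd q)) = (\<Prod>i<?h. ?g (fst (y i)) (snd (y i)))"
        by (simp add: first_path_def prod.list_conv_set_nth atLeast0LessThan)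
      moreover have "ennreal (expm (\<Sum>l\<leftarrow>step_loops y T. test_fun k m l)) =
        jump_factor m (map fst (first_path y T)) (fst (y ?h)) * (\<Prod>q\<leftarrow>first_path y T. ?g (fst q) (snd q))"
        unfolding step_loops_def
        by (rule expm_test_fun_loop_erasure) (use elim in \<open>auto simp: first_path_def intro: less_imp_le\<close>)
      ultimately show ?case by (simp add: p step_tree_def mult_ac)
    qed
  qed
  also have "\<dots> = (\<Sum>w\<in>?V. \<integral>\<^sup>+p. ?Q p w * (walk_weight jp (p @ [w]) * (\<Prod>v\<leftarrow>p. \<integral>\<^sup>+r. ?g v r \<partial>unit_exponential))
      \<partial>count_space {p. set p \<subseteq> ?U \<and> p \<noteq> [] \<and> hd p = Some x})"
    by (rule nn_integral_chain_hitting[OF N x]) measurable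
  also have "\<dots> = (\<Sum>w\<in>?V. \<integral>\<^sup>+p. ?Q p w * (walk_weight jp (p @ [w]) * (\<Prod>v\<leftarrow>p. damping k v))
      \<partial>count_space {p. set p \<subseteq> ?U \<and> p \<noteq> [] \<and> hd p = Some x})"
    by (simp only: nn_integral_unit_exponential_exp[OF rate_nonneg] damping_def)
  also have "\<dots> = (\<Sum>w\<in>?V. \<integral>\<^sup>+\<gamma>. walk_weight jp (\<gamma> @ [w]) * h (T \<union> branch \<gamma> w) * loop_factor k m ?U
      \<partial>count_space (branches x ?U))"
  proof (rule sum.cong[OF refl])
    fix w assume w: "w \<in> ?V"
    let ?P = "{p. set p \<subseteq> ?U \<and> p \<noteq> [] \<and> hd p = Some x}"
    let ?F = "\<lambda>p. ?Q p w * (walk_weight jp (p @ [w]) * (\<Prod>v\<leftarrow>p. damping k v))"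
    have "(\<integral>\<^sup>+p. ?F p \<partial>count_space ?P) = (\<integral>\<^sup>+\<gamma>. \<integral>\<^sup>+p. ?F p \<partial>count_space {p\<in>?P. erased_path p = \<gamma>} \<partial>count_space (branches x ?U))"
    \<comment> \<open>The trajectories are grouped by their loop erasure, the branch that they add
      to the tree.\<close>
    proof (rule nn_integral_count_space_partition)
      fix p assume "p \<in> ?P"
      then show "erased_path p \<in> branches x ?U"
        using erased_path_nonempty[of p] set_erased_path[of p] by (auto simp: branches_def distinct_erased_path)
    qed simp
    also have "\<dots> = (\<integral>\<^sup>+\<gamma>. walk_weight jp (\<gamma> @ [w]) * h (T \<union> branch \<gamma> w) * loop_factor k m ?U \<partial>count_space (branches x ?U))"
    proof (rule nn_integral_cong)
      fix \<gamma> assume "\<gamma> \<in> space (count_space (branches x ?U))"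
      then have \<gamma>: "distinct \<gamma>" "set \<gamma> \<subseteq> ?U" "\<gamma> \<noteq> []" "hd \<gamma> = Some x" by (auto simp: branches_def)
      let ?G = "\<lambda>p. jump_factor m p w * (walk_weight jp (p @ [w]) * (\<Prod>v\<leftarrow>p. damping k v))"
      have P: "{p\<in>?P. erased_path p = \<gamma>} = {p. set p \<subseteq> ?U \<and> erased_path p = \<gamma>}"
      proof (rule Collect_cong)
        have "p \<noteq> [] \<and> hd p = Some x" if "erased_path p = \<gamma>" for p
          using that \<gamma> erased_path_nonempty(2)[of p] by (cases "p = []") auto
        then show "p \<in> ?P \<and> erased_path p = \<gamma> \<longleftrightarrow> set p \<subseteq> ?U \<and> erased_path p = \<gamma>" for p by blast
      qed
      have tv: "- tree_vertices (T \<union> branch \<gamma> w) = ?U - set \<gamma>"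
        using tree_vertices_branch[OF w \<gamma>(3)] by auto
      have "(\<integral>\<^sup>+p. ?F p \<partial>count_space {p\<in>?P. erased_path p = \<gamma>}) =
        (\<integral>\<^sup>+p. ?H (T \<union> branch \<gamma> w) * ?G p \<partial>count_space {p. set p \<subseteq> ?U \<and> erased_path p = \<gamma>})"
        unfolding P by (intro nn_integral_cong) (simp add: mult_ac)
      also have "\<dots> = h (T \<union> branch \<gamma> w) * ((\<integral>\<^sup>+p. ?G p \<partial>count_space {p. set p \<subseteq> ?U \<and> erased_path p = \<gamma>}) * loop_factor k m (?U - set \<gamma>))"
        by (subst nn_integral_cmult) (auto simp: tv mult_ac)
      also have "\<dots> = h (T \<union> branch \<gamma> w) * (walk_weight jp (\<gamma> @ [w]) * loop_factor k m ?U)"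
        using N \<gamma> by (subst sum_walks_to_branch) auto
      finally show "(\<integral>\<^sup>+p. ?F p \<partial>count_space {p\<in>?P. erased_path p = \<gamma>}) =
        walk_weight jp (\<gamma> @ [w]) * h (T \<union> branch \<gamma> w) * loop_factor k m ?U" by (simp add: mult_ac)
    qed
    finally show "(\<integral>\<^sup>+p. ?F p \<partial>count_space ?P) =
      (\<integral>\<^sup>+\<gamma>. walk_weight jp (\<gamma> @ [w]) * h (T \<union> branch \<gamma> w) * loop_factor k m ?U \<partial>count_space (branches x ?U))" .
  qed
  also have "\<dots> = (\<Sum>w\<in>?V. \<integral>\<^sup>+\<gamma>. walk_weight jp (\<gamma> @ [w]) * h (T \<union> branch \<gamma> w) \<partial>count_space (branches x ?U)) * loop_factor k m ?U"
    by (simp add: nn_integral_multc sum_distrib_right)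
  finally show ?thesis .
qed

lemma AE_chain_start: "AE z in chain_law C \<kappa> x. fst (z 0) = Some x"
  unfolding chain_law_def
  by (subst AE_distr_iff[OF measurable_chain]) (auto simp: case_prod_beta)

text \<open>Induction over the ordering: Fubini's theorem sets the trajectory of the first vertex
  apart, and its step is balanced by \<open>loop_factor\<close>. At the end no vertex is left and
  the factor is 1. The inclusion says that every vertex outside the tree is still to come.\<close>

lemma nn_integral_wilson_from:
  assumes "distinct xs" "- tree_vertices T \<subseteq> Some ` set xs"
  shows "(\<integral>\<^sup>+z. of_bool (fst (wilson_from z xs T) = T') *
      ennreal (expm (\<Sum>l\<leftarrow>snd (wilson_from z xs T). test_fun k m l)) \<partial>(\<Pi>\<^sub>M x\<in>set xs. chain_law C \<kappa> x)) =
    tree_weight xs T T' * loop_factor k m (- tree_vertices T)"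
  using assms
proof (induction xs arbitrary: T)
  case Nil
  then have "- tree_vertices T = {}" by simp
  then show ?case
    by (simp add: PiM_empty nn_integral_count_space_finite loop_factor_def loop_exp_def)
next
  case (Cons x xs)
  interpret product_sigma_finite "\<lambda>x. chain_law C \<kappa> x"
    by (simp add: product_sigma_finite_def prob_space_imp_sigma_finite[OF prob_space_chain_law])
  let ?f = "\<lambda>xs T z. of_bool (fst (wilson_from z xs T) = T') *
    ennreal (expm (\<Sum>l\<leftarrow>snd (wilson_from z xs T). test_fun k m l))"
  have sets: "sets (\<Pi>\<^sub>M x\<in>I. chain_law C \<kappa> x) = sets (\<Pi>\<^sub>M x\<in>I. trajectory_space)" for I
    by (rule sets_PiM_cong) (auto simp: sets_chain_law)
  have meas: "?f xs T \<in> borel_measurable (\<Pi>\<^sub>M x\<in>I. chain_law C \<kappa> x)" if "set xs \<subseteq> I" for xs T I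
  proof -
    note [measurable] = measurable_wilson_from[OF measurable_test_fun that]
    show ?thesis unfolding measurable_cong_sets[OF sets refl] of_bool_def by measurable
  qed
  have x: "x \<notin> set xs" using Cons.prems by simp
  \<comment> \<open>Each vertex starts at most one trajectory, so the rest of the run ignores that
    of \<open>x\<close>.\<close>
  have cong: "wilson_from (z(x := y)) xs T = wilson_from z xs T" for z y T
    using x by (intro wilson_from_cong) auto
  have "integral\<^sup>N (\<Pi>\<^sub>M x\<in>set (x # xs). chain_law C \<kappa> x) (?f (x # xs) T) =
    (\<integral>\<^sup>+y. \<integral>\<^sup>+z. ?f (x # xs) T (z(x := y)) \<partial>(\<Pi>\<^sub>M x\<in>set xs. chain_law C \<kappa> x) \<partial>chain_law C \<kappa> x)"
    using x meas[of "x # xs" "insert x (set xs)"] by (simp only: list.set) (intro product_nn_integral_insert_rev; simp)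
  also have "\<dots> = tree_weight (x # xs) T T' * loop_factor k m (- tree_vertices T)"
  proof (cases "Some x \<in> tree_vertices T")
    case True
    have "- tree_vertices T \<subseteq> Some ` set xs" using Cons.prems True by auto
    then have IH: "integral\<^sup>N (\<Pi>\<^sub>M x\<in>set xs. chain_law C \<kappa> x) (?f xs T) = tree_weight xs T T' * loop_factor k m (- tree_vertices T)"
      using Cons by simp
    interpret prob_space "chain_law C \<kappa> x" by (rule prob_space_chain_law)
    show ?thesis using True by (simp add: wilson_from_Cons cong IH emeasure_space_1)
  next
    case False
    have "(\<integral>\<^sup>+z. ?f (x # xs) T (z(x := y)) \<partial>(\<Pi>\<^sub>M x\<in>set xs. chain_law C \<kappa> x)) =
      ennreal (expm (\<Sum>l\<leftarrow>step_loops y T. test_fun k m l)) *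
      (tree_weight xs (step_tree y T) T' * loop_factor k m (- tree_vertices (step_tree y T)))"
      if hit: "\<exists>n. fst (y n) = None" "fst (y 0) = Some x" for y
    proof -
      let ?h = "hitting_index y (tree_vertices T)"
      \<comment> \<open>A trajectory that starts at \<open>x\<close> and is killed hits the tree,
        and not before its first jump. So \<open>x\<close> joins the tree, and the induction
        hypothesis applies to the rest of the ordering.\<close>
      have "\<exists>n. fst (y n) \<in> tree_vertices T" using hit by (auto simp: tree_vertices_def)
      then have h: "fst (y ?h) \<in> tree_vertices T" unfolding hitting_index_def by (rule LeastI_ex)
      then have "?h \<noteq> 0" using False hit(2) by metis
      then have ne: "first_path y T \<noteq> []" and hd: "fst (hd (first_path y T)) = Some x"
        using hit(2) by (auto simp: first_path_def hd_map)
      let ?\<gamma> = "erased_path (map fst (first_path y T))"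
      have \<gamma>: "?\<gamma> \<noteq> []" "hd ?\<gamma> = Some x"
        using erased_path_nonempty[of "map fst (first_path y T)"] ne hd by (auto simp: hd_map)
      then have "Some x \<in> set ?\<gamma>" by (metis hd_in_set)
      then have "Some x \<in> tree_vertices (step_tree y T)" "tree_vertices T \<subseteq> tree_vertices (step_tree y T)"
        unfolding step_tree_def using tree_vertices_branch[OF h \<gamma>(1)] by auto
      then have "- tree_vertices (step_tree y T) \<subseteq> Some ` set xs" using Cons.prems by auto
      then have IH: "integral\<^sup>N (\<Pi>\<^sub>M x\<in>set xs. chain_law C \<kappa> x) (?f xs (step_tree y T)) =
        tree_weight xs (step_tree y T) T' * loop_factor k m (- tree_vertices (step_tree y T))"
        using Cons by simp
      have "(\<integral>\<^sup>+z. ?f (x # xs) T (z(x := y)) \<partial>(\<Pi>\<^sub>M x\<in>set xs. chain_law C \<kappa> x)) =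
        (\<integral>\<^sup>+z. ennreal (expm (\<Sum>l\<leftarrow>step_loops y T. test_fun k m l)) * ?f xs (step_tree y T) z \<partial>(\<Pi>\<^sub>M x\<in>set xs. chain_law C \<kappa> x))"
        using False by (intro nn_integral_cong) (simp add: wilson_from_Cons cong expm_add ennreal_mult mult_ac)
      then show ?thesis using meas[OF order_refl] by (simp add: nn_integral_cmult IH)
    qed
    then have "(\<integral>\<^sup>+y. \<integral>\<^sup>+z. ?f (x # xs) T (z(x := y)) \<partial>(\<Pi>\<^sub>M x\<in>set xs. chain_law C \<kappa> x) \<partial>chain_law C \<kappa> x) =
      (\<integral>\<^sup>+y. ennreal (expm (\<Sum>l\<leftarrow>step_loops y T. test_fun k m l)) *
      (tree_weight xs (step_tree y T) T' * loop_factor k m (- tree_vertices (step_tree y T))) \<partial>chain_law C \<kappa> x)"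
      using AE_chain_killed[of x] AE_chain_start[of x] by (intro nn_integral_cong_AE) (auto elim: eventually_elim2)
    also have "\<dots> = tree_weight (x # xs) T T' * loop_factor k m (- tree_vertices T)"
      using False nn_integral_wilson_step[OF False, of k m "\<lambda>T. tree_weight xs T T'"] by simp
    finally show ?thesis .
  qed
  finally show ?case .
qed

end

section \<open>Laplace transforms determine the law of a network\<close>

text \<open>The polynomials in the coordinates. Being generated by monomials and sums, they allow
  the passage from equal moments to equal integrals by rule induction.\<close>

inductive_set monomial_span :: "(real ^ 'i \<Rightarrow> real) set" where
  monomial: "(\<lambda>v. c * (\<Prod>i\<in>UNIV. (v $ i) ^ n i)) \<in> monomial_span"
| add: "f \<in> monomial_span \<Longrightarrow> g \<in> monomial_span \<Longrightarrow> (\<lambda>v. f v + g v) \<in> monomial_span"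

lemma monomial_span_mult:
  assumes "f \<in> monomial_span" "g \<in> monomial_span"
  shows "(\<lambda>v. f v * g v) \<in> monomial_span"
  using assms
proof (induction f)
  case (monomial c n)
  then show ?case
  proof (induction g)
    case (monomial d m)
    have "(\<lambda>v. (c * (\<Prod>i\<in>UNIV. (v $ i) ^ n i)) * (d * (\<Prod>i\<in>UNIV. (v $ i) ^ m i))) =
      (\<lambda>v. (c * d) * (\<Prod>i\<in>UNIV. (v $ i) ^ (n i + m i)))"
      by (simp add: fun_eq_iff power_add prod.distrib)
    then show ?case using monomial_span.monomial[of "c * d" "\<lambda>i. n i + m i"] by simp
  next
    case (add f g)
    then show ?case using monomial_span.add by (fastforce simp: distrib_left)
  qed
next
  case (add f1 f2)
  then show ?case using monomial_span.add by (fastforce simp: distrib_right)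
qed

lemma continuous_on_monomial_span: "f \<in> monomial_span \<Longrightarrow> continuous_on S f"
  by (induction rule: monomial_span.induct) (auto intro!: continuous_intros)

lemma function_ring_monomial_span:
  "compact S \<Longrightarrow> function_ring_on monomial_span S"
proof
  show "(\<lambda>_. c) \<in> monomial_span" for c
    using monomial_span.monomial[of c "\<lambda>_. 0"] by simp
  fix x y :: "real ^ 'i" assume "x \<noteq> y"
  then obtain j where j: "x $ j \<noteq> y $ j" by (auto simp: vec_eq_iff)
  have *: "(\<Prod>i\<in>UNIV. (v $ i) ^ (if i = j then 1 else 0)) = v $ j" for v :: "real ^ 'i"
    by (subst prod.remove[of _ j]) auto
  show "\<exists>f\<in>monomial_span. f x \<noteq> f y"
    by (rule bexI[OF _ monomial_span.monomial[of 1 "\<lambda>i. if i = j then 1 else 0"]]) (use j in \<open>simp only: * mult_1_left not_False_eq_True\<close>)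
qed (auto intro: continuous_on_monomial_span monomial_span.add monomial_span_mult)

text \<open>Closed sets form an intersection-stable generator, and the indicator of a closed set is
  a bounded limit of continuous functions of the distance to it.\<close>

lemma finite_measure_eqI_continuous:
  fixes M N :: "'b::euclidean_space measure"
  assumes "finite_measure M" "finite_measure N" and sets: "sets M = sets borel" "sets N = sets borel"
    and eq: "\<And>f :: 'b \<Rightarrow> real. continuous_on UNIV f \<Longrightarrow> (\<And>v. 0 \<le> f v \<and> f v \<le> 1) \<Longrightarrow> (\<integral>v. f v \<partial>M) = (\<integral>v. f v \<partial>N)"
  shows "M = N"
proof (rule measure_eqI_generator_eq)
  interpret M: finite_measure M by fact
  interpret N: finite_measure N by fact
  show "Int_stable (Collect closed)" by (auto simp: Int_stable_def)
  show "sets M = sigma_sets UNIV (Collect closed)" "sets N = sigma_sets UNIV (Collect closed)"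
    using sets by (simp_all add: borel_eq_closed)
  show "range (\<lambda>_. UNIV) \<subseteq> Collect closed" by auto
  show "emeasure M UNIV \<noteq> \<infinity>" by simp
  fix A :: "'b set" assume "A \<in> Collect closed"
  then have A: "closed A" by simp
  show "emeasure M A = emeasure N A"
  \<comment> \<open>The empty set is set apart because \<open>infdist\<close> to it is 0 by
    convention.\<close>
  proof (cases "A = {}")
    case False
    define f where "f n v = max 0 (1 - real n * infdist v A)" for n v
    have f01: "0 \<le> f n v \<and> f n v \<le> 1" for n v by (simp add: f_def infdist_nonneg)
    have fc: "continuous_on UNIV (f n)" for n
      unfolding f_def by (intro continuous_intros)
    have fm: "f n \<in> borel_measurable borel" for n
      by (rule borel_measurable_continuous_onI[OF fc])
    have lim: "(\<lambda>n. f n v) \<longlonglongrightarrow> indicator A v" for v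
    proof (cases "v \<in> A")
      case True
      then show ?thesis by (simp add: f_def)
    next
      case notin: False
      then have pos: "infdist v A > 0"
        using A False by (metis in_closed_iff_infdist_zero infdist_nonneg less_le)
      obtain n0 :: nat where n0: "1 / infdist v A < real n0" using reals_Archimedean2 by blast
      have "f n v = 0" if "n \<ge> n0" for n
      proof -
        have "1 < real n0 * infdist v A" using n0 pos by (simp add: divide_less_eq)
        also have "\<dots> \<le> real n * infdist v A" using that pos by (intro mult_right_mono) auto
        finally show ?thesis by (simp add: f_def)
      qed
      then have "eventually (\<lambda>n. f n v = 0) sequentially" using eventually_sequentially by blast
      then show ?thesis using notin by (simp add: tendsto_eventually)
    qed
    have "(\<lambda>n. \<integral>v. f n v \<partial>L) \<longlonglongrightarrow> measure L A" if "finite_measure L" "sets L = sets borel" for L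
    proof -
      interpret L: finite_measure L by fact
      have [measurable]: "A \<in> sets L" "f n \<in> borel_measurable L" for n
        using A fm that(2) by (auto cong: measurable_cong_sets)
      have "(\<lambda>n. \<integral>v. f n v \<partial>L) \<longlonglongrightarrow> (\<integral>v. indicator A v \<partial>L)"
        by (rule integral_dominated_convergence[where w = "\<lambda>_. 1"]) (use lim f01 in auto)
      then show ?thesis by simp
    qed
    note L = this
    have "(\<integral>v. f n v \<partial>M) = (\<integral>v. f n v \<partial>N)" for n
      by (rule eq[OF fc f01])
    with L[OF assms(1) sets(1)] L[OF assms(2) sets(2)]
    have "measure M A = measure N A" by (simp add: LIMSEQ_unique)
    then show ?thesis by (simp add: M.emeasure_eq_measure N.emeasure_eq_measure)
  qed simp
qed auto

text \<open>Both measures live on the unit cube, where continuous functions are uniform limits of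
  polynomials by the Stone-Weierstrass theorem.\<close>

lemma finite_measure_eqI_moments:
  fixes M N :: "(real ^ 'i) measure"
  assumes fin: "finite_measure M" "finite_measure N" and sets: "sets M = sets borel" "sets N = sets borel"
    and K: "AE v in M. \<forall>i. 0 \<le> v $ i \<and> v $ i \<le> 1" "AE v in N. \<forall>i. 0 \<le> v $ i \<and> v $ i \<le> 1"
    and eq: "\<And>n. (\<integral>v. (\<Prod>i\<in>UNIV. (v $ i) ^ n i) \<partial>M) = (\<integral>v. (\<Prod>i\<in>UNIV. (v $ i) ^ n i) \<partial>N)"
  shows "M = N"
proof (rule finite_measure_eqI_continuous[OF fin sets])
  let ?K = "{v :: real ^ 'i. \<forall>i. 0 \<le> v $ i \<and> v $ i \<le> 1}"
  have "?K = cbox 0 1" by (auto simp: mem_box_cart)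
  then have cK: "compact ?K" by simp
  have int: "integrable L f" if "finite_measure L" "sets L = sets borel" "AE v in L. v \<in> ?K" "continuous_on UNIV f"
    for L and f :: "real ^ 'i \<Rightarrow> real"
  proof -
    interpret L: finite_measure L by fact
    have "compact (f ` ?K)"
      using cK that(4) by (intro compact_continuous_image) (auto intro: continuous_on_subset)
    then have "bounded (f ` ?K)" by (rule compact_imp_bounded)
    then obtain B where B: "\<And>v. v \<in> ?K \<Longrightarrow> norm (f v) \<le> B" by (auto simp: bounded_iff)
    show ?thesis
    proof (rule L.integrable_const_bound)
      show "AE v in L. norm (f v) \<le> B" using that(3) by eventually_elim (rule B)
      show "f \<in> borel_measurable L"
        using borel_measurable_continuous_onI[OF that(4)] that(2) by (simp cong: measurable_cong_sets)
    qed
  qed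
  note intM = int[OF fin(1) sets(1)] and intN = int[OF fin(2) sets(2)]
  have span: "(\<integral>v. g v \<partial>M) = (\<integral>v. g v \<partial>N)" if "g \<in> monomial_span" for g
    using that
  proof induction
    case (add f g)
    then show ?case
      using K by (simp add: intM intN continuous_on_monomial_span)
  qed (simp add: eq)
  fix f :: "real ^ 'i \<Rightarrow> real" assume f: "continuous_on UNIV f"
  interpret M: finite_measure M by (rule fin)
  interpret N: finite_measure N by (rule fin)
  interpret function_ring_on monomial_span ?K by (rule function_ring_monomial_span[OF cK])
  have "\<bar>(\<integral>v. f v \<partial>M) - (\<integral>v. f v \<partial>N)\<bar> \<le> e * (measure M UNIV + measure N UNIV)" if e: "e > 0" for e
  proof -
    obtain g where g: "g \<in> monomial_span" "\<And>v. v \<in> ?K \<Longrightarrow> \<bar>f v - g v\<bar> < e"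
      using Stone_Weierstrass_basic[OF continuous_on_subset[OF f] e] by auto
    have *: "\<bar>(\<integral>v. f v \<partial>L) - (\<integral>v. g v \<partial>L)\<bar> \<le> e * measure L UNIV"
      if L: "finite_measure L" "sets L = sets borel" "AE v in L. v \<in> ?K" for L
    proof -
      interpret L: finite_measure L by fact
      note i = int[OF L]
      have d: "integrable L (\<lambda>v. f v - g v)"
        using i[OF f] i[OF continuous_on_monomial_span[OF g(1)]] by simp
      have sp: "space L = UNIV" using sets_eq_imp_space_eq[OF L(2)] by simp
      have "\<bar>(\<integral>v. f v \<partial>L) - (\<integral>v. g v \<partial>L)\<bar> = \<bar>\<integral>v. f v - g v \<partial>L\<bar>"
        using i[OF f] i[OF continuous_on_monomial_span[OF g(1)]] by simp
      also have "\<dots> \<le> (\<integral>v. \<bar>f v - g v\<bar> \<partial>L)"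
        using integral_norm_bound[of L "\<lambda>v. f v - g v"] by simp
      also have "\<dots> \<le> (\<integral>v. e \<partial>L)"
      proof (rule integral_mono_AE)
        show "AE v in L. \<bar>f v - g v\<bar> \<le> e" using L(3) by eventually_elim (use g(2) in \<open>auto intro: less_imp_le\<close>)
      qed (use d in auto)
      finally show ?thesis by (simp add: sp mult.commute)
    qed
    have "\<bar>(\<integral>v. f v \<partial>M) - (\<integral>v. g v \<partial>M)\<bar> \<le> e * measure M UNIV"
      "\<bar>(\<integral>v. f v \<partial>N) - (\<integral>v. g v \<partial>N)\<bar> \<le> e * measure N UNIV"
      using *[OF fin(1) sets(1)] *[OF fin(2) sets(2)] K by auto
    then show ?thesis using span[OF g(1)] by (simp add: distrib_left)
  qed
  note bound = this
  have "\<bar>(\<integral>v. f v \<partial>M) - (\<integral>v. f v \<partial>N)\<bar> \<le> 0"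
  proof (rule field_le_epsilon)
    fix e :: real assume "e > 0"
    let ?m = "measure M UNIV + measure N UNIV"
    have m: "?m \<ge> 0" by simp
    \<comment> \<open>The summand 1 keeps the denominator positive when both measures
      vanish.\<close>
    have "e / (?m + 1) > 0" using \<open>e > 0\<close> m by (intro divide_pos_pos add_nonneg_pos) auto
    from bound[OF this] have "\<bar>(\<integral>v. f v \<partial>M) - (\<integral>v. f v \<partial>N)\<bar> \<le> e * (?m / (?m + 1))" by simp
    also have "\<dots> \<le> e * 1"
    proof (rule mult_left_mono)
      show "?m / (?m + 1) \<le> 1" using m by (subst divide_le_eq_1_pos) linarith+
    qed (use \<open>e > 0\<close> in simp)
    finally show "\<bar>(\<integral>v. f v \<partial>M) - (\<integral>v. f v \<partial>N)\<bar> \<le> 0 + e" by simp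
  qed
  then show "(\<integral>v. f v \<partial>M) = (\<integral>v. f v \<partial>N)" by simp
qed

section \<open>Encoding of networks in the unit cube\<close>

lemma expm_of_nat_mult: "expm (of_nat n * y) = expm y ^ n"
  by (induction n) (auto simp: expm_add distrib_right)

lemma expm_sum: "expm (\<Sum>i\<in>I. f i) = (\<Prod>i\<in>I. expm (f i))"
  by (induction I rule: infinite_finite_induct) (auto simp: expm_add)

text \<open>Left inverse of \<open>expm\<close>; the value at 0 recovers the infinite entries of a
  network.\<close>

definition lnm :: "real \<Rightarrow> ennreal" where
  "lnm t = (if t \<le> 0 then \<top> else ennreal (- ln t))"

lemma lnm_expm: "lnm (expm y) = y"
  by (cases y) (auto simp: lnm_def expm_def)

lemma measurable_lnm [measurable]: "lnm \<in> borel_measurable borel"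
  unfolding lnm_def by measurable

text \<open>The network is encoded injectively, by \<open>expm\<close> in each coordinate, as a point of the unit cube.\<close>

definition encode :: "('a::finite \<Rightarrow> 'a \<Rightarrow> real) \<Rightarrow> 'a network \<Rightarrow> real ^ ('a + 'a \<times> 'a)" where
  "encode C \<eta> = (\<chi> i. case i of Inl x \<Rightarrow> expm (fst \<eta> x)
     | Inr e \<Rightarrow> if e \<in> edge_pairs C then expm (snd \<eta> e) else 1)"

definition decode :: "('a::finite \<Rightarrow> 'a \<Rightarrow> real) \<Rightarrow> real ^ ('a + 'a \<times> 'a) \<Rightarrow> 'a network" where
  "decode C v = (\<lambda>x. lnm (v $ Inl x), \<lambda>e\<in>edge_pairs C. lnm (v $ Inr e))"

lemma decode_encode: "\<eta> \<in> space (network_space C) \<Longrightarrow> decode C (encode C \<eta>) = \<eta>"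
  by (cases \<eta>) (auto simp: decode_def encode_def lnm_expm network_space_def space_pair_measure space_PiM
      fun_eq_iff PiE_def extensional_def)

lemma measurable_encode: "encode C \<in> measurable (network_space C) borel"
proof -
  have 1: "(\<lambda>\<eta>. fst \<eta> x) \<in> borel_measurable (network_space C)" for x
    unfolding network_space_def by measurable
  have 2: "(\<lambda>\<eta>. snd \<eta> e) \<in> borel_measurable (network_space C)" if "e \<in> edge_pairs C" for e
    unfolding network_space_def
    by (rule measurable_compose[OF measurable_snd measurable_component_singleton[OF that]])
  have "(\<lambda>\<eta>. encode C \<eta> $ i) \<in> borel_measurable (network_space C)" for i
  proof (cases i)
    case (Inl x)
    then show ?thesis using measurable_compose[OF 1 measurable_expm] by (simp add: encode_def)
  next
    case (Inr e)
    then show ?thesis using measurable_compose[OF 2 measurable_expm, of e]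
      by (cases "e \<in> edge_pairs C") (auto simp: encode_def)
  qed
  then have "(\<lambda>\<eta>. encode C \<eta> \<bullet> b) \<in> borel_measurable (network_space C)" if "b \<in> Basis" for b
    using that by (auto simp: Basis_vec_def inner_axis)
  then show ?thesis by (subst borel_measurable_euclidean_space) auto
qed

lemma measurable_decode: "decode C \<in> measurable borel (network_space C)"
  unfolding decode_def network_space_def
proof (intro measurable_Pair)
  show "(\<lambda>v x. lnm (v $ Inl x)) \<in> measurable borel (\<Pi>\<^sub>M x\<in>UNIV. borel)"
    by (rule measurable_PiM_single') auto
  show "(\<lambda>v. \<lambda>e\<in>edge_pairs C. lnm (v $ Inr e)) \<in> measurable borel (\<Pi>\<^sub>M e\<in>edge_pairs C. borel)"
    by (rule measurable_restrict) auto
qed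

definition laplace :: "('a::finite \<Rightarrow> 'a \<Rightarrow> real) \<Rightarrow> ('a \<Rightarrow> nat) \<Rightarrow> ('a \<times> 'a \<Rightarrow> nat) \<Rightarrow> 'a network \<Rightarrow> real" where
  "laplace C k m \<eta> = expm ((\<Sum>x\<in>UNIV. of_nat (k x) * fst \<eta> x) + (\<Sum>e\<in>edge_pairs C. of_nat (m e) * snd \<eta> e))"

lemma monomial_encode:
  "(\<Prod>i\<in>UNIV. (encode C \<eta> $ i) ^ n i) = laplace C (n \<circ> Inl) (n \<circ> Inr) \<eta>"
proof -
  have "(\<Prod>i\<in>UNIV. (encode C \<eta> $ i) ^ n i) =
    (\<Prod>i\<in>range Inl. (encode C \<eta> $ i) ^ n i) * (\<Prod>i\<in>range Inr. (encode C \<eta> $ i) ^ n i)"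
    by (subst prod.union_disjoint[symmetric]) (auto simp: UNIV_sum)
  also have "\<dots> = (\<Prod>x\<in>UNIV. expm (fst \<eta> x) ^ n (Inl x)) *
    (\<Prod>e\<in>UNIV. (if e \<in> edge_pairs C then expm (snd \<eta> e) else 1) ^ n (Inr e))"
    by (simp add: prod.reindex encode_def)
  also have "(\<Prod>e\<in>UNIV. (if e \<in> edge_pairs C then expm (snd \<eta> e) else 1) ^ n (Inr e)) =
    (\<Prod>e\<in>edge_pairs C. expm (snd \<eta> e) ^ n (Inr e))"
    by (rule prod.mono_neutral_cong_right) auto
  finally show ?thesis by (simp add: laplace_def expm_add expm_sum expm_of_nat_mult)
qed

text \<open>\<open>decode\<close> is a measurable left inverse of \<open>encode\<close>, so a law is
  determined by its image in the cube, and there the transforms at natural parameters are the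
  moments.\<close>

lemma network_measure_eqI:
  fixes M N :: "'a::finite network measure"
  assumes fin: "finite_measure M" "finite_measure N"
    and sets: "sets M = sets (network_space C)" "sets N = sets (network_space C)"
    and eq: "\<And>k m. (\<integral>\<^sup>+\<eta>. ennreal (laplace C k m \<eta>) \<partial>M) = (\<integral>\<^sup>+\<eta>. ennreal (laplace C k m \<eta>) \<partial>N)"
  shows "M = N"
proof -
  have rec: "distr (distr L borel (encode C)) (network_space C) (decode C) = L"
    if L: "sets L = sets (network_space C)" for L
  proof -
    have e: "encode C \<in> measurable L borel"
      using measurable_encode L by (simp cong: measurable_cong_sets)
    have "distr (distr L borel (encode C)) (network_space C) (decode C) = distr L (network_space C) (decode C \<circ> encode C)"
      using e by (intro distr_distr) (auto intro: measurable_decode)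
    also have "\<dots> = distr L L (\<lambda>x. x)"
      using decode_encode sets_eq_imp_space_eq[OF L] by (intro distr_cong) (auto simp: L)
    finally show ?thesis by simp
  qed
  have "distr M borel (encode C) = distr N borel (encode C)"
  proof (rule finite_measure_eqI_moments)
    have e: "encode C \<in> measurable L borel" if "sets L = sets (network_space C)" for L
      using measurable_encode that by (simp cong: measurable_cong_sets)
    note eM = e[OF sets(1)] and eN = e[OF sets(2)]
    show "finite_measure (distr M borel (encode C))" "finite_measure (distr N borel (encode C))"
      using fin eM eN by (auto intro: finite_measure.finite_measure_distr)
    have b: "0 \<le> encode C \<eta> $ i \<and> encode C \<eta> $ i \<le> 1" for \<eta> i
      by (auto simp: encode_def expm_le_1 split: sum.split)
    show "AE v in distr M borel (encode C). \<forall>i. 0 \<le> v $ i \<and> v $ i \<le> 1"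
      by (subst AE_distr_iff[OF eM]) (use b in auto)
    show "AE v in distr N borel (encode C). \<forall>i. 0 \<le> v $ i \<and> v $ i \<le> 1"
      by (subst AE_distr_iff[OF eN]) (use b in auto)
    fix n :: "'a + 'a \<times> 'a \<Rightarrow> nat"
    have "(\<lambda>v :: real ^ _. 1 * (\<Prod>i\<in>UNIV. (v $ i) ^ n i)) \<in> borel_measurable borel"
      by (rule borel_measurable_continuous_onI[OF continuous_on_monomial_span[OF monomial_span.monomial]])
    then have p: "(\<lambda>v :: real ^ _. \<Prod>i\<in>UNIV. (v $ i) ^ n i) \<in> borel_measurable borel"
      by (simp only: mult_1_left)
    have "(\<integral>v. (\<Prod>i\<in>UNIV. (v $ i) ^ n i) \<partial>distr L borel (encode C)) =
      enn2real (\<integral>\<^sup>+\<eta>. ennreal (laplace C (n \<circ> Inl) (n \<circ> Inr) \<eta>) \<partial>L)" if L: "encode C \<in> measurable L borel" for L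
    proof -
      have "(\<integral>v. (\<Prod>i\<in>UNIV. (v $ i) ^ n i) \<partial>distr L borel (encode C)) = (\<integral>\<eta>. laplace C (n \<circ> Inl) (n \<circ> Inr) \<eta> \<partial>L)"
        by (subst integral_distr[OF L p]) (simp only: monomial_encode)
      also have "\<dots> = enn2real (\<integral>\<^sup>+\<eta>. ennreal (laplace C (n \<circ> Inl) (n \<circ> Inr) \<eta>) \<partial>L)"
        using measurable_compose[OF L p] by (intro integral_eq_nn_integral) (auto simp: monomial_encode laplace_def)
      finally show ?thesis .
    qed
    then show "(\<integral>v. (\<Prod>i\<in>UNIV. (v $ i) ^ n i) \<partial>distr M borel (encode C)) =
      (\<integral>v. (\<Prod>i\<in>UNIV. (v $ i) ^ n i) \<partial>distr N borel (encode C))"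
      using eM eN eq by simp
  qed simp_all
  then show ?thesis using rec[OF sets(1)] rec[OF sets(2)] by metis
qed

section \<open>Laplace functional of a Poisson point process\<close>

lemma expm_antimono: "a \<le> b \<Longrightarrow> expm b \<le> expm a"
  by (cases "b = \<top>")
    (auto simp: expm_def top_unique less_top[symmetric] intro: enn2real_mono)

text \<open>An infinite supremum is treated apart, since \<open>enn2real\<close> is not continuous
  there; below a finite supremum all terms are finite.\<close>

lemma tendsto_expm_SUP:
  assumes "incseq y"
  shows "(\<lambda>i::nat. expm (y i)) \<longlonglongrightarrow> expm (SUP i. y i)"
proof (cases "(SUP i. y i) = \<top>")
  case True
  have lim: "y \<longlonglongrightarrow> \<top>" using LIMSEQ_SUP[OF assms] by (simp only: True)
  have "(\<lambda>i. expm (y i)) \<longlonglongrightarrow> 0"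
  proof (rule tendstoI)
    fix e :: real assume "e > 0"
    define c where "c = max 0 (1 - ln e)"
    have "exp (- c) \<le> exp (ln e - 1)" by (simp add: c_def)
    also have "\<dots> < exp (ln e)" by simp
    also have "\<dots> = e" using \<open>e > 0\<close> by simp
    finally have c: "exp (- c) < e" .
    have "eventually (\<lambda>i. y i > ennreal c) sequentially"
      by (rule order_tendstoD(1)[OF lim]) simp
    then show "eventually (\<lambda>i. dist (expm (y i)) 0 < e) sequentially"
    proof eventually_elim
      case (elim i)
      then have "expm (y i) \<le> expm (ennreal c)" by (intro expm_antimono) simp
      moreover have "expm (ennreal c) = exp (- c)" by (rule expm_ennreal) (simp add: c_def)
      ultimately show ?case using c by simp
    qed
  qed
  then show ?thesis by (simp only: True expm_top)
next
  case False
  have fin: "y i \<noteq> \<top>" for i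
  proof (rule notI)
    assume "y i = \<top>"
    then have "\<top> \<le> (SUP i. y i)" by (metis SUP_upper UNIV_I)
    then show False using False by (simp only: top_unique)
  qed
  obtain r where r: "(SUP i. y i) = ennreal r" "r \<ge> 0" using False by (cases "SUP i. y i") (simp, simp only:)
  have "y \<longlonglongrightarrow> ennreal r" using LIMSEQ_SUP[OF assms] by (simp only: r)
  then have "(\<lambda>i. enn2real (y i)) \<longlonglongrightarrow> r" using r(2) by (rule tendsto_enn2real)
  then have "(\<lambda>i. exp (- enn2real (y i))) \<longlonglongrightarrow> exp (- r)" by (intro tendsto_exp tendsto_minus)
  then show ?thesis using fin by (simp add: expm_def r)
qed

lemma nn_integral_indicator_count_space:
  "(\<integral>\<^sup>+l. indicator A l \<partial>count_space B) = emeasure (count_space UNIV) (B \<inter> A)"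
proof -
  have "(\<integral>\<^sup>+l. indicator A l \<partial>count_space B) = (\<integral>\<^sup>+l. indicator A l * indicator B l \<partial>count_space UNIV)"
    by (cases "B = UNIV") (simp_all add: nn_integral_count_space_indicator)
  also have "\<dots> = (\<integral>\<^sup>+l. indicator (B \<inter> A) l \<partial>count_space UNIV)"
    by (intro nn_integral_cong) (auto simp: indicator_def)
  finally show ?thesis by simp
qed

context
  fixes N :: "'v measure" and \<mu> :: "'b measure" and \<Lambda> :: "'v \<Rightarrow> 'b set"
  assumes ppp: "poisson_point_process N \<mu> \<Lambda>"
begin

abbreviation "points A \<omega> \<equiv> emeasure (count_space UNIV) (\<Lambda> \<omega> \<inter> A)"

lemma
  shows ppp_prob: "prob_space N"
    and ppp_subset: "\<omega> \<in> space N \<Longrightarrow> \<Lambda> \<omega> \<subseteq> space \<mu>"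
    and ppp_measurable: "A \<in> sets \<mu> \<Longrightarrow> points A \<in> borel_measurable N"
    and ppp_finite: "A \<in> sets \<mu> \<Longrightarrow> emeasure \<mu> A < \<infinity> \<Longrightarrow>
      measure N {\<omega> \<in> space N. points A \<omega> = of_nat j} = exp (- measure \<mu> A) * measure \<mu> A ^ j / fact j"
    and ppp_infinite: "A \<in> sets \<mu> \<Longrightarrow> emeasure \<mu> A = \<infinity> \<Longrightarrow> AE \<omega> in N. points A \<omega> = \<infinity>"
    and ppp_indep: "(\<And>i. i < (n :: nat) \<Longrightarrow> B i \<in> sets \<mu>) \<Longrightarrow> disjoint_family_on B {..<n} \<Longrightarrow>
      prob_space.indep_vars N (\<lambda>_. borel) (\<lambda>i. points (B i)) {..<n}"
proof -
  note * = ppp[unfolded poisson_point_process_def Let_def]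
  show "prob_space N" by (rule *[THEN conjunct1])
  note * = *[THEN conjunct2]
  show "\<omega> \<in> space N \<Longrightarrow> \<Lambda> \<omega> \<subseteq> space \<mu>"
    by (rule *[THEN conjunct1, rule_format])
  note * = *[THEN conjunct2]
  show "A \<in> sets \<mu> \<Longrightarrow> points A \<in> borel_measurable N"
    by (rule *[THEN conjunct1, rule_format])
  note * = *[THEN conjunct2]
  show "A \<in> sets \<mu> \<Longrightarrow> emeasure \<mu> A < \<infinity> \<Longrightarrow>
      measure N {\<omega> \<in> space N. points A \<omega> = of_nat j} = exp (- measure \<mu> A) * measure \<mu> A ^ j / fact j"
    by (rule *[THEN conjunct1, rule_format])
  note * = *[THEN conjunct2]
  show "A \<in> sets \<mu> \<Longrightarrow> emeasure \<mu> A = \<infinity> \<Longrightarrow> AE \<omega> in N. points A \<omega> = \<infinity>"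
    by (rule *[THEN conjunct1, rule_format])
  note * = *[THEN conjunct2]
  show "(\<And>i. i < n \<Longrightarrow> B i \<in> sets \<mu>) \<Longrightarrow> disjoint_family_on B {..<n} \<Longrightarrow>
      prob_space.indep_vars N (\<lambda>_. borel) (\<lambda>i. points (B i)) {..<n}"
    using *[THEN spec[of _ n], THEN spec[of _ B], THEN mp] by simp
qed

text \<open>The generating function of a Poisson variable at \<open>expm v\<close>. For infinite
  intensity both sides are 1 or 0, according to whether \<open>v\<close> vanishes.\<close>

lemma laplace_points:
  assumes A: "A \<in> sets \<mu>"
  shows "(\<integral>\<^sup>+\<omega>. ennreal (expm (v * points A \<omega>)) \<partial>N) = ennreal (expm (ennreal (1 - expm v) * emeasure \<mu> A))"
proof -
  interpret prob_space N by (rule ppp_prob)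
  have [measurable]: "points A \<in> borel_measurable N" by (rule ppp_measurable[OF A])
  show ?thesis
  proof (cases "emeasure \<mu> A = \<infinity>")
    case True
    have v1: "v = 0 \<longleftrightarrow> expm v = 1"
      by (cases v) (auto simp: expm_def)
    have "(\<integral>\<^sup>+\<omega>. ennreal (expm (v * points A \<omega>)) \<partial>N) = (\<integral>\<^sup>+\<omega>. ennreal (expm (v * \<top>)) \<partial>N)"
      by (rule nn_integral_cong_AE) (use ppp_infinite[OF A True] in \<open>eventually_elim, simp\<close>)
    also have "\<dots> = ennreal (expm (v * \<top>))" by (simp add: emeasure_space_1)
    also have "expm (v * \<top>) = expm (ennreal (1 - expm v) * \<top>)"
      using v1 expm_le_1[of v] by (cases "v = 0") (auto simp: ennreal_mult_top)
    finally show ?thesis using True by simp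
  next
    case False
    define a where "a = measure \<mu> A"
    have a: "emeasure \<mu> A = ennreal a" "a \<ge> 0"
      using False by (auto simp: a_def emeasure_eq_ennreal_measure)
    let ?E = "\<lambda>j. {\<omega> \<in> space N. points A \<omega> = of_nat j}"
    let ?p = "\<lambda>j. exp (- a) * a ^ j / fact j"
    have p: "measure N (?E j) = ?p j" for j
      using ppp_finite[OF A, of j] False by (simp add: a_def less_top)
    have Em[measurable]: "?E j \<in> sets N" for j by measurable
    have sums: "(\<lambda>j. c ^ j * ?p j) sums exp (- (a * (1 - c)))" for c :: real
    proof -
      have "(\<lambda>j. (c * a) ^ j /\<^sub>R fact j) sums exp (c * a)" by (rule exp_converges)
      from sums_mult[OF this, of "exp (- a)"]
      have "(\<lambda>j. c ^ j * ?p j) sums (exp (- a) * exp (c * a))"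
        by (simp add: power_mult_distrib divide_inverse mult_ac)
      then show ?thesis by (simp add: exp_add[symmetric] algebra_simps)
    qed
    have disj: "disjoint_family ?E" by (auto simp: disjoint_family_on_def)
    \<comment> \<open>The Poisson weights add up to 1, so the count is almost surely a finite
      number.\<close>
    have "emeasure N (\<Union>j. ?E j) = (\<Sum>j. ennreal (?p j))"
      using disj by (subst suminf_emeasure[symmetric]) (auto simp: emeasure_eq_measure p)
    also have "\<dots> = ennreal (exp (- (a * (1 - 1))))"
      using sums[of 1] a by (intro suminf_ennreal_eq) auto
    finally have "emeasure N (\<Union>j. ?E j) = 1" by simp
    then have "AE \<omega> in N. \<omega> \<in> (\<Union>j. ?E j)"
      by (intro AE_prob_1) (simp add: emeasure_eq_measure)
    then have "(\<integral>\<^sup>+\<omega>. ennreal (expm (v * points A \<omega>)) \<partial>N) =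
      (\<integral>\<^sup>+\<omega>. (\<Sum>j. ennreal (expm v ^ j) * indicator (?E j) \<omega>) \<partial>N)"
    proof (intro nn_integral_cong_AE, eventually_elim)
      fix \<omega> assume "\<omega> \<in> (\<Union>j. ?E j)"
      then obtain j where j: "\<omega> \<in> space N" "points A \<omega> = of_nat j" by auto
      have "(\<Sum>i. ennreal (expm v ^ i) * indicator (?E i) \<omega>) = (\<Sum>i\<in>{j}. ennreal (expm v ^ i) * indicator (?E i) \<omega>)"
        by (rule suminf_finite) (use j in auto)
      then show "ennreal (expm (v * points A \<omega>)) = (\<Sum>j. ennreal (expm v ^ j) * indicator (?E j) \<omega>)"
        using j by (simp add: expm_of_nat_mult mult.commute[of v])
    qed
    also have "\<dots> = (\<Sum>j. ennreal (expm v ^ j) * ennreal (?p j))"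
      by (subst nn_integral_suminf) (simp_all add: nn_integral_cmult emeasure_eq_measure p)
    also have "\<dots> = (\<Sum>j. ennreal (expm v ^ j * ?p j))"
      using a by (intro arg_cong[of _ _ suminf] ext ennreal_mult[symmetric]) auto
    also have "\<dots> = ennreal (exp (- (a * (1 - expm v))))"
      using sums a by (intro suminf_ennreal_eq) auto
    also have "exp (- (a * (1 - expm v))) = expm (ennreal (1 - expm v) * emeasure \<mu> A)"
      using a expm_le_1[of v] by (simp add: ennreal_mult[symmetric] expm_ennreal mult.commute)
    finally show ?thesis .
  qed
qed

text \<open>The level sets of \<open>\<phi>\<close> are disjoint, so their counts are independent
  and the transform factorises over the values of \<open>\<phi>\<close>.\<close>

lemma laplace_functional_simple:
  assumes \<phi>: "simple_function \<mu> (\<phi> :: 'b \<Rightarrow> ennreal)"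
  shows "(\<lambda>\<omega>. \<integral>\<^sup>+l. \<phi> l \<partial>count_space (\<Lambda> \<omega>)) \<in> borel_measurable N"
    and "(\<integral>\<^sup>+\<omega>. ennreal (expm (\<integral>\<^sup>+l. \<phi> l \<partial>count_space (\<Lambda> \<omega>))) \<partial>N) =
      ennreal (expm (\<integral>\<^sup>+l. ennreal (1 - expm (\<phi> l)) \<partial>\<mu>))"
proof -
  interpret prob_space N by (rule ppp_prob)
  obtain v :: "nat \<Rightarrow> ennreal" and n where v: "bij_betw v {..<n} (\<phi> ` space \<mu>)"
    using ex_bij_betw_nat_finite[OF simple_functionD(1)[OF \<phi>]] by (auto simp: atLeast0LessThan)
  define B where "B i = \<phi> -` {v i} \<inter> space \<mu>" for i
  have B: "B i \<in> sets \<mu>" for i unfolding B_def by (rule simple_functionD(2)[OF \<phi>])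
  have disj: "disjoint_family_on B {..<n}"
    using v by (auto simp: disjoint_family_on_def B_def bij_betw_def inj_on_def)
  have dec: "g (\<phi> l) = (\<Sum>i<n. g (v i) * indicator (B i) l)" if "l \<in> space \<mu>" for l and g :: "ennreal \<Rightarrow> ennreal"
  proof -
    have "\<phi> l \<in> v ` {..<n}" using v that by (simp add: bij_betw_def)
    then obtain i where i: "i < n" "\<phi> l = v i" by auto
    have "l \<in> B j \<longleftrightarrow> j = i" if "j < n" for j
      using i that \<open>l \<in> space \<mu>\<close> bij_betw_imp_inj_on[OF v] by (auto simp: B_def inj_on_def)
    then have "(\<Sum>j<n. g (v j) * indicator (B j) l) = (\<Sum>j\<in>{i}. g (v j) * indicator (B j) l)"
      using i by (intro sum.mono_neutral_right) auto
    then show ?thesis using i that by (simp add: B_def)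
  qed
  have S: "(\<integral>\<^sup>+l. \<phi> l \<partial>count_space (\<Lambda> \<omega>)) = (\<Sum>i<n. v i * points (B i) \<omega>)" if "\<omega> \<in> space N" for \<omega>
  proof -
    have "(\<integral>\<^sup>+l. \<phi> l \<partial>count_space (\<Lambda> \<omega>)) = (\<integral>\<^sup>+l. (\<Sum>i<n. v i * indicator (B i) l) \<partial>count_space (\<Lambda> \<omega>))"
      using ppp_subset[OF that] dec[of _ "\<lambda>x. x"] by (intro nn_integral_cong) auto
    also have "\<dots> = (\<Sum>i<n. v i * points (B i) \<omega>)"
      by (subst nn_integral_sum) (auto simp: nn_integral_cmult nn_integral_indicator_count_space)
    finally show ?thesis .
  qed
  note [measurable] = ppp_measurable[OF B]
  have "(\<lambda>\<omega>. \<Sum>i<n. v i * points (B i) \<omega>) \<in> borel_measurable N" by measurable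
  then show "(\<lambda>\<omega>. \<integral>\<^sup>+l. \<phi> l \<partial>count_space (\<Lambda> \<omega>)) \<in> borel_measurable N"
    by (subst measurable_cong[OF S]) auto
  have "(\<integral>\<^sup>+\<omega>. ennreal (expm (\<integral>\<^sup>+l. \<phi> l \<partial>count_space (\<Lambda> \<omega>))) \<partial>N) =
    (\<integral>\<^sup>+\<omega>. (\<Prod>i<n. ennreal (expm (v i * points (B i) \<omega>))) \<partial>N)"
    by (intro nn_integral_cong) (simp add: S expm_sum prod_ennreal)
  also have "\<dots> = (\<Prod>i<n. \<integral>\<^sup>+\<omega>. ennreal (expm (v i * points (B i) \<omega>)) \<partial>N)"
  proof (rule indep_vars_nn_integral)
    have "indep_vars (\<lambda>_. borel) (\<lambda>i. points (B i)) {..<n}"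
      by (rule ppp_indep[OF B disj])
    then show "indep_vars (\<lambda>_. borel) (\<lambda>i \<omega>. ennreal (expm (v i * points (B i) \<omega>))) {..<n}"
      by (rule indep_vars_compose2[where X = "\<lambda>i. points (B i)" and Y = "\<lambda>i y. ennreal (expm (v i * y))"]) auto
  qed auto
  also have "\<dots> = ennreal (\<Prod>i<n. expm (ennreal (1 - expm (v i)) * emeasure \<mu> (B i)))"
    by (simp add: laplace_points[OF B] prod_ennreal)
  also have "(\<Prod>i<n. expm (ennreal (1 - expm (v i)) * emeasure \<mu> (B i))) =
    expm (\<Sum>i<n. ennreal (1 - expm (v i)) * emeasure \<mu> (B i))"
    by (simp add: expm_sum)
  also have "(\<Sum>i<n. ennreal (1 - expm (v i)) * emeasure \<mu> (B i)) = (\<integral>\<^sup>+l. (\<Sum>i<n. ennreal (1 - expm (v i)) * indicator (B i) l) \<partial>\<mu>)"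
    using B by (subst nn_integral_sum) (auto simp: nn_integral_cmult_indicator)
  also have "\<dots> = (\<integral>\<^sup>+l. ennreal (1 - expm (\<phi> l)) \<partial>\<mu>)"
    using dec[of _ "\<lambda>y. ennreal (1 - expm y)"] by (intro nn_integral_cong) simp
  finally show "(\<integral>\<^sup>+\<omega>. ennreal (expm (\<integral>\<^sup>+l. \<phi> l \<partial>count_space (\<Lambda> \<omega>))) \<partial>N) =
      ennreal (expm (\<integral>\<^sup>+l. ennreal (1 - expm (\<phi> l)) \<partial>\<mu>))" .
qed

text \<open>Approximation from below by simple functions: the transforms converge because they are
  dominated by 1, the exponents by monotone convergence, which also covers an infinite
  intensity.\<close>

theorem laplace_functional:
  assumes \<phi>: "\<phi> \<in> borel_measurable \<mu>"
  shows "(\<lambda>\<omega>. \<integral>\<^sup>+l. \<phi> l \<partial>count_space (\<Lambda> \<omega>)) \<in> borel_measurable N"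
    and "(\<integral>\<^sup>+\<omega>. ennreal (expm (\<integral>\<^sup>+l. \<phi> l \<partial>count_space (\<Lambda> \<omega>))) \<partial>N) =
      ennreal (expm (\<integral>\<^sup>+l. ennreal (1 - expm (\<phi> l)) \<partial>\<mu>))"
proof -
  interpret prob_space N by (rule ppp_prob)
  obtain f :: "nat \<Rightarrow> 'b \<Rightarrow> ennreal" where f: "incseq f" "\<And>i. simple_function \<mu> (f i)" "\<And>l. (SUP i. f i l) = \<phi> l"
    using borel_measurable_implies_simple_function_sequence'[OF \<phi>] by metis
  have inc: "incseq (\<lambda>i. f i l)" for l using f(1) by (auto simp: incseq_def le_fun_def)
  let ?S = "\<lambda>i \<omega>. \<integral>\<^sup>+l. f i l \<partial>count_space (\<Lambda> \<omega>)"
  have S: "(\<integral>\<^sup>+l. \<phi> l \<partial>count_space (\<Lambda> \<omega>)) = (SUP i. ?S i \<omega>)" for \<omega>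
    unfolding f(3)[symmetric] by (rule nn_integral_monotone_convergence_SUP) (use f(1) in auto)
  have incS: "incseq (\<lambda>i. ?S i \<omega>)" for \<omega>
    using f(1) by (auto simp: incseq_def le_fun_def intro!: nn_integral_mono)
  note m[measurable] = laplace_functional_simple(1)[OF f(2)]
  show M[measurable]: "(\<lambda>\<omega>. \<integral>\<^sup>+l. \<phi> l \<partial>count_space (\<Lambda> \<omega>)) \<in> borel_measurable N"
    unfolding S by measurable
  have fm[measurable]: "f i \<in> borel_measurable \<mu>" for i
    using f(2) by (rule borel_measurable_simple_function)
  have l1: "(\<lambda>i. \<integral>\<^sup>+\<omega>. ennreal (expm (?S i \<omega>)) \<partial>N) \<longlonglongrightarrow>
    (\<integral>\<^sup>+\<omega>. ennreal (expm (\<integral>\<^sup>+l. \<phi> l \<partial>count_space (\<Lambda> \<omega>))) \<partial>N)"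
  proof (rule nn_integral_dominated_convergence[where w = "\<lambda>_. 1"])
    show "AE \<omega> in N. (\<lambda>i. ennreal (expm (?S i \<omega>))) \<longlonglongrightarrow> ennreal (expm (\<integral>\<^sup>+l. \<phi> l \<partial>count_space (\<Lambda> \<omega>)))"
      unfolding S by (intro AE_I2 tendsto_ennrealI tendsto_expm_SUP incS)
    show "(\<integral>\<^sup>+\<omega>. 1 \<partial>N) < \<infinity>" by (simp add: emeasure_space_1)
  qed (auto simp: ennreal_le_1 expm_le_1)
  let ?R = "\<lambda>i. \<integral>\<^sup>+l. ennreal (1 - expm (f i l)) \<partial>\<mu>"
  have inc1: "incseq (\<lambda>i l. ennreal (1 - expm (f i l)))"
    using f(1) by (auto simp: incseq_def le_fun_def intro!: ennreal_leI expm_antimono)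
  have "(SUP i. ennreal (1 - expm (f i l))) = ennreal (1 - expm (\<phi> l))" for l
  proof (rule LIMSEQ_unique)
    show "(\<lambda>i. ennreal (1 - expm (f i l))) \<longlonglongrightarrow> (SUP i. ennreal (1 - expm (f i l)))"
      using inc1 by (intro LIMSEQ_SUP) (auto simp: incseq_def le_fun_def)
    show "(\<lambda>i. ennreal (1 - expm (f i l))) \<longlonglongrightarrow> ennreal (1 - expm (\<phi> l))"
      unfolding f(3)[symmetric] by (intro tendsto_ennrealI tendsto_intros tendsto_expm_SUP inc)
  qed
  then have "(\<integral>\<^sup>+l. ennreal (1 - expm (\<phi> l)) \<partial>\<mu>) = (SUP i. ?R i)"
    using nn_integral_monotone_convergence_SUP[OF inc1] by simp
  moreover have "incseq ?R"
    using inc1 by (auto simp: incseq_def le_fun_def intro!: nn_integral_mono)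
  ultimately have "(\<lambda>i. ennreal (expm (?R i))) \<longlonglongrightarrow> ennreal (expm (\<integral>\<^sup>+l. ennreal (1 - expm (\<phi> l)) \<partial>\<mu>))"
    using tendsto_expm_SUP[of ?R] by (intro tendsto_ennrealI) simp
  then show "(\<integral>\<^sup>+\<omega>. ennreal (expm (\<integral>\<^sup>+l. \<phi> l \<partial>count_space (\<Lambda> \<omega>))) \<partial>N) =
      ennreal (expm (\<integral>\<^sup>+l. ennreal (1 - expm (\<phi> l)) \<partial>\<mu>))"
    using l1 unfolding laplace_functional_simple(2)[OF f(2)] by (rule LIMSEQ_unique[symmetric])
qed

end

section \<open>The intensity measure of the loops\<close>

text \<open>Logarithmic differentiation: the integrand is minus the derivative in \<open>u\<close>
  of the product of the 1 / \<open>(b v + u)\<close>, which tends to 0 because \<open>p\<close> is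
  not empty.\<close>

lemma nn_integral_sum_prod_inverse:
  assumes "p \<noteq> []" "\<And>v. v \<in> set p \<Longrightarrow> b v > 0"
  shows "(\<integral>\<^sup>+u\<in>{0..}. ennreal ((\<Sum>v\<leftarrow>p. 1 / (b v + u)) * (\<Prod>v\<leftarrow>p. 1 / (b v + u))) \<partial>lborel) =
    ennreal (\<Prod>v\<leftarrow>p. 1 / b v)"
proof -
  let ?P = "\<lambda>p u. \<Prod>v\<leftarrow>p. 1 / (b v + u)" and ?S = "\<lambda>p u. \<Sum>v\<leftarrow>p. 1 / (b v + u)"
  have d: "DERIV (?P p) u :> - (?S p u * ?P p u)" if "\<And>v. v \<in> set p \<Longrightarrow> b v + u > 0" for p u
    using that
  proof (induction p)
    case (Cons v p)
    have v: "b v + u > 0" using Cons.prems[of v] by simp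
    then have 1: "DERIV (\<lambda>u. 1 / (b v + u)) u :> - (1 / (b v + u) * (1 / (b v + u)))"
      by (auto intro!: derivative_eq_intros simp: power2_eq_square)
    have 2: "DERIV (?P p) u :> - (?S p u * ?P p u)"
      by (rule Cons.IH) (use Cons.prems in auto)
    have 3: "- (1 / (b v + u) * (1 / (b v + u))) * ?P p u + - (?S p u * ?P p u) * (1 / (b v + u)) =
      - (?S (v # p) u * ?P (v # p) u)"
      by (simp add: algebra_simps)
    have "DERIV (\<lambda>u. 1 / (b v + u) * ?P p u) u :>
      - (1 / (b v + u) * (1 / (b v + u))) * ?P p u + - (?S p u * ?P p u) * (1 / (b v + u))"
      by (rule DERIV_mult[OF 1 2])
    then show ?case unfolding 3 by simp
  qed simp
  have l: "(?P p \<longlongrightarrow> of_bool (p = [])) at_top" for p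
  proof (induction p)
    case (Cons v p)
    have "((\<lambda>u. 1 / (b v + u)) \<longlongrightarrow> 0) at_top"
      by (rule tendsto_divide_0[OF tendsto_const filterlim_at_top_imp_at_infinity])
        (rule filterlim_tendsto_add_at_top[OF tendsto_const filterlim_ident])
    from tendsto_mult[OF this Cons.IH] show ?case by simp
  qed simp
  have pos: "b v + u > 0" if "v \<in> set p" "0 \<le> u" for v u
    using assms(2)[OF that(1)] that(2) by simp
  have "(\<integral>\<^sup>+u. ennreal (?S p u * ?P p u) * indicator {0..} u \<partial>lborel) = 0 - (- ?P p 0)"
  proof (rule nn_integral_FTC_atLeast)
    show "(\<lambda>u. ?S p u * ?P p u) \<in> borel_measurable borel"
    proof (intro borel_measurable_times)
      show "?S p \<in> borel_measurable borel" by (induction p) auto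
      show "?P p \<in> borel_measurable borel" by (induction p) auto
    qed
    show "((\<lambda>u. - ?P p u) \<longlongrightarrow> 0) at_top" using tendsto_minus[OF l[of p]] assms(1) by simp
    fix u :: real assume u: "0 \<le> u"
    show "DERIV (\<lambda>u. - ?P p u) u :> ?S p u * ?P p u"
      using DERIV_minus[OF d[OF pos[OF _ u]]] by simp
    have "0 \<le> ?S p u" using pos[OF _ u] by (intro sum_list_nonneg) (auto intro: less_imp_le)
    moreover have "0 \<le> ?P p u" using pos[OF _ u]
      by (intro prod_list_nonneg) (auto intro: less_imp_le)
    ultimately show "0 \<le> ?S p u * ?P p u" by simp
  qed
  then show ?thesis by simp
qed

text \<open>A Frullani integral: the integrand is the integral of exp (- t v) over v in [1, 1 + c],
  and exchanging the order leaves the integral of 1 / v.\<close>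

lemma nn_integral_frullani:
  assumes "c \<ge> 0"
  shows "(\<integral>\<^sup>+t\<in>{0<..}. ennreal ((1 - exp (- (c * t))) * exp (- t) / t) \<partial>lborel) = ennreal (ln (1 + c))"
proof -
  have 1: "ennreal ((1 - exp (- (c * t))) * exp (- t) / t) = (\<integral>\<^sup>+v. ennreal (exp (- (t * v))) * indicator {1..1 + c} v \<partial>lborel)"
    if t: "t > 0" for t
  proof -
    have "(\<integral>\<^sup>+v. ennreal (exp (- (t * v))) * indicator {1..1 + c} v \<partial>lborel) =
      - (exp (- (t * (1 + c))) / t) - - (exp (- (t * 1)) / t)"
    proof (rule nn_integral_FTC_Icc)
      fix v show "DERIV (\<lambda>v. - (exp (- (t * v)) / t)) v :> exp (- (t * v))"
        using t by (auto intro!: derivative_eq_intros)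
    qed (use assms in auto)
    also have "- (exp (- (t * (1 + c))) / t) - - (exp (- (t * 1)) / t) = (1 - exp (- (c * t))) * exp (- t) / t"
      by (simp add: algebra_simps exp_add[symmetric] diff_divide_distrib)
    finally show ?thesis by simp
  qed
  have 2: "(\<integral>\<^sup>+t\<in>{0<..}. ennreal (exp (- (t * v))) \<partial>lborel) = ennreal (1 / v)" if "v > 0" for v
  proof -
    have "(\<integral>\<^sup>+t\<in>{0<..}. ennreal (exp (- (t * v))) \<partial>lborel) = (\<integral>\<^sup>+t\<in>{0..}. ennreal (exp (- (v * t))) \<partial>lborel)"
      by (rule nn_integral_cong_AE)
        (use AE_lborel_singleton[of 0] in \<open>eventually_elim, auto simp: mult.commute split: split_indicator\<close>)
    then show ?thesis using nn_integral_exp[OF that] by simp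
  qed
  have "(\<integral>\<^sup>+t\<in>{0<..}. ennreal ((1 - exp (- (c * t))) * exp (- t) / t) \<partial>lborel) =
    (\<integral>\<^sup>+t. \<integral>\<^sup>+v. ennreal (exp (- (t * v))) * indicator {1..1 + c} v * indicator {0<..} t \<partial>lborel \<partial>lborel)"
    by (intro nn_integral_cong) (auto simp: 1 nn_integral_multc split: split_indicator)
  also have "\<dots> = (\<integral>\<^sup>+v. \<integral>\<^sup>+t. ennreal (exp (- (t * v))) * indicator {1..1 + c} v * indicator {0<..} t \<partial>lborel \<partial>lborel)"
    by (rule lborel_pair.Fubini') measurable
  also have "\<dots> = (\<integral>\<^sup>+v. (\<integral>\<^sup>+t. ennreal (exp (- (t * v))) * indicator {0<..} t \<partial>lborel) * indicator {1..1 + c} v \<partial>lborel)"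
    by (intro nn_integral_cong, subst nn_integral_multc[symmetric]) (auto simp: mult_ac)
  also have "\<dots> = (\<integral>\<^sup>+v. ennreal (1 / v) * indicator {1..1 + c} v \<partial>lborel)"
    by (intro nn_integral_cong) (auto simp: 2 split: split_indicator)
  also have "\<dots> = ln (1 + c) - ln 1"
  proof (rule nn_integral_FTC_Icc)
    fix v :: real assume "v \<in> {1..1 + c}"
    then show "DERIV ln v :> 1 / v"
      by (auto intro!: derivative_eq_intros)
  qed (use assms in auto)
  finally show ?thesis by simp
qed

lemma nn_integral_exp_tail:
  "(\<integral>\<^sup>+s. ennreal (exp (- s)) * indicator {r..} s \<partial>lborel) = ennreal (exp (- r))"
proof -
  have "(\<integral>\<^sup>+s. ennreal (exp (- s)) * indicator {r..} s \<partial>lborel) = 0 - (- exp (- r))"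
  proof (rule nn_integral_FTC_atLeast)
    have "((\<lambda>s::real. exp (- s)) \<longlongrightarrow> 0) at_top"
      by (rule filterlim_compose[OF exp_at_bot filterlim_uminus_at_bot_at_top])
    from tendsto_minus[OF this] show "((\<lambda>s::real. - exp (- s)) \<longlongrightarrow> 0) at_top" by simp
    show "DERIV (\<lambda>s. - exp (- s)) s :> exp (- s)" for s :: real
      by (auto intro!: derivative_eq_intros)
  qed auto
  then show ?thesis by simp
qed

lemma measurable_holding_component: "(\<lambda>\<tau>. \<tau> i) \<in> borel_measurable holding_measure"
  by (subst measurable_cong_sets[OF sets_holding_measure refl]) (rule measurable_component_singleton, simp)

text \<open>The last, incomplete holding time of a path of duration \<open>t\<close> becomes, after integration over
  \<open>t\<close>, an exponential variable like the others.\<close>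

lemma nn_integral_path_holding:
  assumes g[measurable]: "\<And>i. g i \<in> borel_measurable borel"
  shows "(\<integral>\<^sup>+t\<in>{0<..}. (\<integral>\<^sup>+\<tau>. of_bool ((\<Sum>i<n. \<tau> i) \<le> t \<and> t < (\<Sum>i<Suc n. \<tau> i)) *
      ((\<Prod>i<n. g i (\<tau> i)) * g n (t - (\<Sum>i<n. \<tau> i))) \<partial>holding_measure) \<partial>lborel) =
    (\<Prod>i<Suc n. \<integral>\<^sup>+r. g i r \<partial>unit_exponential)"
proof -
  interpret h: prob_space holding_measure by (rule prob_space_holding_measure)
  interpret lh: pair_sigma_finite lborel holding_measure ..
  let ?S = "\<lambda>n \<tau>. \<Sum>i<n. \<tau> i :: real"
  let ?F = "\<lambda>t \<tau>. of_bool (?S n \<tau> \<le> t \<and> t < ?S (Suc n) \<tau>) * ((\<Prod>i<n. g i (\<tau> i)) * g n (t - ?S n \<tau>))"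
  let ?G = "\<lambda>s. \<integral>\<^sup>+r. of_bool (0 \<le> r \<and> r < s) * g n r \<partial>lborel"
  have F: "(\<lambda>(t, \<tau>). ?F t \<tau>) \<in> borel_measurable (lborel \<Otimes>\<^sub>M holding_measure)"
  proof -
    note [measurable] = measurable_holding_component
    show ?thesis unfolding of_bool_def by measurable
  qed
  have G[measurable]: "?G \<in> borel_measurable borel"
    unfolding of_bool_def by measurable
  have "(\<integral>\<^sup>+t\<in>{0<..}. (\<integral>\<^sup>+\<tau>. ?F t \<tau> \<partial>holding_measure) \<partial>lborel) = (\<integral>\<^sup>+t. (\<integral>\<^sup>+\<tau>. ?F t \<tau> \<partial>holding_measure) \<partial>lborel)"
  proof (rule nn_integral_cong_AE)
    have neg: "(\<integral>\<^sup>+\<tau>. ?F t \<tau> \<partial>holding_measure) = 0" if "t < 0" for t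
    proof -
      have "(\<integral>\<^sup>+\<tau>. ?F t \<tau> \<partial>holding_measure) = (\<integral>\<^sup>+\<tau>. 0 \<partial>holding_measure)"
      proof (rule nn_integral_cong_AE)
        show "AE \<tau> in holding_measure. ?F t \<tau> = 0"
          using AE_holding_pos
        proof eventually_elim
          case (elim \<tau>)
          then have "0 \<le> ?S n \<tau>" by (intro sum_nonneg) (auto intro: less_imp_le)
          then show ?case using that by auto
        qed
      qed
      then show ?thesis by simp
    qed
    show "AE t in lborel. (\<integral>\<^sup>+\<tau>. ?F t \<tau> \<partial>holding_measure) * indicator {0<..} t = (\<integral>\<^sup>+\<tau>. ?F t \<tau> \<partial>holding_measure)"
      using AE_lborel_singleton[of 0]
    proof eventually_elim
      case (elim t)
      then show ?case using neg[of t] by (cases "t < 0") (auto split: split_indicator)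
    qed
  qed
  also have "\<dots> = (\<integral>\<^sup>+\<tau>. \<integral>\<^sup>+t. ?F t \<tau> \<partial>lborel \<partial>holding_measure)"
    by (rule lh.Fubini'[OF F, symmetric])
  also have "\<dots> = (\<integral>\<^sup>+\<tau>. (\<Prod>i<n. g i (\<tau> i)) * ?G (\<tau> n) \<partial>holding_measure)"
  proof (rule nn_integral_cong)
    fix \<tau> :: "nat \<Rightarrow> real"
    have "(\<integral>\<^sup>+t. ?F t \<tau> \<partial>lborel) = (\<integral>\<^sup>+r. ?F (?S n \<tau> + 1 * r) \<tau> \<partial>lborel)"
      using nn_integral_real_affine[of "\<lambda>t. ?F t \<tau>" 1 "?S n \<tau>"] by (simp add: of_bool_def)
    \<comment> \<open>Here \<open>r\<close> is the elapsed part of the interrupted holding time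
      \<open>\<tau> n\<close>.\<close>
    also have "\<dots> = (\<integral>\<^sup>+r. (\<Prod>i<n. g i (\<tau> i)) * (of_bool (0 \<le> r \<and> r < \<tau> n) * g n r) \<partial>lborel)"
      by (intro nn_integral_cong) (auto simp: mult_ac)
    also have "\<dots> = (\<Prod>i<n. g i (\<tau> i)) * ?G (\<tau> n)"
      by (rule nn_integral_cmult) (simp add: of_bool_def)
    finally show "(\<integral>\<^sup>+t. ?F t \<tau> \<partial>lborel) = (\<Prod>i<n. g i (\<tau> i)) * ?G (\<tau> n)" .
  qed
  also have "\<dots> = (\<integral>\<^sup>+\<tau>. (\<Prod>i<Suc n. (if i < n then g i else ?G) (\<tau> i)) \<partial>holding_measure)"
    by (intro nn_integral_cong) simp
  also have "\<dots> = (\<Prod>i<Suc n. \<integral>\<^sup>+r. (if i < n then g i else ?G) r \<partial>unit_exponential)"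
    using G g by (intro nn_integral_holding_prod) auto
  also have "\<dots> = (\<Prod>i<n. \<integral>\<^sup>+r. g i r \<partial>unit_exponential) * (\<integral>\<^sup>+s. ?G s \<partial>unit_exponential)"
    by simp
  also have "(\<integral>\<^sup>+s. ?G s \<partial>unit_exponential) = (\<integral>\<^sup>+r. g n r \<partial>unit_exponential)"
  proof -
    \<comment> \<open>The probability exp (- r) that the interrupted holding time exceeds
      \<open>r\<close> is also the density of a unit exponential variable at
      \<open>r\<close>.\<close>
    have e: "(\<integral>\<^sup>+s. of_bool (r < s) * (ennreal (exp (- s)) * indicator {0..} s) \<partial>lborel) = ennreal (exp (- r))" if "r \<ge> 0" for r
    proof -
      have "(\<integral>\<^sup>+s. of_bool (r < s) * (ennreal (exp (- s)) * indicator {0..} s) \<partial>lborel) =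
        (\<integral>\<^sup>+s. ennreal (exp (- s)) * indicator {r..} s \<partial>lborel)"
      proof (rule nn_integral_cong_AE)
        show "AE s in lborel. of_bool (r < s) * (ennreal (exp (- s)) * indicator {0..} s) =
          ennreal (exp (- s)) * indicator {r..} s"
          using AE_lborel_singleton[of r]
          by eventually_elim (use that in \<open>auto split: split_indicator\<close>)
      qed
      also have "\<dots> = ennreal (exp (- r))" by (rule nn_integral_exp_tail)
      finally show ?thesis by simp
    qed
    have "(\<integral>\<^sup>+s. ?G s \<partial>unit_exponential) = (\<integral>\<^sup>+s. ?G s * (ennreal (exp (- s)) * indicator {0..} s) \<partial>lborel)"
      by (subst nn_integral_unit_exponential[OF G]) (simp add: mult.assoc)
    also have "\<dots> = (\<integral>\<^sup>+s. \<integral>\<^sup>+r. of_bool (0 \<le> r \<and> r < s) * g n r * (ennreal (exp (- s)) * indicator {0..} s) \<partial>lborel \<partial>lborel)"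
      by (intro nn_integral_cong nn_integral_multc[symmetric]) (simp add: of_bool_def)
    also have "\<dots> = (\<integral>\<^sup>+r. \<integral>\<^sup>+s. of_bool (0 \<le> r \<and> r < s) * g n r * (ennreal (exp (- s)) * indicator {0..} s) \<partial>lborel \<partial>lborel)"
      by (rule lborel_pair.Fubini') (unfold of_bool_def, measurable)
    also have "\<dots> = (\<integral>\<^sup>+r\<in>{0..}. g n r * ennreal (exp (- r)) \<partial>lborel)"
    proof (rule nn_integral_cong)
      fix r :: real
      have "(\<integral>\<^sup>+s. of_bool (0 \<le> r \<and> r < s) * g n r * (ennreal (exp (- s)) * indicator {0..} s) \<partial>lborel) =
        (\<integral>\<^sup>+s. (of_bool (0 \<le> r) * g n r) * (of_bool (r < s) * (ennreal (exp (- s)) * indicator {0..} s)) \<partial>lborel)"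
        by (intro nn_integral_cong) auto
      also have "\<dots> = (of_bool (0 \<le> r) * g n r) * (\<integral>\<^sup>+s. of_bool (r < s) * (ennreal (exp (- s)) * indicator {0..} s) \<partial>lborel)"
        by (rule nn_integral_cmult) (unfold of_bool_def, measurable)
      also have "\<dots> = g n r * ennreal (exp (- r)) * indicator {0..} r"
        using e[of r] by (cases "0 \<le> r") auto
      finally show "(\<integral>\<^sup>+s. of_bool (0 \<le> r \<and> r < s) * g n r * (ennreal (exp (- s)) * indicator {0..} s) \<partial>lborel) =
        g n r * ennreal (exp (- r)) * indicator {0..} r" .
    qed
    also have "\<dots> = (\<integral>\<^sup>+r. g n r \<partial>unit_exponential)"
      by (rule nn_integral_unit_exponential[OF g, symmetric])
    finally show ?thesis .
  qed
  finally show ?thesis by (simp add: mult.commute)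
qed

text \<open>Writing \<open>1 / t\<close> as the integral of \<open>exp (- u t)\<close> turns the integrand into a product over the
  holding times.\<close>

lemma nn_integral_path_holding_exp:
  fixes c :: "nat \<Rightarrow> real"
  assumes c: "\<And>i. c i \<ge> 0"
  shows "(\<integral>\<^sup>+t\<in>{0<..}. ennreal (1 / t) * (\<integral>\<^sup>+\<tau>. of_bool ((\<Sum>i<n. \<tau> i) \<le> t \<and> t < (\<Sum>i<Suc n. \<tau> i)) *
      ((\<Prod>i<n. ennreal (exp (- (c i * \<tau> i)))) * ennreal (exp (- (c n * (t - (\<Sum>i<n. \<tau> i)))))) \<partial>holding_measure) \<partial>lborel) =
    (\<integral>\<^sup>+u\<in>{0..}. (\<Prod>i<Suc n. ennreal (1 / (1 + c i + u))) \<partial>lborel)"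
proof -
  interpret h: prob_space holding_measure by (rule prob_space_holding_measure)
  let ?S = "\<lambda>n \<tau>. \<Sum>i<n. \<tau> i :: real"
  let ?B = "\<lambda>t \<tau>. of_bool (?S n \<tau> \<le> t \<and> t < ?S (Suc n) \<tau>) :: ennreal"
  let ?E = "\<lambda>c t \<tau>. (\<Prod>i<n. ennreal (exp (- (c i * \<tau> i)))) * ennreal (exp (- (c n * (t - ?S n \<tau>))))"
  let ?X = "\<lambda>c t. \<integral>\<^sup>+\<tau>. ?B t \<tau> * ?E c t \<tau> \<partial>holding_measure"
  note mh = measurable_holding_component
  have X[measurable]: "?X c \<in> borel_measurable lborel" for c
  proof -
    note [measurable] = mh
    show ?thesis unfolding of_bool_def by measurable
  qed
  \<comment> \<open>The holding times, with the interrupted one, add up to \<open>t\<close>, so the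
    factor exp (- t u) raises every rate by \<open>u\<close>.\<close>
  have shift: "ennreal (exp (- (t * u))) * ?X c t = ?X (\<lambda>i. c i + u) t" for t u
  proof -
    have e: "ennreal (exp (- (t * u))) * ?E c t \<tau> = ?E (\<lambda>i. c i + u) t \<tau>" for \<tau>
    proof -
      have "?E (\<lambda>i. c i + u) t \<tau> = (\<Prod>i<n. ennreal (exp (- (c i * \<tau> i))) * ennreal (exp (- (u * \<tau> i)))) *
        (ennreal (exp (- (c n * (t - ?S n \<tau>)))) * ennreal (exp (- (u * (t - ?S n \<tau>)))))"
        by (simp add: ennreal_mult[symmetric] exp_add[symmetric] algebra_simps)
      also have "\<dots> = ?E c t \<tau> * ((\<Prod>i<n. ennreal (exp (- (u * \<tau> i)))) * ennreal (exp (- (u * (t - ?S n \<tau>)))))"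
        by (simp add: prod.distrib mult_ac)
      also have "(\<Prod>i<n. ennreal (exp (- (u * \<tau> i)))) * ennreal (exp (- (u * (t - ?S n \<tau>)))) = ennreal (exp (- (t * u)))"
      proof -
        have "(\<Prod>i<n. ennreal (exp (- (u * \<tau> i)))) = ennreal (exp (- (u * ?S n \<tau>)))"
          by (simp add: prod_ennreal exp_sum[symmetric] sum_negf sum_distrib_left)
        then show ?thesis by (simp add: ennreal_mult[symmetric] exp_add[symmetric] algebra_simps)
      qed
      finally show ?thesis by (simp add: mult.commute)
    qed
    have "ennreal (exp (- (t * u))) * ?X c t = (\<integral>\<^sup>+\<tau>. ennreal (exp (- (t * u))) * (?B t \<tau> * ?E c t \<tau>) \<partial>holding_measure)"
    proof (rule nn_integral_cmult[symmetric])
      note [measurable] = mh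
      show "(\<lambda>\<tau>. ?B t \<tau> * ?E c t \<tau>) \<in> borel_measurable holding_measure"
        unfolding of_bool_def by measurable
    qed
    also have "\<dots> = (\<integral>\<^sup>+\<tau>. ?B t \<tau> * (ennreal (exp (- (t * u))) * ?E c t \<tau>) \<partial>holding_measure)"
      by (simp only: mult.left_commute)
    finally show ?thesis by (simp only: e)
  qed
  have "(\<integral>\<^sup>+t\<in>{0<..}. ennreal (1 / t) * ?X c t \<partial>lborel) =
    (\<integral>\<^sup>+t. \<integral>\<^sup>+u. ennreal (exp (- (t * u))) * ?X c t * indicator {0..} u * indicator {0<..} t \<partial>lborel \<partial>lborel)"
  proof (rule nn_integral_cong)
    fix t :: real
    show "ennreal (1 / t) * ?X c t * indicator {0<..} t =
      (\<integral>\<^sup>+u. ennreal (exp (- (t * u))) * ?X c t * indicator {0..} u * indicator {0<..} t \<partial>lborel)"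
    proof (cases "t > 0")
      case True
      have "(\<integral>\<^sup>+u. ennreal (exp (- (t * u))) * ?X c t * indicator {0..} u * indicator {0<..} t \<partial>lborel) =
        (\<integral>\<^sup>+u. (ennreal (exp (- (t * u))) * indicator {0..} u) * ?X c t \<partial>lborel)"
        using True by (intro nn_integral_cong) (simp add: mult_ac)
      also have "\<dots> = ennreal (1 / t) * ?X c t"
        by (subst nn_integral_multc) (simp_all add: nn_integral_exp[OF True])
      finally show ?thesis using True by simp
    qed simp
  qed
  also have "\<dots> = (\<integral>\<^sup>+u. \<integral>\<^sup>+t. ennreal (exp (- (t * u))) * ?X c t * indicator {0..} u * indicator {0<..} t \<partial>lborel \<partial>lborel)"
  proof (rule lborel_pair.Fubini')
    have [measurable]: "(\<lambda>p. ?X c (snd p)) \<in> borel_measurable ((lborel :: real measure) \<Otimes>\<^sub>M lborel)"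
      by (rule measurable_compose[OF measurable_snd X])
    show "(\<lambda>(u, t). ennreal (exp (- (t * u))) * ?X c t * indicator {0..} u * indicator {0<..} t)
      \<in> borel_measurable (lborel \<Otimes>\<^sub>M lborel)"
      unfolding case_prod_beta by measurable
  qed
  also have "\<dots> = (\<integral>\<^sup>+u\<in>{0..}. (\<integral>\<^sup>+t\<in>{0<..}. ?X (\<lambda>i. c i + u) t \<partial>lborel) \<partial>lborel)"
  proof (rule nn_integral_cong)
    fix u :: real
    show "(\<integral>\<^sup>+t. ennreal (exp (- (t * u))) * ?X c t * indicator {0..} u * indicator {0<..} t \<partial>lborel) =
      (\<integral>\<^sup>+t\<in>{0<..}. ?X (\<lambda>i. c i + u) t \<partial>lborel) * indicator {0..} u"
      unfolding shift
      by (subst nn_integral_multc[symmetric]) (measurable, simp only: mult_ac)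
  qed
  also have "\<dots> = (\<integral>\<^sup>+u\<in>{0..}. (\<Prod>i<Suc n. ennreal (1 / (1 + c i + u))) \<partial>lborel)"
  proof (rule nn_integral_cong)
    fix u :: real
    show "(\<integral>\<^sup>+t\<in>{0<..}. ?X (\<lambda>i. c i + u) t \<partial>lborel) * indicator {0..} u =
      (\<Prod>i<Suc n. ennreal (1 / (1 + c i + u))) * indicator {0..} u"
    proof (cases "u \<ge> 0")
      case True
      have "(\<integral>\<^sup>+t\<in>{0<..}. ?X (\<lambda>i. c i + u) t \<partial>lborel) = (\<Prod>i<Suc n. \<integral>\<^sup>+r. ennreal (exp (- ((c i + u) * r))) \<partial>unit_exponential)"
        by (rule nn_integral_path_holding[of "\<lambda>i r. ennreal (exp (- ((c i + u) * r)))"]) measurable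
      also have "\<dots> = (\<Prod>i<Suc n. ennreal (1 / (1 + c i + u)))"
        using c True by (intro prod.cong refl) (simp add: nn_integral_unit_exponential_exp add.assoc)
      finally show ?thesis by simp
    qed simp
  qed
  finally show ?thesis .
qed

text \<open>No explosion, by Markov's inequality: for the sum S of the first n holding times, exp (t
  - S) has mean exp t / 2 ^ n, as 1 / 2 is the Laplace transform of a unit exponential variable at
  1.\<close>

lemma AE_holding_exceeds: "AE \<tau> in holding_measure. \<exists>n. t < (\<Sum>i\<le>n. \<tau> i)"
proof -
  note [measurable] = measurable_holding_component
  let ?N = "{\<tau> \<in> space holding_measure. \<forall>n. (\<Sum>i\<le>n. \<tau> i) \<le> t}"
  have [measurable]: "?N \<in> sets holding_measure" by measurable
  have le: "emeasure holding_measure ?N \<le> ennreal (exp t * (1 / 2) ^ n)" for n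
  proof -
    have "emeasure holding_measure ?N = (\<integral>\<^sup>+\<tau>. indicator ?N \<tau> \<partial>holding_measure)" by simp
    also have "\<dots> \<le> (\<integral>\<^sup>+\<tau>. ennreal (exp t) * (\<Prod>i<n. ennreal (exp (- (1 * \<tau> i)))) \<partial>holding_measure)"
    proof (rule nn_integral_mono_AE, use AE_holding_pos in eventually_elim)
      fix \<tau> :: "nat \<Rightarrow> real" assume pos: "\<forall>i. 0 < \<tau> i"
      show "indicator ?N \<tau> \<le> ennreal (exp t) * (\<Prod>i<n. ennreal (exp (- (1 * \<tau> i))))"
      proof (cases "\<tau> \<in> ?N")
        case True
        then have "(\<Sum>i\<le>n. \<tau> i) \<le> t" by auto
        moreover have "(\<Sum>i<n. \<tau> i) \<le> (\<Sum>i\<le>n. \<tau> i)"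
          using pos by (intro sum_mono2) (auto intro: less_imp_le)
        ultimately have "(\<Sum>i<n. \<tau> i) \<le> t" by simp
        then have "1 \<le> exp t * exp (- (\<Sum>i<n. \<tau> i))" by (simp add: exp_add[symmetric])
        also have "exp (- (\<Sum>i<n. \<tau> i)) = (\<Prod>i<n. exp (- (1 * \<tau> i)))"
          by (simp add: exp_sum[symmetric] sum_negf)
        finally have "ennreal 1 \<le> ennreal (exp t * (\<Prod>i<n. exp (- (1 * \<tau> i))))" by (rule ennreal_leI)
        then show ?thesis using True by (simp add: ennreal_mult prod_ennreal prod_nonneg)
      qed simp
    qed
    also have "\<dots> = ennreal (exp t) * (\<Prod>i<n. \<integral>\<^sup>+r. ennreal (exp (- (1 * r))) \<partial>unit_exponential)"
      by (subst nn_integral_cmult) (measurable, subst nn_integral_holding_prod, auto)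
    also have "\<dots> = ennreal (exp t) * (\<Prod>i<n. ennreal (1 / (1 + 1)))"
      by (subst nn_integral_unit_exponential_exp) (rule zero_le_one, rule refl)
    also have "(\<Prod>i<n. ennreal (1 / (1 + 1))) = ennreal ((1 / 2) ^ n)"
      by (subst prod_ennreal, simp, simp only: prod_constant card_lessThan one_add_one)
    also have "ennreal (exp t) * ennreal ((1 / 2) ^ n) = ennreal (exp t * (1 / 2) ^ n)"
      by (rule ennreal_mult[symmetric]) auto
    finally show ?thesis .
  qed
  have "(\<lambda>n. ennreal (exp t * (1 / 2) ^ n)) \<longlonglongrightarrow> ennreal (exp t * 0)"
    by (intro tendsto_ennrealI tendsto_mult tendsto_const LIMSEQ_power_zero) simp
  then have "emeasure holding_measure ?N \<le> ennreal (exp t * 0)"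
    by (rule LIMSEQ_le_const) (use le in auto)
  then have "emeasure holding_measure ?N = 0" by simp
  then show ?thesis by (intro AE_I[of _ _ ?N]) (auto simp: not_less)
qed

lemma AE_chain_exceeds: "AE z in chain_law C \<kappa> (x :: 'a::finite). \<exists>n. t < (\<Sum>i\<le>n. snd (z i))"
proof -
  interpret h: prob_space holding_measure by (rule prob_space_holding_measure)
  interpret a: prob_space "arrow_measure C \<kappa>" by (rule prob_space_arrow_measure)
  interpret ah: pair_prob_space "arrow_measure C \<kappa>" holding_measure ..
  note [measurable] = measurable_holding_component
  have "AE p in arrow_measure C \<kappa> \<Otimes>\<^sub>M holding_measure. \<exists>n. t < (\<Sum>i\<le>n. snd p i)"
    by (rule ah.AE_pair_measure) (measurable, use AE_holding_exceeds in auto)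
  then show ?thesis unfolding chain_law_def
    by (subst AE_distr_iff[OF measurable_chain]) (auto simp: case_prod_beta)
qed

section \<open>The loop measure as an integral over bridges\<close>

definition bridge_integral ::
  "('a::finite \<Rightarrow> 'a \<Rightarrow> real) \<Rightarrow> ('a \<Rightarrow> real) \<Rightarrow> ('a path \<Rightarrow> ennreal) \<Rightarrow> 'a \<Rightarrow> real \<Rightarrow> ennreal" where
  "bridge_integral C \<kappa> f x t = (\<integral>\<^sup>+z. f (path_until t z) * of_bool (state_at t z = Some x) \<partial>chain_law C \<kappa> x)"

lemma measurable_bridge_integrand:
  fixes f :: "'a::finite path \<Rightarrow> ennreal"
  assumes f: "f \<in> borel_measurable path_space"
  shows "(\<lambda>(t, z). f (path_until t z) * of_bool (state_at t z = Some x))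
    \<in> borel_measurable (borel \<Otimes>\<^sub>M (trajectory_space :: 'a trajectory measure))"
proof -
  have [measurable]: "(\<lambda>p. f (path_until (fst p) (snd p))) \<in> borel_measurable (borel \<Otimes>\<^sub>M trajectory_space)"
    using measurable_compose[OF measurable_path_until f] by (simp add: case_prod_beta')
  have [measurable]: "(\<lambda>p. state_at (fst p) (snd p)) \<in> measurable (borel \<Otimes>\<^sub>M trajectory_space) (count_space (UNIV :: 'a option set))"
    using measurable_state_at by (simp add: case_prod_beta')
  have "(\<lambda>p. f (path_until (fst p) (snd p)) * of_bool (state_at (fst p) (snd p) = Some x))
    \<in> borel_measurable (borel \<Otimes>\<^sub>M trajectory_space)"
    unfolding of_bool_def by measurable
  then show ?thesis by (simp add: case_prod_beta')
qed

lemma measurable_bridge_integrand_at: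
  fixes f :: "'a::finite path \<Rightarrow> ennreal"
  assumes f: "f \<in> borel_measurable path_space"
  shows "(\<lambda>z. f (path_until t z) * of_bool (state_at t z = Some x)) \<in> borel_measurable (chain_law C \<kappa> y)"
  using measurable_compose[OF measurable_Pair1'[of t borel trajectory_space] measurable_bridge_integrand[OF f, of x]]
  by (simp add: measurable_cong_sets[OF sets_chain_law refl])

lemma measurable_bridge_integral:
  fixes f :: "'a::finite path \<Rightarrow> ennreal"
  assumes f: "f \<in> borel_measurable path_space"
  shows "bridge_integral C \<kappa> f x \<in> borel_measurable borel"
proof -
  interpret prob_space "chain_law C \<kappa> x" by (rule prob_space_chain_law)
  have "(\<lambda>(t, z). f (path_until t z) * of_bool (state_at t z = Some x)) \<in> borel_measurable (borel \<Otimes>\<^sub>M chain_law C \<kappa> x)"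
    using measurable_bridge_integrand[OF f, of x]
    by (simp add: measurable_cong_sets[OF sets_pair_measure_cong[OF refl sets_chain_law] refl])
  from borel_measurable_nn_integral[OF this] show ?thesis
    unfolding bridge_integral_def[abs_def] .
qed

context killed_chain
begin

lemma nn_integral_loop_measure:
  fixes f :: "'a path \<Rightarrow> ennreal"
  assumes "f \<in> borel_measurable path_space"
  shows "(\<integral>\<^sup>+l. f l \<partial>loop_measure C \<kappa>) =
    (\<Sum>x\<in>UNIV. \<integral>\<^sup>+t\<in>{0<..}. ennreal (1 / t) * bridge_integral C \<kappa> f x t \<partial>lborel)"
proof -
  let ?R = "\<lambda>f. \<integral>\<^sup>+x. (\<integral>\<^sup>+t\<in>{0<..}. ennreal (1 / t) * bridge_integral C \<kappa> f x t \<partial>lborel) \<partial>count_space UNIV"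
  have "(\<integral>\<^sup>+l. f l \<partial>loop_measure C \<kappa>) = ?R f"
    using assms
  proof (induction rule: borel_measurable_induct)
    case (cong f g)
    then have "f = g" by auto
    then show ?case using cong by simp
  next
    case (set A)
    \<comment> \<open>The factor 1 / \<open>wt x\<close> of the bridge measure cancels against the
      factor \<open>wt x\<close> of the loop measure, so that \<open>bridge_integral\<close>
      contains neither.\<close>
    have "bridge_integral C \<kappa> (indicator A) x t = bridge_measure C \<kappa> x t A * ennreal (wt x)" for x t
    proof -
      let ?A = "{z \<in> space (chain_law C \<kappa> x). path_until t z \<in> A \<and> state_at t z = Some x}"
      have i: "indicator A (path_until t z) * of_bool (state_at t z = Some x) = (indicator ?A z :: ennreal)"
        if "z \<in> space (chain_law C \<kappa> x)" for z
        using that by (auto simp: indicator_def)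
      have "(indicator ?A :: _ \<Rightarrow> ennreal) \<in> borel_measurable (chain_law C \<kappa> x) \<longleftrightarrow>
        (\<lambda>z. indicator A (path_until t z) * of_bool (state_at t z = Some x) :: ennreal) \<in> borel_measurable (chain_law C \<kappa> x)"
        by (rule measurable_cong) (simp add: i)
      then have "(indicator ?A :: _ \<Rightarrow> ennreal) \<in> borel_measurable (chain_law C \<kappa> x)"
        using measurable_bridge_integrand_at[of "indicator A" t x C \<kappa> x] set by auto
      then have "?A \<in> sets (chain_law C \<kappa> x)"
        by (simp add: borel_measurable_indicator_iff Int_absorb2)
      then have "bridge_integral C \<kappa> (indicator A) x t = emeasure (chain_law C \<kappa> x) ?A"
        unfolding bridge_integral_def by (subst nn_integral_cong[OF i]) auto
      also have "\<dots> = emeasure (chain_law C \<kappa> x) ?A * (ennreal (1 / wt x) * ennreal (wt x))"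
        using w_pos[of x] by (simp add: ennreal_mult[symmetric])
      finally show ?thesis by (simp add: bridge_measure_def mult_ac)
    qed
    then show ?case using set
      by (simp add: emeasure_loop_measure sets_loop_measure nn_integral_count_space_finite mult_ac)
  next
    case (mult u c)
    note [measurable] = measurable_bridge_integral[OF mult(2)]
    have "bridge_integral C \<kappa> (\<lambda>l. c * u l) x t = c * bridge_integral C \<kappa> u x t" for x t
      unfolding bridge_integral_def mult.assoc
      by (rule nn_integral_cmult[OF measurable_bridge_integrand_at[OF mult(2)]])
    then have "?R (\<lambda>l. c * u l) = (\<integral>\<^sup>+x. \<integral>\<^sup>+t. c * (ennreal (1 / t) * bridge_integral C \<kappa> u x t * indicator {0<..} t) \<partial>lborel \<partial>count_space UNIV)"
      by (simp add: mult_ac)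
    also have "\<dots> = c * ?R u"
      by (simp add: nn_integral_cmult)
    finally show ?case using mult by (simp add: nn_integral_cmult measurable_cong_sets[OF sets_loop_measure refl])
  next
    case (add u v)
    have u: "u \<in> borel_measurable path_space" and v: "v \<in> borel_measurable path_space" by fact+
    note [measurable] = measurable_bridge_integral[OF u] measurable_bridge_integral[OF v]
    have "bridge_integral C \<kappa> (\<lambda>l. v l + u l) x t = bridge_integral C \<kappa> v x t + bridge_integral C \<kappa> u x t" for x t
      unfolding bridge_integral_def distrib_right
      by (rule nn_integral_add[OF measurable_bridge_integrand_at[OF v] measurable_bridge_integrand_at[OF u]])
    then have "?R (\<lambda>l. v l + u l) = ?R v + ?R u"
      by (simp add: distrib_left distrib_right nn_integral_add)
    then show ?case using add by (simp add: nn_integral_add measurable_cong_sets[OF sets_loop_measure refl])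
  next
    case (seq U)
    have m: "U i \<in> borel_measurable path_space" for i by fact
    have inc: "incseq U" by fact
    have IH: "(\<integral>\<^sup>+l. U i l \<partial>loop_measure C \<kappa>) = ?R (U i)" for i by fact
    note [measurable] = measurable_bridge_integral[OF m]
    have mono: "U i l \<le> U j l" if "i \<le> j" for i j l
      using inc that by (auto simp: incseq_def le_fun_def)
    have b: "bridge_integral C \<kappa> (SUP i. U i) x t = (SUP i. bridge_integral C \<kappa> (U i) x t)" for x t
    proof -
      have "bridge_integral C \<kappa> (SUP i. U i) x t = (\<integral>\<^sup>+z. (SUP i. U i (path_until t z) * of_bool (state_at t z = Some x)) \<partial>chain_law C \<kappa> x)"
        unfolding bridge_integral_def by (simp add: SUP_mult_right_ennreal image_comp)
      also have "\<dots> = (SUP i. bridge_integral C \<kappa> (U i) x t)"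
        unfolding bridge_integral_def
      proof (rule nn_integral_monotone_convergence_SUP)
        show "incseq (\<lambda>i z. U i (path_until t z) * of_bool (state_at t z = Some x))"
          by (auto simp: incseq_def le_fun_def intro!: mult_right_mono mono)
      qed (rule measurable_bridge_integrand_at[OF m])
      finally show ?thesis .
    qed
    have bm: "bridge_integral C \<kappa> (U i) x t \<le> bridge_integral C \<kappa> (U j) x t" if "i \<le> j" for i j x t
      unfolding bridge_integral_def by (intro nn_integral_mono mult_right_mono mono that) auto
    have "?R (SUP i. U i) = (\<integral>\<^sup>+x. \<integral>\<^sup>+t. (SUP i. ennreal (1 / t) * bridge_integral C \<kappa> (U i) x t * indicator {0<..} t) \<partial>lborel \<partial>count_space UNIV)"
      unfolding b by (simp add: SUP_mult_right_ennreal SUP_mult_left_ennreal)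
    also have "\<dots> = (\<integral>\<^sup>+x. (SUP i. \<integral>\<^sup>+t. ennreal (1 / t) * bridge_integral C \<kappa> (U i) x t * indicator {0<..} t \<partial>lborel) \<partial>count_space UNIV)"
      by (intro nn_integral_cong nn_integral_monotone_convergence_SUP)
        (auto simp: incseq_def le_fun_def intro!: mult_right_mono mult_left_mono bm)
    also have "\<dots> = (SUP i. ?R (U i))"
      by (rule nn_integral_monotone_convergence_SUP)
        (auto simp: incseq_def le_fun_def intro!: mult_right_mono mult_left_mono bm nn_integral_mono)
    also have "\<dots> = (SUP i. \<integral>\<^sup>+l. U i l \<partial>loop_measure C \<kappa>)"
      by (simp only: IH)
    also have "\<dots> = (\<integral>\<^sup>+l. (SUP i. U i) l \<partial>loop_measure C \<kappa>)"
      using inc m by (simp add: image_comp nn_integral_monotone_convergence_SUP[symmetric] measurable_cong_sets[OF sets_loop_measure refl])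
    finally show ?case by (rule sym)
  qed
  then show ?thesis by (simp add: nn_integral_count_space_finite)
qed

text \<open>The path seen at time \<open>t\<close> during its last listed state:
  \<open>length q - 1\<close> holding times are complete and the last one is cut at
  \<open>t\<close>.\<close>

definition timed_path :: "'a option list \<Rightarrow> (nat \<Rightarrow> real) \<Rightarrow> real \<Rightarrow> 'a path" where
  "timed_path q \<tau> t = map (\<lambda>i. (q ! i, \<tau> i)) [0..<length q - 1] @ [(last q, t - (\<Sum>i<length q - 1. \<tau> i))]"

definition timed_integral :: "('a path \<Rightarrow> ennreal) \<Rightarrow> 'a option list \<Rightarrow> real \<Rightarrow> ennreal" where
  "timed_integral f q t = (\<integral>\<^sup>+\<tau>. of_bool ((\<Sum>i<length q - 1. \<tau> i) \<le> t \<and> t < (\<Sum>i<Suc (length q - 1). \<tau> i)) *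
     f (timed_path q \<tau> t) \<partial>holding_measure)"

lemma measurable_timed_integrand:
  fixes f :: "'a path \<Rightarrow> ennreal"
  assumes f: "f \<in> borel_measurable path_space"
  shows "(\<lambda>(t, \<tau>). of_bool ((\<Sum>i<length q - 1. \<tau> i) \<le> t \<and> t < (\<Sum>i<Suc (length q - 1). \<tau> i)) *
     f (timed_path q \<tau> t)) \<in> borel_measurable (borel \<Otimes>\<^sub>M holding_measure)"
proof -
  note [measurable] = measurable_holding_component
  have "(\<lambda>p. timed_path q (snd p) (fst p)) \<in> measurable (borel \<Otimes>\<^sub>M holding_measure) path_space"
  proof (rule measurable_path_spaceI[of "Suc (length q - 1)"])
    fix i assume "i < Suc (length q - 1)"
    have "(\<lambda>p. if i < length q - 1 then (q ! i, snd p i) else (last q, fst p - (\<Sum>i<length q - 1. snd p i)))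
      \<in> measurable (borel \<Otimes>\<^sub>M holding_measure) (count_space UNIV \<Otimes>\<^sub>M borel)" by measurable
    also have "(\<lambda>p. if i < length q - 1 then (q ! i, snd p i) else (last q, fst p - (\<Sum>i<length q - 1. snd p i))) =
      (\<lambda>p. timed_path q (snd p) (fst p) ! i)"
      using \<open>i < Suc (length q - 1)\<close> by (auto simp: timed_path_def nth_append fun_eq_iff)
    finally show "(\<lambda>p. timed_path q (snd p) (fst p) ! i) \<in> measurable (borel \<Otimes>\<^sub>M holding_measure) (count_space UNIV \<Otimes>\<^sub>M borel)" .
  qed (simp add: timed_path_def)
  from measurable_compose[OF this f]
  have 1: "(\<lambda>p. f (timed_path q (snd p) (fst p))) \<in> borel_measurable (borel \<Otimes>\<^sub>M holding_measure)" .
  have [measurable]: "(\<lambda>p. \<Sum>i<m. snd p i) \<in> borel_measurable ((borel :: real measure) \<Otimes>\<^sub>M holding_measure)" for m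
    by (rule borel_measurable_sum) measurable
  have 2: "(\<lambda>p. of_bool ((\<Sum>i<length q - 1. snd p i) \<le> fst p \<and> fst p < (\<Sum>i<Suc (length q - 1). snd p i)) :: ennreal)
    \<in> borel_measurable (borel \<Otimes>\<^sub>M holding_measure)"
    unfolding of_bool_def by measurable
  from borel_measurable_times_ennreal[OF 2 1] show ?thesis by (simp only: case_prod_beta')
qed

lemma measurable_timed_integrand_at:
  fixes f :: "'a path \<Rightarrow> ennreal"
  assumes f: "f \<in> borel_measurable path_space"
  shows "(\<lambda>\<tau>. of_bool ((\<Sum>i<length q - 1. \<tau> i) \<le> t \<and> t < (\<Sum>i<Suc (length q - 1). \<tau> i)) *
     f (timed_path q \<tau> t)) \<in> borel_measurable holding_measure"
  using measurable_compose[OF measurable_Pair1'[of t borel holding_measure] measurable_timed_integrand[OF f, of q]] by simp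

lemma measurable_timed_integral:
  fixes f :: "'a path \<Rightarrow> ennreal"
  assumes f: "f \<in> borel_measurable path_space"
  shows "timed_integral f q \<in> borel_measurable borel"
proof -
  interpret h: prob_space holding_measure by (rule prob_space_holding_measure)
  show ?thesis unfolding timed_integral_def[abs_def]
    using h.borel_measurable_nn_integral[OF measurable_timed_integrand[OF f, of q]] .
qed

text \<open>The bridge is summed over its number of jumps before \<open>t\<close>. This number is
  almost surely determined by the position of \<open>t\<close> among the partial sums of the holding
  times, which are positive and do not explode.\<close>

lemma bridge_integral_eq:
  fixes f :: "'a path \<Rightarrow> ennreal"
  assumes f: "f \<in> borel_measurable path_space" and t: "t > 0"
  shows "bridge_integral C \<kappa> f x t =
    (\<Sum>n. \<Sum>q\<in>{q\<in>prefixes x n. last q = Some x}. walk_weight jp q * timed_integral f q t)"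
proof -
  let ?k = "\<lambda>q \<tau>. of_bool (last q = Some x) * (of_bool ((\<Sum>i<length q - 1. \<tau> i) \<le> t \<and> t < (\<Sum>i<Suc (length q - 1). \<tau> i)) *
     f (timed_path q \<tau> t))"
  let ?P = "\<lambda>n z. map (fst \<circ> z) [0..<Suc n]"
  have km: "?k q \<in> borel_measurable holding_measure" for q
    using measurable_timed_integrand_at[OF f, of q t] by measurable
  have "bridge_integral C \<kappa> f x t = (\<integral>\<^sup>+z. (\<Sum>n. ?k (?P n z) (snd \<circ> z)) \<partial>chain_law C \<kappa> x)"
    unfolding bridge_integral_def
  proof (rule nn_integral_cong_AE)
    show "AE z in chain_law C \<kappa> x. f (path_until t z) * of_bool (state_at t z = Some x) = (\<Sum>n. ?k (?P n z) (snd \<circ> z))"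
      using AE_chain_holding_pos[of x] AE_chain_exceeds[of t C \<kappa> x]
    proof eventually_elim
      case (elim z)
      let ?h = "jump_count t z"
      let ?S = "\<lambda>n. \<Sum>i<n. snd (z i)"
      have h1: "t < ?S (Suc ?h)"
        using LeastI_ex[OF elim(2)] by (simp add: jump_count_def lessThan_Suc_atMost)
      have mono: "?S m \<le> ?S n" if "m \<le> n" for m n
        using elim(1) that by (intro sum_mono2) (auto intro: less_imp_le)
      have h2: "?S ?h \<le> t"
      proof (cases ?h)
        case (Suc m)
        then have "m < ?h" by simp
        then have "\<not> t < (\<Sum>i\<le>m. snd (z i))"
          unfolding jump_count_def by (rule not_less_Least)
        then show ?thesis using Suc by (simp add: lessThan_Suc_atMost)
      qed (use t in simp)
      have iff: "(?S n \<le> t \<and> t < ?S (Suc n)) \<longleftrightarrow> n = ?h" for n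
      proof
        assume n: "?S n \<le> t \<and> t < ?S (Suc n)"
        have "\<not> Suc n \<le> ?h" using n h2 mono[of "Suc n" ?h] by auto
        moreover have "\<not> Suc ?h \<le> n" using n h1 mono[of "Suc ?h" n] by auto
        ultimately show "n = ?h" by simp
      qed (use h1 h2 in simp)
      have pth: "timed_path (?P n z) (snd \<circ> z) t = map z [0..<n] @ [(fst (z n), t - ?S n)]" for n
        by (auto simp: timed_path_def nth_append)
      have k: "?k (?P n z) (snd \<circ> z) = of_bool (fst (z n) = Some x) * (of_bool (n = ?h) * f (map z [0..<n] @ [(fst (z n), t - ?S n)]))" for n
        unfolding pth iff[symmetric] by simp
      have "(\<Sum>n. ?k (?P n z) (snd \<circ> z)) = (\<Sum>n\<in>{?h}. ?k (?P n z) (snd \<circ> z))"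
        by (rule suminf_finite) (simp_all only: k, auto)
      also have "\<dots> = f (path_until t z) * of_bool (state_at t z = Some x)"
        unfolding k by (simp add: path_until_def state_at_def Let_def)
      finally show ?case by simp
    qed
  qed
  also have "\<dots> = (\<Sum>n. \<integral>\<^sup>+z. ?k (?P n z) (snd \<circ> z) \<partial>chain_law C \<kappa> x)"
  proof (rule nn_integral_suminf)
    fix n
    have "(\<lambda>z. ?k (?P n z) (snd \<circ> z)) \<in> borel_measurable trajectory_space"
      by (rule measurable_compose_countable'[where I = UNIV, OF _ measurable_prefix[of "Suc n"]])
        (rule measurable_compose[OF measurable_holding km], simp)
    then show "(\<lambda>z. ?k (?P n z) (snd \<circ> z)) \<in> borel_measurable (chain_law C \<kappa> x)"
      by (simp only: measurable_cong_sets[OF sets_chain_law refl])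
  qed
  also have "\<dots> = (\<Sum>n. \<Sum>q\<in>prefixes x n. walk_weight jp q * (\<integral>\<^sup>+\<tau>. ?k q \<tau> \<partial>holding_measure))"
    by (intro suminf_cong nn_integral_chain_prefix km)
  also have "\<dots> = (\<Sum>n. \<Sum>q\<in>{q\<in>prefixes x n. last q = Some x}. walk_weight jp q * timed_integral f q t)"
    by (intro suminf_cong sum.mono_neutral_cong_right) (auto simp: timed_integral_def)
  finally show ?thesis .
qed

text \<open>All terms are nonnegative, so the integral over \<open>t\<close> moves inside the sums,
  and the loop measure becomes a sum over closed lists of states, each with a time integral of its
  own.\<close>

lemma nn_integral_loop_measure_words:
  fixes f :: "'a path \<Rightarrow> ennreal"
  assumes f: "f \<in> borel_measurable path_space"
  shows "(\<integral>\<^sup>+l. f l \<partial>loop_measure C \<kappa>) = (\<Sum>x\<in>UNIV. \<Sum>n. \<Sum>q\<in>{q\<in>prefixes x n. last q = Some x}.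
    walk_weight jp q * (\<integral>\<^sup>+t\<in>{0<..}. ennreal (1 / t) * timed_integral f q t \<partial>lborel))"
  unfolding nn_integral_loop_measure[OF f]
proof (rule sum.cong[OF refl])
  fix x
  note [measurable] = measurable_timed_integral[OF f]
  let ?Q = "\<lambda>n. {q\<in>prefixes x n. last q = Some x}"
  have "(\<integral>\<^sup>+t\<in>{0<..}. ennreal (1 / t) * bridge_integral C \<kappa> f x t \<partial>lborel) =
    (\<integral>\<^sup>+t. (\<Sum>n. \<Sum>q\<in>?Q n. walk_weight jp q * (ennreal (1 / t) * timed_integral f q t * indicator {0<..} t)) \<partial>lborel)"
    by (intro nn_integral_cong)
      (auto simp: bridge_integral_eq[OF f] sum_distrib_left mult_ac ennreal_suminf_cmult[symmetric] split: split_indicator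
        simp del: ennreal_suminf_cmult)
  also have "\<dots> = (\<Sum>n. \<integral>\<^sup>+t. (\<Sum>q\<in>?Q n. walk_weight jp q * (ennreal (1 / t) * timed_integral f q t * indicator {0<..} t)) \<partial>lborel)"
    by (rule nn_integral_suminf) measurable
  also have "\<dots> = (\<Sum>n. \<Sum>q\<in>?Q n. walk_weight jp q * (\<integral>\<^sup>+t\<in>{0<..}. ennreal (1 / t) * timed_integral f q t \<partial>lborel))"
    by (intro suminf_cong, subst nn_integral_sum) (measurable, simp add: nn_integral_cmult)
  finally show "(\<integral>\<^sup>+t\<in>{0<..}. ennreal (1 / t) * bridge_integral C \<kappa> f x t \<partial>lborel) =
    (\<Sum>n. \<Sum>q\<in>?Q n. walk_weight jp q * (\<integral>\<^sup>+t\<in>{0<..}. ennreal (1 / t) * timed_integral f q t \<partial>lborel))" .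
qed

end

section \<open>Closed words and their rotations\<close>

context killed_chain
begin

lemma map_fst_timed_path: "q \<noteq> [] \<Longrightarrow> map fst (timed_path q \<tau> t) = q"
proof -
  assume "q \<noteq> []"
  have "map ((!) q) [0..<length q - 1] = butlast q"
    by (rule nth_equalityI) (auto simp: nth_butlast)
  then show ?thesis using \<open>q \<noteq> []\<close> by (simp add: timed_path_def o_def)
qed

text \<open>A bridge ends in the state it started from, so the cyclic jump from the last entry to
  the first stays at a vertex and is not a jump between distinct \<open>x\<close> and
  \<open>y\<close>.\<close>

lemma traversals_timed_path:
  assumes "q \<noteq> []" "hd q = last q" "x \<noteq> y"
  shows "traversals (timed_path q \<tau> t) x y = path_jumps q x y"
proof -
  have ne: "timed_path q \<tau> t \<noteq> []" by (simp add: timed_path_def)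
  have "fst (hd (timed_path q \<tau> t)) = hd (map fst (timed_path q \<tau> t))" using ne by (simp add: hd_map)
  then have "traversals (timed_path q \<tau> t) x y = path_jumps (q @ [last q]) x y"
    using traversals_conv[OF ne] assms by (simp add: map_fst_timed_path)
  also have "q @ [last q] = butlast q @ last q # [last q]" using assms(1) by simp
  also have "path_jumps \<dots> x y = path_jumps (butlast q @ [last q]) x y + path_jumps [last q, last q] x y"
    by (rule path_jumps_append)
  also have "\<dots> = path_jumps q x y" using assms by simp
  finally show ?thesis .
qed

lemma expm_test_fun_timed_path:
  assumes q: "length q = Suc n" "hd q = last q" and \<tau>: "\<And>i. \<tau> i > 0" and t: "(\<Sum>i<n. \<tau> i) \<le> t"
  shows "ennreal (expm (test_fun k m (timed_path q \<tau> t))) = walk_weight (marking m) q *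
    ((\<Prod>i<n. ennreal (exp (- (rate k (q ! i) * \<tau> i)))) * ennreal (exp (- (rate k (q ! n) * (t - (\<Sum>i<n. \<tau> i))))))"
proof -
  have ne: "q \<noteq> []" using q by auto
  have "(\<Sum>x\<in>UNIV. of_nat (k x) * local_time C \<kappa> (timed_path q \<tau> t) x) =
    (\<Sum>a\<leftarrow>timed_path q \<tau> t. ennreal (rate k (fst a) * snd a))"
    using \<tau> t q by (intro local_time_part) (auto simp: timed_path_def intro: less_imp_le)
  also have "\<dots> = (\<Sum>i<n. ennreal (rate k (q ! i) * \<tau> i)) + ennreal (rate k (q ! n) * (t - (\<Sum>i<n. \<tau> i)))"
    using q ne by (simp add: timed_path_def last_conv_nth o_def interv_sum_list_conv_sum_set_nat atLeast0LessThan)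
  finally have 1: "(\<Sum>x\<in>UNIV. of_nat (k x) * local_time C \<kappa> (timed_path q \<tau> t) x) =
    (\<Sum>i<n. ennreal (rate k (q ! i) * \<tau> i)) + ennreal (rate k (q ! n) * (t - (\<Sum>i<n. \<tau> i)))" .
  have "(\<Sum>e\<in>edge_pairs C. of_nat (m e) * of_nat (traversals (timed_path q \<tau> t) (fst e) (snd e))) =
    (\<Sum>e\<in>edge_pairs C. ennreal (real (m e) * real (path_jumps q (fst e) (snd e))))"
    using traversals_timed_path[OF ne q(2)] edge_pairs_neq
    by (intro sum.cong refl) (simp add: ennreal_mult ennreal_of_nat_eq_real_of_nat)
  also have "\<dots> = ennreal (\<Sum>e\<in>edge_pairs C. real (m e) * real (path_jumps q (fst e) (snd e)))"
    by (rule sum_ennreal) simp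
  finally have 2: "(\<Sum>e\<in>edge_pairs C. of_nat (m e) * of_nat (traversals (timed_path q \<tau> t) (fst e) (snd e))) =
    ennreal (\<Sum>e\<in>edge_pairs C. real (m e) * real (path_jumps q (fst e) (snd e)))" .
  have a: "0 \<le> rate k (q ! i) * \<tau> i" for i
    using rate_nonneg[of k "q ! i"] \<tau>[of i] by simp
  have b: "0 \<le> rate k (q ! n) * (t - (\<Sum>i<n. \<tau> i))" using rate_nonneg[of k "q ! n"] t by simp
  have d: "0 \<le> (\<Sum>e\<in>edge_pairs C. real (m e) * real (path_jumps q (fst e) (snd e)))"
    by (intro sum_nonneg) simp
  have "expm (test_fun k m (timed_path q \<tau> t)) = (\<Prod>i<n. exp (- (rate k (q ! i) * \<tau> i))) *
    exp (- (rate k (q ! n) * (t - (\<Sum>i<n. \<tau> i)))) *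
    exp (- (\<Sum>e\<in>edge_pairs C. real (m e) * real (path_jumps q (fst e) (snd e))))"
    unfolding test_fun_def 1 2
    by (simp only: expm_add expm_sum expm_ennreal[OF a] expm_ennreal[OF b] expm_ennreal[OF d])
  moreover have "(\<Prod>i<n. ennreal (exp (- (rate k (q ! i) * \<tau> i)))) = ennreal (\<Prod>i<n. exp (- (rate k (q ! i) * \<tau> i)))"
    by (rule prod_ennreal) simp
  ultimately show ?thesis
    unfolding walk_weight_marking by (simp only: ennreal_mult''[OF exp_ge_zero], simp only: mult_ac)
qed

text \<open>The cemetery is absorbing, so a walk through it cannot end elsewhere.\<close>

lemma walk_weight_jp_None:
  "None \<in> set q \<Longrightarrow> last q \<noteq> None \<Longrightarrow> walk_weight jp q = 0"
proof (induction jp q rule: walk_weight.induct)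
  case (1 u v vs)
  show ?case
  proof (cases "None \<in> set (v # vs)")
    case True
    then show ?thesis using 1 by simp
  next
    case False
    then show ?thesis using 1 by (auto simp: jump_pmf_def pmf_return)
  qed
next
  case ("2_2" v)
  then show ?case by simp
qed simp

text \<open>A bridge with \<open>n\<close> jumps lists its base point twice; without the last entry
  it is a closed word of \<open>n\<close> letters, and lists through the cemetery have weight 0. For
  \<open>n = 0\<close> the word would be empty and have no base point.\<close>

lemma sum_closed_words:
  fixes H :: "'a option list \<Rightarrow> ennreal"
  assumes n: "n > 0"
  shows "(\<Sum>x\<in>UNIV. \<Sum>q\<in>{q\<in>prefixes x n. last q = Some x}. walk_weight jp q * H q) =
    (\<Sum>p\<in>words (range Some) n. cycle_weight jp p * H (p @ [hd p]))"
proof -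
  let ?Q = "\<lambda>x. {q\<in>prefixes x n. last q = Some x}"
  let ?c = "\<lambda>p :: 'a option list. p @ [hd p]"
  have "(\<Sum>x\<in>UNIV. \<Sum>q\<in>?Q x. walk_weight jp q * H q) = (\<Sum>q\<in>(\<Union>x. ?Q x). walk_weight jp q * H q)"
    by (rule sum.UNION_disjoint[symmetric]) (simp, simp, auto simp: prefixes_def)
  also have "\<dots> = (\<Sum>q\<in>?c ` words (range Some) n. walk_weight jp q * H q)"
  proof (rule sum.mono_neutral_right)
    show "?c ` words (range Some) n \<subseteq> (\<Union>x. ?Q x)"
    proof
      fix q assume "q \<in> ?c ` words (range Some) n"
      then obtain p where p: "q = p @ [hd p]" "set p \<subseteq> range Some" "length p = n" by (auto simp: words_def)
      then have "p \<noteq> []" using n by auto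
      then obtain x where "hd p = Some x" using p by (metis hd_in_set image_iff subset_iff)
      then show "q \<in> (\<Union>x. ?Q x)" using p \<open>p \<noteq> []\<close> by (auto simp: prefixes_def)
    qed
    show "\<forall>q\<in>(\<Union>x. ?Q x) - ?c ` words (range Some) n. walk_weight jp q * H q = 0"
    proof
      fix q assume q: "q \<in> (\<Union>x. ?Q x) - ?c ` words (range Some) n"
      then obtain x where x: "length q = Suc n" "hd q = Some x" "last q = Some x" by (auto simp: prefixes_def)
      then have ne: "q \<noteq> []" "butlast q \<noteq> []" using n by (auto simp: butlast_conv_take)
      have "hd (butlast q) = hd q" using ne by (cases q) (auto split: if_splits)
      then have "q = ?c (butlast q)" using append_butlast_last_id[OF ne(1)] x by simp
      then have "butlast q \<notin> words (range Some) n" using q by blast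
      then have "\<not> set (butlast q) \<subseteq> range Some" using x by (simp add: words_def)
      then have "None \<in> set (butlast q)" by (metis notin_range_Some subsetI)
      then have "None \<in> set q" by (rule in_set_butlastD)
      then show "walk_weight jp q * H q = 0" using x by (simp add: walk_weight_jp_None)
    qed
  qed simp
  also have "\<dots> = (\<Sum>p\<in>words (range Some) n. cycle_weight jp p * H (?c p))"
    by (subst sum.reindex) (auto simp: inj_on_def cycle_weight_def)
  finally show ?thesis .
qed

lemma cycle_weight_tilted:
  "cycle_weight (tilted k m) p = cycle_weight jp p * (\<Prod>v\<leftarrow>p. damping k v) * cycle_weight (marking m) p"
  unfolding cycle_weight_def tilted_def walk_weight_mult walk_weight_source ..

text \<open>The extra factor at \<open>hd p\<close> comes from the visit to the base point, which a
  bridge cuts into two holding times. Averaged over the rotations it becomes a sum over the letters,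
  and the integral over \<open>u\<close> is then that of a derivative.\<close>

lemma nn_integral_rotation:
  assumes n: "n > 0"
  shows "(\<Sum>p\<in>words U n. cycle_weight w p * (\<integral>\<^sup>+u\<in>{0..}. ((\<Prod>v\<leftarrow>p. ennreal (1 / (1 + rate k v + u))) *
      ennreal (1 / (1 + rate k (hd p) + u))) \<partial>lborel)) =
    (\<Sum>p\<in>words U n. cycle_weight w p * (\<Prod>v\<leftarrow>p. damping k v)) / of_nat n"
proof -
  let ?h = "\<lambda>u v. ennreal (1 / (1 + rate k v + u))"
  let ?W = "words U n"
  have fin: "finite ?W" by simp
  have rot: "(\<Prod>v\<leftarrow>rotate1 p. ?h u v) = (\<Prod>v\<leftarrow>p. ?h u v)" for u and p :: "'a option list"
    by (cases p) (auto simp: mult.commute)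
  have mp[measurable]: "(\<lambda>u. \<Prod>v\<leftarrow>p. ?h u v) \<in> borel_measurable borel" for p :: "'a option list"
    by (induction p) auto
  have ms[measurable]: "(\<lambda>u. \<Sum>v\<leftarrow>p. ?h u v) \<in> borel_measurable borel" for p :: "'a option list"
    by (induction p) auto
  let ?L = "\<Sum>p\<in>?W. cycle_weight w p * (\<integral>\<^sup>+u\<in>{0..}. ((\<Prod>v\<leftarrow>p. ?h u v) * ?h u (hd p)) \<partial>lborel)"
  have "of_nat n * ?L = of_nat n * (\<integral>\<^sup>+u. (\<Sum>p\<in>?W. cycle_weight w p * ((\<Prod>v\<leftarrow>p. ?h u v) * ?h u (hd p) * indicator {0..} u)) \<partial>lborel)"
    by (subst nn_integral_sum) (auto simp: nn_integral_cmult)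
  also have "\<dots> = (\<integral>\<^sup>+u. of_nat n * (\<Sum>p\<in>?W. cycle_weight w p * ((\<Prod>v\<leftarrow>p. ?h u v) * ?h u (hd p) * indicator {0..} u)) \<partial>lborel)"
    by (rule nn_integral_cmult[symmetric]) measurable
  also have "\<dots> = (\<integral>\<^sup>+u. (\<Sum>p\<in>?W. cycle_weight w p * ((\<Sum>v\<leftarrow>p. ?h u v) * (\<Prod>v\<leftarrow>p. ?h u v) * indicator {0..} u)) \<partial>lborel)"
  proof (rule nn_integral_cong)
    fix u
    have "(\<Sum>p\<in>?W. cycle_weight w p * ((\<Sum>v\<leftarrow>p. ?h u v) * (\<Prod>v\<leftarrow>p. ?h u v) * indicator {0..} u)) =
      (\<Sum>p\<in>?W. cycle_weight w p * (\<Prod>v\<leftarrow>p. ?h u v) * (\<Sum>v\<leftarrow>p. ?h u v)) * indicator {0..} u"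
      unfolding sum_distrib_right by (intro sum.cong refl) (simp only: mult_ac)
    also have "\<dots> = of_nat n * (\<Sum>p\<in>?W. cycle_weight w p * (\<Prod>v\<leftarrow>p. ?h u v) * ?h u (hd p)) * indicator {0..} u"
      by (subst sum_words_rotation) (simp_all only: cycle_weight_rotate1 rot)
    also have "\<dots> = of_nat n * (\<Sum>p\<in>?W. cycle_weight w p * ((\<Prod>v\<leftarrow>p. ?h u v) * ?h u (hd p) * indicator {0..} u))"
      unfolding sum_distrib_left sum_distrib_right by (intro sum.cong refl) (simp only: mult_ac)
    finally show "of_nat n * (\<Sum>p\<in>?W. cycle_weight w p * ((\<Prod>v\<leftarrow>p. ?h u v) * ?h u (hd p) * indicator {0..} u)) =
      (\<Sum>p\<in>?W. cycle_weight w p * ((\<Sum>v\<leftarrow>p. ?h u v) * (\<Prod>v\<leftarrow>p. ?h u v) * indicator {0..} u))" by simp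
  qed
  also have "\<dots> = (\<Sum>p\<in>?W. cycle_weight w p * (\<integral>\<^sup>+u\<in>{0..}. ((\<Sum>v\<leftarrow>p. ?h u v) * (\<Prod>v\<leftarrow>p. ?h u v)) \<partial>lborel))"
    by (subst nn_integral_sum) (auto simp: nn_integral_cmult)
  also have "\<dots> = (\<Sum>p\<in>?W. cycle_weight w p * (\<Prod>v\<leftarrow>p. damping k v))"
  proof (rule sum.cong[OF refl], rule arg_cong2[of _ _ _ _ "(*)"])
    fix p assume "p \<in> ?W"
    then have ne: "p \<noteq> []" using n by (auto simp: words_def)
    have b: "1 + rate k v > 0" for v using rate_nonneg[of k v] by simp
    have "(\<integral>\<^sup>+u\<in>{0..}. ((\<Sum>v\<leftarrow>p. ?h u v) * (\<Prod>v\<leftarrow>p. ?h u v)) \<partial>lborel) =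
      (\<integral>\<^sup>+u\<in>{0..}. ennreal ((\<Sum>v\<leftarrow>p. 1 / (1 + rate k v + u)) * (\<Prod>v\<leftarrow>p. 1 / (1 + rate k v + u))) \<partial>lborel)"
    proof (rule nn_integral_cong)
      fix u :: real
      have pos: "0 \<le> 1 / (1 + rate k v + u)" if "u \<ge> 0" for v
        using b[of v] that by simp
      have s: "(\<Sum>v\<leftarrow>p. ?h u v) = ennreal (\<Sum>v\<leftarrow>p. 1 / (1 + rate k v + u)) \<and> 0 \<le> (\<Sum>v\<leftarrow>p. 1 / (1 + rate k v + u))" if u: "u \<ge> 0"
        using pos[OF u] by (induction p) (auto simp: ennreal_plus)
      have "(\<Prod>v\<leftarrow>p. ?h u v) = ennreal (\<Prod>v\<leftarrow>p. 1 / (1 + rate k v + u)) \<and> 0 \<le> (\<Prod>v\<leftarrow>p. 1 / (1 + rate k v + u))" if u: "u \<ge> 0"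
        using pos[OF u]
      proof (induction p)
        case (Cons v p)
        then show ?case by (simp add: ennreal_mult[symmetric] del: times_divide_eq_left times_divide_eq_right)
      qed simp
      then show "(\<Sum>v\<leftarrow>p. ?h u v) * (\<Prod>v\<leftarrow>p. ?h u v) * indicator {0..} u =
        ennreal ((\<Sum>v\<leftarrow>p. 1 / (1 + rate k v + u)) * (\<Prod>v\<leftarrow>p. 1 / (1 + rate k v + u))) * indicator {0..} u"
        using s by (auto simp: ennreal_mult split: split_indicator)
    qed
    also have "\<dots> = ennreal (\<Prod>v\<leftarrow>p. 1 / (1 + rate k v))"
      by (rule nn_integral_sum_prod_inverse[OF ne b])
    also have "\<dots> = (\<Prod>v\<leftarrow>p. damping k v)"
    proof (induction p)
      case (Cons v p)
      have "0 \<le> 1 / (1 + rate k v)" using b[of v] by simp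
      then show ?case using Cons by (simp add: damping_def ennreal_mult' del: times_divide_eq_left times_divide_eq_right)
    qed simp
    finally show "(\<integral>\<^sup>+u\<in>{0..}. ((\<Sum>v\<leftarrow>p. ?h u v) * (\<Prod>v\<leftarrow>p. ?h u v)) \<partial>lborel) = (\<Prod>v\<leftarrow>p. damping k v)" .
  qed simp
  finally have "of_nat n * ?L = (\<Sum>p\<in>?W. cycle_weight w p * (\<Prod>v\<leftarrow>p. damping k v))" .
  then have "of_nat n * ?L / of_nat n = (\<Sum>p\<in>?W. cycle_weight w p * (\<Prod>v\<leftarrow>p. damping k v)) / of_nat n"
    by simp
  then show ?thesis
    using n ennreal_mult_divide_eq[of "of_nat n" ?L] by (simp add: mult.commute[of _ ?L] of_nat_less_top less_top[symmetric])
qed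

text \<open>A path with \<open>n\<close> jumps has \<open>n + 1\<close> entries, so
  \<open>2 \<le> length l\<close> means at least one jump. Loops reduced to a point are kept out
  because their mass is infinite.\<close>

lemma nn_integral_long_loops:
  "(\<integral>\<^sup>+l. ennreal (expm (test_fun k m l)) * of_bool (2 \<le> length l) \<partial>loop_measure C \<kappa>) =
    loop_mass (tilted k m) (range Some)"
proof -
  let ?f = "\<lambda>l. ennreal (expm (test_fun k m l)) * of_bool (2 \<le> length l)"
  have len: "(\<lambda>l. of_bool (2 \<le> length (l :: 'a path)) :: ennreal) \<in> borel_measurable path_space"
    by (rule measurable_compose[OF measurable_length_path]) simp
  have "(\<lambda>l. ennreal (expm (test_fun k m l))) \<in> borel_measurable path_space" by measurable
  from borel_measurable_times_ennreal[OF this len]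
  have f: "?f \<in> borel_measurable path_space" .
  let ?I = "\<lambda>q. \<integral>\<^sup>+u\<in>{0..}. (\<Prod>i<length q. ennreal (1 / (1 + rate k (q ! i) + u))) \<partial>lborel"
  let ?Q = "\<lambda>x n. {q\<in>prefixes x n. last q = Some x}"
  have term_eq: "(\<integral>\<^sup>+t\<in>{0<..}. ennreal (1 / t) * timed_integral ?f q t \<partial>lborel) =
    of_bool (0 < n) * (walk_weight (marking m) q * ?I q)" if q: "q \<in> ?Q x n" for x n q
  proof -
    from q have len: "length q = Suc n" and hd: "hd q = last q" by (auto simp: prefixes_def)
    let ?X = "\<lambda>t. \<integral>\<^sup>+\<tau>. of_bool ((\<Sum>i<n. \<tau> i) \<le> t \<and> t < (\<Sum>i<Suc n. \<tau> i)) *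
      ((\<Prod>i<n. ennreal (exp (- (rate k (q ! i) * \<tau> i)))) * ennreal (exp (- (rate k (q ! n) * (t - (\<Sum>i<n. \<tau> i)))))) \<partial>holding_measure"
    have "timed_integral ?f q t = of_bool (0 < n) * walk_weight (marking m) q * ?X t" for t
    proof -
      note [measurable] = measurable_holding_component
      have "timed_integral ?f q t = (\<integral>\<^sup>+\<tau>. (of_bool (0 < n) * walk_weight (marking m) q) * (of_bool ((\<Sum>i<n. \<tau> i) \<le> t \<and> t < (\<Sum>i<Suc n. \<tau> i)) *
        ((\<Prod>i<n. ennreal (exp (- (rate k (q ! i) * \<tau> i)))) * ennreal (exp (- (rate k (q ! n) * (t - (\<Sum>i<n. \<tau> i))))))) \<partial>holding_measure)"
        unfolding timed_integral_def
      proof (rule nn_integral_cong_AE, use AE_holding_pos in eventually_elim)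
        fix \<tau> :: "nat \<Rightarrow> real" assume "\<forall>i. 0 < \<tau> i"
        then show "of_bool ((\<Sum>i<length q - 1. \<tau> i) \<le> t \<and> t < (\<Sum>i<Suc (length q - 1). \<tau> i)) * ?f (timed_path q \<tau> t) =
          (of_bool (0 < n) * walk_weight (marking m) q) * (of_bool ((\<Sum>i<n. \<tau> i) \<le> t \<and> t < (\<Sum>i<Suc n. \<tau> i)) *
          ((\<Prod>i<n. ennreal (exp (- (rate k (q ! i) * \<tau> i)))) * ennreal (exp (- (rate k (q ! n) * (t - (\<Sum>i<n. \<tau> i)))))))"
          using expm_test_fun_timed_path[OF len hd, of \<tau> t k m] len
          by (cases "(\<Sum>i<n. \<tau> i) \<le> t") (auto simp: timed_path_def mult_ac)
      qed
      also have "\<dots> = of_bool (0 < n) * walk_weight (marking m) q * ?X t"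
        by (rule nn_integral_cmult) (unfold of_bool_def, measurable)
      finally show ?thesis .
    qed
    then have "(\<integral>\<^sup>+t\<in>{0<..}. ennreal (1 / t) * timed_integral ?f q t \<partial>lborel) =
      (\<integral>\<^sup>+t. of_bool (0 < n) * walk_weight (marking m) q * (ennreal (1 / t) * ?X t * indicator {0<..} t) \<partial>lborel)"
      by (intro nn_integral_cong) (simp only: mult_ac)
    also have "\<dots> = of_bool (0 < n) * walk_weight (marking m) q * (\<integral>\<^sup>+t\<in>{0<..}. ennreal (1 / t) * ?X t \<partial>lborel)"
    proof (rule nn_integral_cmult)
      have [measurable]: "?X \<in> borel_measurable lborel"
      proof -
        interpret h: prob_space holding_measure by (rule prob_space_holding_measure)
        note [measurable] = measurable_holding_component
        show ?thesis unfolding of_bool_def by measurable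
      qed
      show "(\<lambda>t. ennreal (1 / t) * ?X t * indicator {0<..} t) \<in> borel_measurable lborel" by measurable
    qed
    also have "(\<integral>\<^sup>+t\<in>{0<..}. ennreal (1 / t) * ?X t \<partial>lborel) = ?I q"
      using nn_integral_path_holding_exp[of "\<lambda>i. rate k (q ! i)" n] rate_nonneg len by simp
    finally show ?thesis by (simp only: mult.assoc)
  qed
  have "(\<integral>\<^sup>+l. ?f l \<partial>loop_measure C \<kappa>) = (\<Sum>x\<in>UNIV. \<Sum>n. \<Sum>q\<in>?Q x n. walk_weight jp q *
    (of_bool (0 < n) * (walk_weight (marking m) q * ?I q)))"
    unfolding nn_integral_loop_measure_words[OF f]
    by (intro sum.cong refl suminf_cong arg_cong2[of _ _ _ _ "(*)"] term_eq)
  also have "\<dots> = (\<Sum>n. \<Sum>x\<in>UNIV. \<Sum>q\<in>?Q x n. walk_weight jp q * (of_bool (0 < n) * (walk_weight (marking m) q * ?I q)))"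
    by (rule suminf_sum[symmetric]) simp
  also have "\<dots> = (\<Sum>n. \<Sum>p\<in>{p\<in>words (range Some) n. p \<noteq> []}. cycle_weight (tilted k m) p / of_nat (length p))"
  proof (rule suminf_cong)
    fix n
    show "(\<Sum>x\<in>UNIV. \<Sum>q\<in>?Q x n. walk_weight jp q * (of_bool (0 < n) * (walk_weight (marking m) q * ?I q))) =
      (\<Sum>p\<in>{p\<in>words (range Some) n. p \<noteq> []}. cycle_weight (tilted k m) p / of_nat (length p))"
    proof (cases "n = 0")
      case True
      then have e: "{p\<in>words (range Some) n. p \<noteq> []} = {}" by (auto simp: words_def)
      show ?thesis unfolding e using True by simp
    next
      case False
      let ?W = "words (range Some) n"
      let ?w = "\<lambda>u v. jp u v * marking m u v"
      have cw: "cycle_weight jp p * cycle_weight (marking m) p = cycle_weight ?w p" for p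
        by (simp add: cycle_weight_def walk_weight_mult)
      \<comment> \<open>The list of a bridge repeats its base point, hence one factor more than
        \<open>p\<close> has letters.\<close>
      have I: "?I (p @ [hd p]) = (\<integral>\<^sup>+u\<in>{0..}. ((\<Prod>v\<leftarrow>p. ennreal (1 / (1 + rate k v + u))) * ennreal (1 / (1 + rate k (hd p) + u))) \<partial>lborel)" for p
        by (intro nn_integral_cong) (simp add: prod.list_conv_set_nth atLeast0LessThan nth_append)
      have "(\<Sum>x\<in>UNIV. \<Sum>q\<in>?Q x n. walk_weight jp q * (of_bool (0 < n) * (walk_weight (marking m) q * ?I q))) =
        (\<Sum>p\<in>?W. cycle_weight jp p * (walk_weight (marking m) (p @ [hd p]) * ?I (p @ [hd p])))"
        using sum_closed_words[of n "\<lambda>q. walk_weight (marking m) q * ?I q"] False by simp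
      also have "\<dots> = (\<Sum>p\<in>?W. cycle_weight ?w p * (\<integral>\<^sup>+u\<in>{0..}. ((\<Prod>v\<leftarrow>p. ennreal (1 / (1 + rate k v + u))) * ennreal (1 / (1 + rate k (hd p) + u))) \<partial>lborel))"
        unfolding I cw[symmetric] by (simp only: cycle_weight_def mult.assoc)
      also have "\<dots> = (\<Sum>p\<in>?W. cycle_weight ?w p * (\<Prod>v\<leftarrow>p. damping k v)) / of_nat n"
        using False by (intro nn_integral_rotation) simp
      also have "\<dots> = (\<Sum>p\<in>?W. cycle_weight (tilted k m) p / of_nat n)"
        unfolding cw[symmetric] cycle_weight_tilted divide_ennreal_def sum_distrib_right
        by (intro sum.cong refl) (simp only: mult_ac)
      also have "\<dots> = (\<Sum>p\<in>{p\<in>?W. p \<noteq> []}. cycle_weight (tilted k m) p / of_nat (length p))"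
        using False by (intro sum.cong) (auto simp: words_def)
      finally show ?thesis .
    qed
  qed
  also have "\<dots> = loop_mass (tilted k m) (range Some)"
    unfolding loop_mass_def by (rule nn_integral_lists_by_length[symmetric]) simp
  finally show ?thesis .
qed

text \<open>The chain makes no jump before \<open>t\<close> with probability exp (- t), which leads
  to a Frullani integral; the difference 1 - \<open>expm\<close> compensates the divergence of exp
  (- t) / t at 0.\<close>

lemma nn_integral_point_loops:
  "(\<integral>\<^sup>+l. ennreal (1 - expm (test_fun k m l)) * of_bool (length l < 2) \<partial>loop_measure C \<kappa>) =
    (\<Sum>x\<in>UNIV. ennreal (ln (1 + rate k (Some x))))"
proof -
  let ?f = "\<lambda>l. ennreal (1 - expm (test_fun k m l)) * of_bool (length l < 2)"
  have len: "(\<lambda>l. of_bool (length (l :: 'a path) < 2) :: ennreal) \<in> borel_measurable path_space"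
    by (rule measurable_compose[OF measurable_length_path]) simp
  have "(\<lambda>l. ennreal (1 - expm (test_fun k m l))) \<in> borel_measurable path_space" by measurable
  from borel_measurable_times_ennreal[OF this len]
  have f: "?f \<in> borel_measurable path_space" .
  let ?Q = "\<lambda>x n. {q\<in>prefixes x n. last q = Some x}"
  show ?thesis unfolding nn_integral_loop_measure_words[OF f]
  proof (rule sum.cong[OF refl])
    fix x
    let ?c = "rate k (Some x)"
    let ?T = "\<lambda>q. walk_weight jp q * (\<integral>\<^sup>+t\<in>{0<..}. ennreal (1 / t) * timed_integral ?f q t \<partial>lborel)"
    have zero: "timed_integral ?f q t = 0" if "q \<in> ?Q x n" "n \<noteq> 0" for q t n
      using that by (auto simp: timed_integral_def timed_path_def prefixes_def)
    have "(\<Sum>n. \<Sum>q\<in>?Q x n. ?T q) = (\<Sum>n\<in>{0}. \<Sum>q\<in>?Q x n. ?T q)"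
    proof (rule suminf_finite)
      fix n :: nat assume "n \<notin> {0}"
      then show "(\<Sum>q\<in>?Q x n. ?T q) = 0" using zero[of _ n] by (intro sum.neutral) simp
    qed simp
    also have "\<dots> = ?T [Some x]"
    proof -
      have "?Q x 0 = {[Some x]}" by (auto simp: prefixes_def length_Suc_conv)
      then show ?thesis by simp
    qed
    also have "\<dots> = (\<integral>\<^sup>+t\<in>{0<..}. ennreal ((1 - exp (- (?c * t))) * exp (- t) / t) \<partial>lborel)"
    proof (simp only: walk_weight.simps mult_1_left, rule nn_integral_cong)
      fix t :: real
      show "ennreal (1 / t) * timed_integral ?f [Some x] t * indicator {0<..} t =
        ennreal ((1 - exp (- (?c * t))) * exp (- t) / t) * indicator {0<..} t"
      proof (cases "t > 0")
        case True
        note [measurable] = measurable_holding_component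
        interpret h: prob_space holding_measure by (rule prob_space_holding_measure)
        \<comment> \<open>The holding times \<open>\<lambda>_. 1\<close> are dummies: without a
          jump, the only entry of the path is cut at \<open>t\<close>.\<close>
        have e: "ennreal (expm (test_fun k m (timed_path [Some x] (\<lambda>_. 1) t))) = ennreal (exp (- (?c * t)))"
          using expm_test_fun_timed_path[of "[Some x]" 0 "\<lambda>_. 1" t k m] True by simp
        then have e': "expm (test_fun k m [(Some x, t)]) = exp (- (?c * t))"
          by (simp add: timed_path_def)
        have "timed_integral ?f [Some x] t = (\<integral>\<^sup>+\<tau>. ennreal (1 - exp (- (?c * t))) * (\<Prod>i<1. of_bool (t < \<tau> i)) \<partial>holding_measure)"
          unfolding timed_integral_def timed_path_def using True
          by (intro nn_integral_cong) (simp add: e' mult.commute)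
        also have "\<dots> = ennreal (1 - exp (- (?c * t))) * (\<integral>\<^sup>+r. of_bool (t < r) \<partial>unit_exponential)"
          by (subst nn_integral_cmult, unfold of_bool_def, measurable, subst nn_integral_holding_prod) auto
        also have "(\<integral>\<^sup>+r. of_bool (t < r) \<partial>unit_exponential) = ennreal (exp (- t))"
        proof -
          have "(\<integral>\<^sup>+r. of_bool (t < r) \<partial>unit_exponential) = (\<integral>\<^sup>+r. ennreal (exp (- r)) * indicator {t..} r \<partial>lborel)"
          proof (subst nn_integral_unit_exponential, (simp add: of_bool_def; fail), rule nn_integral_cong_AE)
            show "AE r in lborel. of_bool (t < r) * ennreal (exp (- r)) * indicator {0..} r = ennreal (exp (- r)) * indicator {t..} r"
              using AE_lborel_singleton[of t] by eventually_elim (use True in \<open>auto split: split_indicator\<close>)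
          qed
          also have "\<dots> = ennreal (exp (- t))" by (rule nn_integral_exp_tail)
          finally show ?thesis by simp
        qed
        finally have "timed_integral ?f [Some x] t = ennreal ((1 - exp (- (?c * t))) * exp (- t))"
          by (simp add: ennreal_mult'')
        moreover have "0 \<le> 1 - exp (- (?c * t))" using rate_nonneg[of k "Some x"] True by simp
        ultimately show ?thesis using True by (simp add: ennreal_mult[symmetric])
      qed simp
    qed
    also have "\<dots> = ennreal (ln (1 + ?c))" by (rule nn_integral_frullani[OF rate_nonneg])
    finally show "(\<Sum>n. \<Sum>q\<in>?Q x n. ?T q) = ennreal (ln (1 + ?c))" .
  qed
qed

lemma tilted_0: "tilted (\<lambda>_. 0) (\<lambda>_. 0) = jp"
  by (simp add: fun_eq_iff tilted_def damping_def marking_def rate_def split: option.split)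

lemma test_fun_0: "test_fun (\<lambda>_. 0) (\<lambda>_. 0) l = 0"
  by (simp add: test_fun_def)

text \<open>On loops with a jump, the integral of 1 - \<open>expm\<close> is the mass for
  \<open>jp\<close> minus that for \<open>tilted k m\<close>, written as a sum because subtraction
  is delicate for extended reals. Loops reduced to a point supply the dampings of all vertices, as
  exp (- ln (1 + r)) = 1 / (1 + r).\<close>

lemma laplace_loop_measure:
  "ennreal (expm (\<integral>\<^sup>+l. ennreal (1 - expm (test_fun k m l)) \<partial>loop_measure C \<kappa>)) * loop_exp jp (range Some) =
    loop_factor k m (range Some)"
proof -
  let ?\<mu> = "loop_measure C \<kappa>"
  let ?e = "\<lambda>l. expm (test_fun k m l)"
  have len: "(\<lambda>l. of_bool (length (l :: 'a path) < 2) :: ennreal) \<in> borel_measurable ?\<mu>"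
    "(\<lambda>l. of_bool (2 \<le> length (l :: 'a path)) :: ennreal) \<in> borel_measurable ?\<mu>"
    unfolding measurable_cong_sets[OF sets_loop_measure refl]
    by (rule measurable_compose[OF measurable_length_path], simp)+
  have m: "(\<lambda>l. ennreal (1 - ?e l)) \<in> borel_measurable ?\<mu>" "(\<lambda>l. ennreal (?e l)) \<in> borel_measurable ?\<mu>"
    unfolding measurable_cong_sets[OF sets_loop_measure refl] by measurable
  let ?R = "\<integral>\<^sup>+l. ennreal (1 - ?e l) * of_bool (2 \<le> length l) \<partial>?\<mu>"
  let ?P = "\<Sum>x\<in>UNIV. ennreal (ln (1 + rate k (Some x)))"
  have "(\<integral>\<^sup>+l. ennreal (1 - ?e l) \<partial>?\<mu>) =
    (\<integral>\<^sup>+l. ennreal (1 - ?e l) * of_bool (length l < 2) + ennreal (1 - ?e l) * of_bool (2 \<le> length l) \<partial>?\<mu>)"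
    by (intro nn_integral_cong) (auto simp: of_bool_def)
  also have "\<dots> = ?P + ?R"
    using borel_measurable_times_ennreal[OF m(1) len(1)] borel_measurable_times_ennreal[OF m(1) len(2)]
    by (subst nn_integral_add) (simp_all add: nn_integral_point_loops)
  finally have total: "(\<integral>\<^sup>+l. ennreal (1 - ?e l) \<partial>?\<mu>) = ?P + ?R" .
  have "loop_mass jp (range Some) = (\<integral>\<^sup>+l. of_bool (2 \<le> length l) \<partial>?\<mu>)"
    using nn_integral_long_loops[of "\<lambda>_. 0" "\<lambda>_. 0"] by (simp add: tilted_0 test_fun_0)
  also have "\<dots> = (\<integral>\<^sup>+l. ennreal (1 - ?e l) * of_bool (2 \<le> length l) + ennreal (?e l) * of_bool (2 \<le> length l) \<partial>?\<mu>)"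
    using expm_le_1 by (intro nn_integral_cong) (auto simp: of_bool_def ennreal_plus[symmetric] simp del: ennreal_plus)
  also have "\<dots> = ?R + loop_mass (tilted k m) (range Some)"
    using borel_measurable_times_ennreal[OF m(1) len(2)] borel_measurable_times_ennreal[OF m(2) len(2)]
    by (subst nn_integral_add) (simp_all add: nn_integral_long_loops)
  finally have mass: "loop_mass jp (range Some) = ?R + loop_mass (tilted k m) (range Some)" .
  \<comment> \<open>Finiteness for \<open>jp\<close> passes to both summands, which from here on are
    real numbers.\<close>
  have "loop_mass jp (range Some) < \<top>"
    using loop_mass_tilted_finite[of "range Some" "\<lambda>_. 0" "\<lambda>_. 0"] by (simp add: tilted_0)
  then obtain r a where r: "?R = ennreal r" "r \<ge> 0" and a: "loop_mass (tilted k m) (range Some) = ennreal a" "a \<ge> 0"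
    unfolding mass by (cases ?R; cases "loop_mass (tilted k m) (range Some)") auto
  have jp: "loop_exp jp (range Some) = ennreal (exp (r + a))"
    using r a unfolding loop_exp_def mass by (simp add: ennreal_plus[symmetric] del: ennreal_plus)
  have ti: "loop_exp (tilted k m) (range Some) = ennreal (exp a)"
    using a by (simp add: loop_exp_def)
  have d: "(\<Prod>v\<in>range Some. damping k v) = ennreal (\<Prod>x\<in>UNIV. 1 / (1 + rate k (Some x)))"
    using rate_nonneg[of k] by (simp add: prod.reindex damping_def prod_ennreal add_nonneg_nonneg)
  have P: "?P = ennreal (\<Sum>x\<in>UNIV. ln (1 + rate k (Some x)))"
    using rate_nonneg[of k] by (intro sum_ennreal) simp
  have "expm (?P + ?R) = expm ?P * exp (- r)" by (simp add: expm_add r expm_ennreal)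
  also have "expm ?P = (\<Prod>x\<in>UNIV. 1 / (1 + rate k (Some x)))"
  proof -
    have pos: "1 + rate k v > 0" for v using rate_nonneg[of k v] by simp
    have "expm ?P = (\<Prod>x\<in>UNIV. exp (- ln (1 + rate k (Some x))))"
      using rate_nonneg[of k] unfolding expm_sum by (intro prod.cong refl expm_ennreal) simp
    also have "\<dots> = (\<Prod>x\<in>UNIV. 1 / (1 + rate k (Some x)))"
      using pos by (intro prod.cong refl) (simp add: exp_minus divide_inverse)
    finally show ?thesis .
  qed
  finally have "ennreal (expm (?P + ?R)) * loop_exp jp (range Some) =
    ennreal ((\<Prod>x\<in>UNIV. 1 / (1 + rate k (Some x))) * exp (- r) * exp (r + a))"
    unfolding jp by (simp add: ennreal_mult'')
  also have "(\<Prod>x\<in>UNIV. 1 / (1 + rate k (Some x))) * exp (- r) * exp (r + a) = (\<Prod>x\<in>UNIV. 1 / (1 + rate k (Some x))) * exp a"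
    by (simp add: mult.assoc exp_add[symmetric])
  also have "ennreal \<dots> = loop_factor k m (range Some)"
    unfolding loop_factor_def ti d by (simp add: ennreal_mult'')
  finally show ?thesis unfolding total .
qed

end

section \<open>Comparison of the two networks\<close>

lemma nn_integral_distr_target:
  assumes "T \<in> measurable M M'" "f \<in> borel_measurable M'"
  shows "(\<integral>\<^sup>+x. f x \<partial>distr M M' T) = (\<integral>\<^sup>+x. f (T x) \<partial>M)"
  using assms by (intro nn_integral_distr) auto

context killed_chain
begin

lemma laplace_wilson_network:
  "laplace C k m (wilson_network C \<kappa> z xs) = expm (\<Sum>l\<leftarrow>snd (wilson_from z xs {}). test_fun k m l)"
proof -
  have "(\<Sum>l\<leftarrow>ls. test_fun k m l) = (\<Sum>x\<in>UNIV. of_nat (k x) * (\<Sum>l\<leftarrow>ls. local_time C \<kappa> l x)) +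
    (\<Sum>e\<in>edge_pairs C. of_nat (m e) * (\<Sum>l\<leftarrow>ls. of_nat (traversals l (fst e) (snd e))))" for ls
    by (induction ls) (auto simp: test_fun_def distrib_left sum.distrib ac_simps)
  then show ?thesis
    by (simp add: laplace_def wilson_network_eq case_prod_beta)
qed

lemma laplace_network:
  "laplace C k m (network C \<kappa> \<Lambda> (\<lambda>l. l)) = expm (\<integral>\<^sup>+l. test_fun k m l \<partial>count_space \<Lambda>)"
proof -
  have "(\<integral>\<^sup>+l. test_fun k m l \<partial>count_space \<Lambda>) =
    (\<Sum>x\<in>UNIV. of_nat (k x) * (\<integral>\<^sup>+l. local_time C \<kappa> l x \<partial>count_space \<Lambda>)) +
    (\<Sum>e\<in>edge_pairs C. of_nat (m e) * (\<integral>\<^sup>+l. of_nat (traversals l (fst e) (snd e)) \<partial>count_space \<Lambda>))"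
    unfolding test_fun_def
    by (simp add: nn_integral_add nn_integral_sum nn_integral_cmult)
  then show ?thesis
    by (simp add: laplace_def network_def case_prod_beta)
qed

context
  fixes M :: "'w measure" and Z :: "'w \<Rightarrow> 'a \<Rightarrow> 'a trajectory"
  assumes chains: "independent_chains C \<kappa> M Z"
begin

lemma prob_space_chains: "prob_space M"
  using chains by (simp add: independent_chains_def)

lemma measurable_chains: "Z \<in> measurable M (\<Pi>\<^sub>M x\<in>UNIV. trajectory_space)"
proof -
  interpret prob_space M by (rule prob_space_chains)
  have "indep_vars (\<lambda>_. trajectory_space) (\<lambda>x \<omega>. Z \<omega> x) UNIV"
    using chains by (simp add: independent_chains_def)
  then have "(\<lambda>\<omega>. Z \<omega> x) \<in> measurable M trajectory_space" for x
    by (auto simp: indep_vars_def)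
  then show ?thesis by (intro measurable_PiM_single') (auto intro: measurable_space)
qed

text \<open>Independence is the product form of the joint law; it transports the run of the
  algorithm to the product space on which the recursion was integrated.\<close>

lemma distr_chains: "distr M (\<Pi>\<^sub>M x\<in>UNIV. trajectory_space) Z = (\<Pi>\<^sub>M x\<in>UNIV. chain_law C \<kappa> x)"
proof -
  interpret prob_space M by (rule prob_space_chains)
  have i: "indep_vars (\<lambda>_. trajectory_space) (\<lambda>x \<omega>. Z \<omega> x) UNIV"
    and d: "distr M trajectory_space (\<lambda>\<omega>. Z \<omega> x) = chain_law C \<kappa> x" for x
    using chains by (auto simp: independent_chains_def)
  have rv: "(\<lambda>\<omega>. Z \<omega> x) \<in> measurable M trajectory_space" for x
    using i by (auto simp: indep_vars_def)
  have "distr M (\<Pi>\<^sub>M x\<in>UNIV. trajectory_space) (\<lambda>\<omega>. \<lambda>x\<in>UNIV. Z \<omega> x) =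
    (\<Pi>\<^sub>M x\<in>UNIV. distr M trajectory_space (\<lambda>\<omega>. Z \<omega> x))"
    by (subst indep_vars_iff_distr_eq_PiM[symmetric]) (use i rv in auto)
  then show ?thesis by (simp add: d restrict_def)
qed

lemma measurable_network_of_chains:
  "(\<lambda>\<omega>. wilson_network C \<kappa> (Z \<omega>) xs) \<in> measurable M (network_space C)"
  by (rule measurable_compose[OF measurable_chains measurable_wilson_network]) simp

lemma measurable_tree_of_chains:
  "(\<lambda>\<omega>. wilson_tree (Z \<omega>) xs) \<in> measurable M (count_space UNIV)"
  unfolding wilson_tree_eq
  by (rule measurable_compose[OF measurable_chains measurable_wilson_from(1)[OF measurable_test_fun]]) simp

lemma laplace_wilson_joint:
  assumes xs: "distinct xs" "set xs = UNIV"
  shows "(\<integral>\<^sup>+\<omega>. of_bool (wilson_tree (Z \<omega>) xs = T) * ennreal (laplace C k m (wilson_network C \<kappa> (Z \<omega>) xs)) \<partial>M) =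
    tree_weight xs {} T * loop_factor k m (range Some)"
proof -
  let ?P = "\<Pi>\<^sub>M x\<in>UNIV. (trajectory_space :: 'a trajectory measure)"
  let ?f = "\<lambda>z. of_bool (fst (wilson_from z xs {}) = T) *
    ennreal (expm (\<Sum>l\<leftarrow>snd (wilson_from z xs {}). test_fun k m l))"
  have f: "?f \<in> borel_measurable ?P"
  proof -
    note [measurable] = measurable_wilson_from[OF measurable_test_fun subset_UNIV]
    show ?thesis unfolding of_bool_def by measurable
  qed
  have "(\<integral>\<^sup>+\<omega>. of_bool (wilson_tree (Z \<omega>) xs = T) * ennreal (laplace C k m (wilson_network C \<kappa> (Z \<omega>) xs)) \<partial>M) =
    (\<integral>\<^sup>+z. ?f z \<partial>distr M ?P Z)"
    by (subst nn_integral_distr_target[OF measurable_chains f]) (simp add: laplace_wilson_network wilson_tree_eq)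
  also have "\<dots> = tree_weight xs {} T * loop_factor k m (- tree_vertices {})"
    unfolding distr_chains
    using nn_integral_wilson_from[OF xs(1), of "{}" T k m] xs(2)
    by (simp add: tree_vertices_def Compl_eq_Diff_UNIV UNIV_option_conv)
  also have "- tree_vertices {} = range Some"
    by (auto simp: tree_vertices_def) (metis notin_range_Some rangeI)
  finally show ?thesis .
qed

text \<open>Only the first factor on the right depends on \<open>T\<close>, whence the independence of the network and
  the tree; the second one does not depend on the ordering.\<close>

lemma laplace_wilson:
  assumes xs: "distinct xs" "set xs = UNIV"
  shows "(\<integral>\<^sup>+\<omega>. of_bool (wilson_tree (Z \<omega>) xs = T) * ennreal (laplace C k m (wilson_network C \<kappa> (Z \<omega>) xs)) \<partial>M) * loop_exp jp (range Some) =
      emeasure M {\<omega> \<in> space M. wilson_tree (Z \<omega>) xs = T} * loop_factor k m (range Some)"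
    and "(\<integral>\<^sup>+\<omega>. ennreal (laplace C k m (wilson_network C \<kappa> (Z \<omega>) xs)) \<partial>M) * loop_exp jp (range Some) =
      loop_factor k m (range Some)"
proof -
  interpret prob_space M by (rule prob_space_chains)
  note t[measurable] = measurable_tree_of_chains[of xs]
  let ?L = "\<lambda>k m \<omega>. ennreal (laplace C k m (wilson_network C \<kappa> (Z \<omega>) xs))"
  let ?I = "\<lambda>T \<omega>. of_bool (wilson_tree (Z \<omega>) xs = T) :: ennreal"
  have L[measurable]: "?L k m \<in> borel_measurable M" for k m
  proof -
    have "(\<lambda>z. ennreal (expm (\<Sum>l\<leftarrow>snd (wilson_from z xs {}). test_fun k m l))) \<in> borel_measurable (\<Pi>\<^sub>M x\<in>UNIV. trajectory_space)"
      using measurable_wilson_from(2)[OF measurable_test_fun subset_UNIV] by measurable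
    from measurable_compose[OF measurable_chains this] show ?thesis
      by (simp add: laplace_wilson_network)
  qed
  have I: "?I T \<in> borel_measurable M" for T
    by (rule measurable_compose[OF t]) simp
  \<comment> \<open>At zero parameters there is neither damping nor marking, and the joint formula
    gives the law of the tree.\<close>
  have 0: "loop_factor (\<lambda>_. 0) (\<lambda>_. 0) U = loop_exp jp U" for U
  proof -
    have "damping (\<lambda>_. 0) v = 1" for v by (simp add: damping_def rate_def split: option.split)
    then show ?thesis by (simp add: loop_factor_def tilted_0)
  qed
  have l0: "laplace C (\<lambda>_. 0) (\<lambda>_. 0) \<eta> = 1" for \<eta>
    by (simp add: laplace_def)
  have P: "emeasure M {\<omega> \<in> space M. wilson_tree (Z \<omega>) xs = T} = tree_weight xs {} T * loop_exp jp (range Some)" for T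
  proof -
    have "{\<omega> \<in> space M. wilson_tree (Z \<omega>) xs = T} \<in> sets M" by measurable
    then have "emeasure M {\<omega> \<in> space M. wilson_tree (Z \<omega>) xs = T} = (\<integral>\<^sup>+\<omega>. indicator {\<omega> \<in> space M. wilson_tree (Z \<omega>) xs = T} \<omega> \<partial>M)"
      by simp
    also have "\<dots> = (\<integral>\<^sup>+\<omega>. ?I T \<omega> * ?L (\<lambda>_. 0) (\<lambda>_. 0) \<omega> \<partial>M)"
      by (intro nn_integral_cong) (auto simp: l0 indicator_def)
    also have "\<dots> = tree_weight xs {} T * loop_exp jp (range Some)"
      unfolding laplace_wilson_joint[OF xs] 0 ..
    finally show ?thesis .
  qed
  show one: "(\<integral>\<^sup>+\<omega>. ?I T \<omega> * ?L k m \<omega> \<partial>M) * loop_exp jp (range Some) =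
      emeasure M {\<omega> \<in> space M. wilson_tree (Z \<omega>) xs = T} * loop_factor k m (range Some)" for T
    unfolding laplace_wilson_joint[OF xs] P by (simp add: mult_ac)
  \<comment> \<open>The tree takes finitely many values; summing over them removes the weights of
    the trees without evaluating them.\<close>
  have sum1: "(\<Sum>T\<in>UNIV. ?I T \<omega>) = 1" for \<omega>
    by (simp add: of_bool_def)
  have "(\<Sum>T\<in>UNIV. emeasure M {\<omega> \<in> space M. wilson_tree (Z \<omega>) xs = T}) = (\<Sum>T\<in>UNIV. \<integral>\<^sup>+\<omega>. ?I T \<omega> \<partial>M)"
  proof (rule sum.cong[OF refl])
    fix T
    have "{\<omega> \<in> space M. wilson_tree (Z \<omega>) xs = T} \<in> sets M" by measurable
    then have "emeasure M {\<omega> \<in> space M. wilson_tree (Z \<omega>) xs = T} =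
      (\<integral>\<^sup>+\<omega>. indicator {\<omega> \<in> space M. wilson_tree (Z \<omega>) xs = T} \<omega> \<partial>M)" by simp
    also have "\<dots> = (\<integral>\<^sup>+\<omega>. ?I T \<omega> \<partial>M)"
      by (intro nn_integral_cong) (auto simp: indicator_def)
    finally show "emeasure M {\<omega> \<in> space M. wilson_tree (Z \<omega>) xs = T} = (\<integral>\<^sup>+\<omega>. ?I T \<omega> \<partial>M)" .
  qed
  also have "\<dots> = (\<integral>\<^sup>+\<omega>. (\<Sum>T\<in>UNIV. ?I T \<omega>) \<partial>M)"
    by (rule nn_integral_sum[symmetric]) (rule I)
  also have "\<dots> = 1" unfolding sum1 by (simp add: emeasure_space_1)
  finally have total: "(\<Sum>T\<in>UNIV. emeasure M {\<omega> \<in> space M. wilson_tree (Z \<omega>) xs = T}) = 1" .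
  have "(\<integral>\<^sup>+\<omega>. ?L k m \<omega> \<partial>M) = (\<integral>\<^sup>+\<omega>. (\<Sum>T\<in>UNIV. ?I T \<omega> * ?L k m \<omega>) \<partial>M)"
    by (intro nn_integral_cong) (simp only: sum_distrib_right[symmetric] sum1 mult_1_left)
  also have "\<dots> = (\<Sum>T\<in>UNIV. \<integral>\<^sup>+\<omega>. ?I T \<omega> * ?L k m \<omega> \<partial>M)"
    by (rule nn_integral_sum) (intro borel_measurable_times_ennreal I L)
  finally show "(\<integral>\<^sup>+\<omega>. ?L k m \<omega> \<partial>M) * loop_exp jp (range Some) = loop_factor k m (range Some)"
    by (simp only: sum_distrib_right one) (simp only: sum_distrib_right[symmetric] total mult_1_left)
qed

end

text \<open>The normalising factor is the exponential of a real number, hence neither 0 nor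
  infinite.\<close>

lemma loop_exp_cancel:
  assumes "a * loop_exp w U = b * loop_exp w U" shows "a = b"
proof -
  have "loop_exp w U \<noteq> 0" "loop_exp w U \<noteq> \<top>" by (auto simp: loop_exp_def)
  then show ?thesis using assms by (metis ennreal_mult_cancel_left mult.commute)
qed

end

lemma measurable_laplace [measurable]:
  fixes C :: "'a::finite \<Rightarrow> 'a \<Rightarrow> real"
  shows "laplace C k m \<in> borel_measurable (network_space C)"
proof -
  have "(\<lambda>v :: real ^ ('a + 'a \<times> 'a). 1 * (\<Prod>i\<in>UNIV. (v $ i) ^ case_sum k m i)) \<in> borel_measurable borel"
    by (rule borel_measurable_continuous_onI[OF continuous_on_monomial_span[OF monomial_span.monomial]])
  from measurable_compose[OF measurable_encode this]
  show ?thesis by (simp add: monomial_encode o_def)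
qed

theorem corollary6:
  fixes C :: "'a::finite \<Rightarrow> 'a \<Rightarrow> real" and \<kappa> :: "'a \<Rightarrow> real"
    and M :: "'w measure" and Z :: "'w \<Rightarrow> 'a \<Rightarrow> 'a trajectory" and xs :: "'a list"
  assumes C_sym: "\<And>x y. C x y = C y x"
    and C_nonneg: "\<And>x y. C x y \<ge> 0"
    and C_diag: "\<And>x. C x x = 0"
    and connected: "\<And>x y. (x, y) \<in> (edge_pairs C)\<^sup>*"
    and kappa_nonneg: "\<And>x. \<kappa> x \<ge> 0"
    and kappa_nonzero: "\<exists>x. \<kappa> x \<noteq> 0"
    and chains: "independent_chains C \<kappa> M Z"
    and ordering: "distinct xs" "set xs = UNIV"
  shows "independent_rvs M
           (network_space C) (\<lambda>\<omega>. wilson_network C \<kappa> (Z \<omega>) xs)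
           (count_space UNIV) (\<lambda>\<omega>. wilson_tree (Z \<omega>) xs)
       \<and> (\<forall>ys. distinct ys \<and> set ys = UNIV \<longrightarrow>
            distr M (network_space C) (\<lambda>\<omega>. wilson_network C \<kappa> (Z \<omega>) ys) =
            distr M (network_space C) (\<lambda>\<omega>. wilson_network C \<kappa> (Z \<omega>) xs))
       \<and> (\<forall>(N :: 'v measure) \<Lambda>. poisson_point_process N (loop_measure C \<kappa>) \<Lambda> \<longrightarrow>
            (\<lambda>\<omega>. network C \<kappa> (\<Lambda> \<omega>) (\<lambda>l. l)) \<in> measurable N (network_space C) \<and>
            distr M (network_space C) (\<lambda>\<omega>. wilson_network C \<kappa> (Z \<omega>) xs) =
            distr N (network_space C) (\<lambda>\<omega>. network C \<kappa> (\<Lambda> \<omega>) (\<lambda>l. l)))"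
proof -
  interpret killed_chain C \<kappa>
    by (rule killed_chain.intro) fact+
  interpret M: prob_space M by (rule prob_space_chains[OF chains])
  let ?W = "\<lambda>xs \<omega>. wilson_network C \<kappa> (Z \<omega>) xs" and ?Y = "\<lambda>\<omega>. wilson_tree (Z \<omega>) xs"
  have W: "?W xs \<in> measurable M (network_space C)" for xs
    by (rule measurable_network_of_chains[OF chains])
  have Y[measurable]: "?Y \<in> measurable M (count_space UNIV)"
    by (rule measurable_tree_of_chains[OF chains])
  have lap: "(\<lambda>\<eta>. ennreal (laplace C k m \<eta>)) \<in> borel_measurable (network_space C)" for k m
    by measurable
  have fin: "finite_measure (distr M (network_space C) (?W xs))" for xs
    by (rule M.finite_measure_distr[OF W])

  have indep: "emeasure M (?W xs -` A \<inter> space M \<inter> {\<omega> \<in> space M. ?Y \<omega> = T}) =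
    emeasure M (?W xs -` A \<inter> space M) * emeasure M {\<omega> \<in> space M. ?Y \<omega> = T}"
    if A: "A \<in> sets (network_space C)" for A T
  proof -
    let ?E = "{\<omega> \<in> space M. ?Y \<omega> = T}"
    have E: "?E \<in> sets M" by measurable
    have iE: "indicator ?E \<in> borel_measurable M" using E by simp
    \<comment> \<open>The law of the network on the event that the tree is \<open>T\<close>, against
      its law scaled by the probability of this event: their equality for every \<open>T\<close> is
      the independence.\<close>
    let ?M1 = "distr (density M (indicator ?E)) (network_space C) (?W xs)"
    let ?M2 = "density (distr M (network_space C) (?W xs)) (\<lambda>_. emeasure M ?E)"
    have W': "?W xs \<in> measurable (density M (indicator ?E)) (network_space C)"
      using W by simp
    have "?M1 = ?M2"
    proof (rule network_measure_eqI)
      show "finite_measure ?M1"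
      proof (rule finite_measure.finite_measure_distr[OF _ W'], rule finite_measureI)
        show "emeasure (density M (indicator ?E)) (space (density M (indicator ?E))) \<noteq> \<infinity>"
        proof -
          have "emeasure (density M (indicator ?E)) (space M) = (\<integral>\<^sup>+\<omega>. indicator ?E \<omega> * indicator (space M) \<omega> \<partial>M)"
            by (rule emeasure_density[OF iE sets.top])
          also have "\<dots> = (\<integral>\<^sup>+\<omega>. indicator ?E \<omega> \<partial>M)"
            by (intro nn_integral_cong) simp
          also have "\<dots> = emeasure M ?E" using E by simp
          finally show ?thesis by simp
        qed
      qed
      show "finite_measure ?M2"
        by (rule finite_measureI)
          (use finite_measure.emeasure_finite[OF fin] in \<open>simp add: emeasure_density_const ennreal_mult_eq_top_iff M.emeasure_eq_measure\<close>)
      fix k m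
      have "(\<integral>\<^sup>+\<eta>. ennreal (laplace C k m \<eta>) \<partial>?M1) = (\<integral>\<^sup>+\<omega>. ennreal (laplace C k m (?W xs \<omega>)) \<partial>density M (indicator ?E))"
        by (rule nn_integral_distr_target[OF W' lap])
      also have "\<dots> = (\<integral>\<^sup>+\<omega>. indicator ?E \<omega> * ennreal (laplace C k m (?W xs \<omega>)) \<partial>M)"
        by (rule nn_integral_density[OF iE measurable_compose[OF W lap]])
      also have "\<dots> = (\<integral>\<^sup>+\<omega>. of_bool (?Y \<omega> = T) * ennreal (laplace C k m (?W xs \<omega>)) \<partial>M)"
        by (intro nn_integral_cong) (auto simp: indicator_def)
      \<comment> \<open>Multiplied by \<open>loop_exp jp (range Some)\<close>, both sides are the
        probability of the event times \<open>loop_factor k m (range Some)\<close>.\<close>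
      also have "\<dots> = emeasure M ?E * (\<integral>\<^sup>+\<omega>. ennreal (laplace C k m (?W xs \<omega>)) \<partial>M)"
        by (rule loop_exp_cancel[of _ jp "range Some"])
          (simp only: laplace_wilson[OF chains ordering] mult.assoc)
      also have "\<dots> = emeasure M ?E * (\<integral>\<^sup>+\<eta>. ennreal (laplace C k m \<eta>) \<partial>distr M (network_space C) (?W xs))"
        by (simp only: nn_integral_distr_target[OF W lap])
      also have "\<dots> = (\<integral>\<^sup>+\<eta>. ennreal (laplace C k m \<eta>) \<partial>?M2)"
        using lap by (simp add: nn_integral_density nn_integral_cmult)
      finally show "(\<integral>\<^sup>+\<eta>. ennreal (laplace C k m \<eta>) \<partial>?M1) = (\<integral>\<^sup>+\<eta>. ennreal (laplace C k m \<eta>) \<partial>?M2)" .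
    qed simp_all
    then have "emeasure ?M1 A = emeasure ?M2 A" by simp
    moreover have "emeasure ?M1 A = emeasure M (?W xs -` A \<inter> space M \<inter> ?E)"
    proof -
      have S: "?W xs -` A \<inter> space M \<in> sets M" by (rule measurable_sets[OF W A])
      have "emeasure ?M1 A = (\<integral>\<^sup>+\<omega>. indicator ?E \<omega> * indicator (?W xs -` A \<inter> space M) \<omega> \<partial>M)"
        using emeasure_distr[OF W' A] emeasure_density[OF iE S] by simp
      also have "\<dots> = (\<integral>\<^sup>+\<omega>. indicator (?W xs -` A \<inter> space M \<inter> ?E) \<omega> \<partial>M)"
        by (intro nn_integral_cong) (auto simp: indicator_def)
      finally show ?thesis using S E by simp
    qed
    moreover have "emeasure ?M2 A = emeasure M ?E * emeasure M (?W xs -` A \<inter> space M)"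
      using A emeasure_distr[OF W A] by (simp add: emeasure_density_const)
    ultimately show ?thesis by (simp add: mult.commute)
  qed

  have "independent_rvs M (network_space C) (?W xs) (count_space UNIV) ?Y"
    unfolding independent_rvs_def
  proof (intro conjI W Y)
    let ?FW = "{?W xs -` A \<inter> space M | A. A \<in> sets (network_space C)}"
    let ?FY = "{?Y -` B \<inter> space M | B. B \<in> sets (count_space UNIV)}"
    have FW: "sigma_sets (space M) ?FW = ?FW"
      using sets_vimage_algebra2[of "?W xs" "space M" "network_space C"] measurable_space[OF W]
      by (simp add: sets_vimage_algebra)
    have FY: "sigma_sets (space M) ?FY = ?FY"
      using sets_vimage_algebra2[of ?Y "space M" "count_space UNIV"] by (simp add: sets_vimage_algebra)
    show "M.indep_set (sigma_sets (space M) ?FW) (sigma_sets (space M) ?FY)"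
      unfolding FW FY
    proof (rule M.indep_setI)
      show "?FW \<subseteq> M.events" using measurable_sets[OF W] by auto
      show "?FY \<subseteq> M.events" using measurable_sets[OF Y] by auto
      fix a b assume "a \<in> ?FW" "b \<in> ?FY"
      then obtain A B where a: "a = ?W xs -` A \<inter> space M" "A \<in> sets (network_space C)"
        and b: "b = ?Y -` B \<inter> space M" by auto
      have aM: "a \<in> sets M" using measurable_sets[OF W a(2)] by (simp add: a(1))
      let ?E = "\<lambda>T. {\<omega> \<in> space M. ?Y \<omega> = T}"
      have E: "?E T \<in> sets M" for T by measurable
      \<comment> \<open>Every event about the tree is a finite disjoint union of the events
        \<open>?E T\<close>.\<close>
      have b': "b = (\<Union>T\<in>B. ?E T)" by (auto simp: b)
      have "emeasure M (a \<inter> b) = emeasure M (\<Union>T\<in>B. a \<inter> ?E T)"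
        unfolding b' by (simp only: Int_UN_distrib)
      also have "\<dots> = (\<Sum>T\<in>B. emeasure M (a \<inter> ?E T))"
        using aM E by (intro sum_emeasure[symmetric]) (auto simp: disjoint_family_on_def)
      also have "\<dots> = emeasure M a * (\<Sum>T\<in>B. emeasure M (?E T))"
        unfolding sum_distrib_left a(1) by (intro sum.cong refl indep[OF a(2)])
      also have "(\<Sum>T\<in>B. emeasure M (?E T)) = emeasure M b"
        unfolding b' using E by (intro sum_emeasure) (auto simp: disjoint_family_on_def)
      finally show "M.prob (a \<inter> b) = M.prob a * M.prob b"
        by (simp add: M.emeasure_eq_measure ennreal_mult[symmetric])
    qed
  qed

  moreover have "distr M (network_space C) (?W ys) = distr M (network_space C) (?W xs)"
    if "distinct ys" "set ys = UNIV" for ys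
  proof (rule network_measure_eqI[OF fin fin])
    fix k m
    show "(\<integral>\<^sup>+\<eta>. ennreal (laplace C k m \<eta>) \<partial>distr M (network_space C) (?W ys)) =
      (\<integral>\<^sup>+\<eta>. ennreal (laplace C k m \<eta>) \<partial>distr M (network_space C) (?W xs))"
      unfolding nn_integral_distr_target[OF W lap]
      \<comment> \<open>Multiplied by \<open>loop_exp jp (range Some)\<close>, either transform is
        \<open>loop_factor k m (range Some)\<close>, in which no ordering occurs.\<close>
      by (rule loop_exp_cancel[of _ jp "range Some"])
        (simp only: laplace_wilson(2)[OF chains ordering] laplace_wilson(2)[OF chains that])
  qed simp_all

  moreover have "(\<lambda>\<omega>. network C \<kappa> (\<Lambda> \<omega>) (\<lambda>l. l)) \<in> measurable N (network_space C) \<and>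
      distr M (network_space C) (?W xs) = distr N (network_space C) (\<lambda>\<omega>. network C \<kappa> (\<Lambda> \<omega>) (\<lambda>l. l))"
    if ppp: "poisson_point_process N (loop_measure C \<kappa>) \<Lambda>" for N :: "'v measure" and \<Lambda>
  proof -
    interpret N: prob_space N by (rule ppp_prob[OF ppp])
    have path: "f \<in> borel_measurable (loop_measure C \<kappa>)" if "f \<in> borel_measurable path_space" for f :: "'a path \<Rightarrow> ennreal"
      using that by (simp add: measurable_cong_sets[OF sets_loop_measure refl])
    have net: "(\<lambda>\<omega>. network C \<kappa> (\<Lambda> \<omega>) (\<lambda>l. l)) \<in> measurable N (network_space C)"
      unfolding network_def
      by (intro measurable_network_spaceI laplace_functional(1)[OF ppp path] measurable_local_time measurable_traversals)
    have "distr M (network_space C) (?W xs) = distr N (network_space C) (\<lambda>\<omega>. network C \<kappa> (\<Lambda> \<omega>) (\<lambda>l. l))"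
    proof (rule network_measure_eqI[OF fin N.finite_measure_distr[OF net]])
      fix k m
      have *: "(\<integral>\<^sup>+\<omega>. ennreal (laplace C k m (network C \<kappa> (\<Lambda> \<omega>) (\<lambda>l. l))) \<partial>N) =
        ennreal (expm (\<integral>\<^sup>+l. ennreal (1 - expm (test_fun k m l)) \<partial>loop_measure C \<kappa>))"
        unfolding laplace_network by (rule laplace_functional(2)[OF ppp path[OF measurable_test_fun]])
      show "(\<integral>\<^sup>+\<eta>. ennreal (laplace C k m \<eta>) \<partial>distr M (network_space C) (?W xs)) =
        (\<integral>\<^sup>+\<eta>. ennreal (laplace C k m \<eta>) \<partial>distr N (network_space C) (\<lambda>\<omega>. network C \<kappa> (\<Lambda> \<omega>) (\<lambda>l. l)))"
        unfolding nn_integral_distr_target[OF W lap] nn_integral_distr_target[OF net lap] *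
        \<comment> \<open>The Poisson transform has the same product with
          \<open>loop_exp jp (range Some)\<close>.\<close>
        by (rule loop_exp_cancel[of _ jp "range Some"])
          (simp only: laplace_wilson(2)[OF chains ordering] laplace_loop_measure)
    qed simp_all
    with net show ?thesis by simp
  qed
  ultimately show ?thesis by blast
qed

end
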